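(* Let $\alpha,\beta,b,\sigma,f,g$ and the families $\mathcal Z,\mathcal Z^{\alpha,\beta},\mathcal Z_h,\mathcal Z_h^\beta$ be as in the context. Assume: (i) there exists a unique minimizer $\zeta^*\in\mathcal Z$ of $\zeta\mapsto\Phi_1(\zeta)$ over $\mathcal Z$, it belongs to $\mathcal Z^{\alpha,\beta}$, and $\mathrm{Var}(\mathcal Y_0^{\zeta^*})=0$; (ii) for all $\mu\ge 0$ there exists a collection of minimizers $\zeta^*_{\mu,h}\in\mathcal Z_h$, $h\in(0,1)$, of $\zeta\mapsto\Phi_{\mu,h}(\zeta)$ over $\mathcal Z_h$, such that $\zeta^*_{\mu,h}\in\mathcal Z_h^\beta$ for each $h$ and $\sup_{h\in(0,1)}|||\hat\zeta^*_{\mu,h}|||_{0,\beta}<\infty$. Let $\alpha>0$ and $\lambda>0$. Write $(X,Y,Z):=(X^{\zeta^*},Y^{\zeta^*},Z^{\zeta^*})$ and $(X^{h,\lambda},Y^{h,\lambda},Z^{h,\lambda}):=(X^{h,\zeta^*_{\lambda,h}},Y^{h,\zeta^*_{\lambda,h}},Z^{h,\zeta^*_{\lambda,h}})$. Then there exists a constant $C$, independent of $h$, such that $$\big\|X-\hat X^{h,\lambda}\big\|_{\mathcal S^2(\mathbb R^d)}+\big\|Y-\hat Y^{h,\lambda}\big\|_{\mathcal S^2(\mathbb R)}+\big\|Z-\hat Z^{h,\lambda}\big\|_{\mathcal H^2(\mathbb R^k)}\le C\Bigg(h^{\frac\alpha2}+\max_{n=0,\dots,N_h}\Big(\mathbb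 E\Big[\big\|\zeta^*(t_n,X_n^{h,\lambda})-\hat\zeta^*_{\lambda,h}(t_n,X_n^{h,\lambda})\big\|^2\Big]\Big)^{\frac12}\Bigg).$$
   Context: **Grid.** $T\in(0,\infty)$, $d,k\in\mathbb N$, $x_0\in\mathbb R^d$. Step sizes $h$ always range over $(0,1)\cap\{T/N:N\ge1\}$ (written $h\in(0,1)$), $N=N_h=T/h$, $t_n=nh$. $(W_t)_{t\in[0,T]}$ is a $k$-dimensional Brownian motion on a filtered probability space $(\Omega,\mathcal F,(\mathcal F_t)_{t\in[0,T]},\mathbb P)$, $\Delta W_n=W_{t_{n+1}}-W_{t_n}$, and $\mathcal F^h_n=\sigma(\Delta W_m:m=0,\dots,n-1)$. **Process spaces.** $\mathcal S^2(\mathbb R^q)$, $\mathcal H^2(\mathbb R^q)$: progressively measurable $y,z:[0,T]\times\Omega\to\mathbb R^q$ with $\|y\|_{\mathcal S^2(\mathbb R^q)}=\sup_{t\in[0,T]}(\mathbb E\|y_t\|^2)^{1/2}<\infty$, respectively $\|z\|_{\mathcal H^2(\mathbb R^q)}=(\mathbb E\int_0^T\|z_t\|^2dt)^{1/2}<\infty$. $\mathcal S_h^2(\mathbb R^q)$: $\mathcal F^h$-adapted, square integrable discrete-time processes on the grid indices with values in $\mathbb R^q$. **Function spaces.** For functions of several variables, $|\phi|_{\gamma}=\sup\|\partial^\gamma\phi\|$ for a multi-index $\gamma$ (one index per variable). Only derivatives whose multi-index has exactly one non-zero entry are considered (no condition on mixed derivatives, nor boundedness of $\phi$ itself). $C_{\mathrm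 b}^{\ell}$ (resp. $C_{\mathrm b}^{0,\ell_1,\ell_2}$, etc.): functions whose derivatives up to the indicated order in each variable exist, are continuous, and (for the multi-indices just described) are bounded. For $\alpha\in(0,1]$, $C_{\mathrm{H,b}}^{\alpha,\ell_1,\ell_2}([0,T]\times S_1\times S_2;S_3)$ is the space of $\phi$ that are $\alpha$-Hölder continuous in time, with continuous bounded derivatives up to orders $\ell_1,\ell_2$ in the two space variables, and with $$|||\phi|||_{\alpha,\ell_1,\ell_2}=\sup_t\|\phi(t,0,0)\|+\sum_\gamma\sup_t|\phi(t,\cdot,\cdot)|_\gamma+\sup_{x_1,x_2}\sup_{t_1\ne t_2}\frac{\mathbf 1_{(0,1]}(\alpha)\|\phi(t_1,x_1,x_2)-\phi(t_2,x_1,x_2)\|}{(1+\|x_1\|+\|x_2\|)|t_2-t_1|^\alpha}<\infty,$$ the sum being over $\gamma=(i,0)$, $1\le i\le\ell_1$, and $\gamma=(0,i)$, $1\le i\le\ell_2$. For $\alpha=0$, $C_{\mathrm{H,b}}^{0,\ell_1,\ell_2}=C_{\mathrm b}^{0,\ell_1,\ell_2}$. With one space variable one index is dropped; e.g. $|||\phi|||_{0,\beta}=\sup_t\|\phi(t,0)\|+\sum_{i=1}^\beta\sup_t|\phi(t,\cdot)|_i$ (this formula is also used for $\phi$ piecewise constant in $t$). **Coefficients.** Either $(\alpha,\beta)\in[0,\frac12]\times\{1\}$ or $(\alpha,\beta)=(1,2)$. $b\in C_{\mathrm{H,b}}^{\alpha,\beta,\beta}([0,T]\times\mathbb R^d\times\mathbb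 R^k;\mathbb R^d)$, $\sigma\in C_{\mathrm{H,b}}^{\alpha,\beta}([0,T]\times\mathbb R^d;\mathbb R^{d\times k})$, $f\in C_{\mathrm{H,b}}^{\alpha,\beta,\beta}([0,T]\times\mathbb R^d\times\mathbb R^k;\mathbb R)$, $g\in C_{\mathrm b}^1(\mathbb R^d;\mathbb R)$. If $\alpha=1$, it is assumed that $\mathrm D_x\sigma=0$. **Continuous problem.** $\mathcal Z$ is the set of measurable $\zeta:[0,T]\times\mathbb R^d\to\mathbb R^k$ for which the following are well defined with $(X^\zeta,Y^\zeta,Z^\zeta)\in\mathcal S^2(\mathbb R^d)\times\mathcal S^2(\mathbb R)\times\mathcal H^2(\mathbb R^k)$: for all $t\in[0,T]$, a.s., $$X_t^\zeta=x_0+\int_0^tb(s,X_s^\zeta,Z_s^\zeta)ds+\int_0^t\sigma(s,X_s^\zeta)dW_s,\quad Z_t^\zeta=\zeta(t,X_t^\zeta),$$ $$\mathcal Y_0^\zeta=g(X_T^\zeta)+\int_0^Tf(t,X_t^\zeta,Z_t^\zeta)dt-\int_0^T\langle Z_t^\zeta,dW_t\rangle,\quad Y_t^\zeta=\mathbb E[\mathcal Y_0^\zeta]-\int_0^tf(s,X_s^\zeta,Z_s^\zeta)ds+\int_0^t\langle Z_s^\zeta,dW_s\rangle.$$ $\mathcal Z^{\alpha,\beta}=\mathcal Z\cap C_{\mathrm{H,b}}^{\alpha,\beta}([0,T]\times\mathbb R^d;\mathbb R^k)$ and $\Phi_\lambda(\zeta)=\mathbb E[\mathcal Y_0^\zeta]+\lambda\mathrm{Var}[\mathcal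 Y_0^\zeta]$. **Discrete problem.** $\mathcal Z_h$ is the set of measurable $\zeta:\{0,\dots,N_h-1\}\times\mathbb R^d\to\mathbb R^k$, $\zeta_n=\zeta(n,\cdot)$, for which the following are well defined with $X^{h,\zeta}\in\mathcal S_h^2(\mathbb R^d)$, $Y^{h,\zeta}\in\mathcal S_h^2(\mathbb R)$, $Z^{h,\zeta}\in\mathcal S_h^2(\mathbb R^k)$: $$X_n^{h,\zeta}=x_0+\sum_{j=0}^{n-1}b(t_j,X_j^{h,\zeta},Z_j^{h,\zeta})h+\sum_{j=0}^{n-1}\sigma(t_j,X_j^{h,\zeta})\Delta W_j,\quad Z_j^{h,\zeta}=\zeta_j(X_j^{h,\zeta}),$$ $$\mathcal Y_0^{h,\zeta}=g(X_N^{h,\zeta})+\sum_{j=0}^{N-1}f(t_j,X_j^{h,\zeta},Z_j^{h,\zeta})h-\sum_{j=0}^{N-1}\langle Z_j^{h,\zeta},\Delta W_j\rangle,\quad Y_n^{h,\zeta}=\mathbb E[\mathcal Y_0^{h,\zeta}]-\sum_{j=0}^{n-1}f(t_j,X_j^{h,\zeta},Z_j^{h,\zeta})h+\sum_{j=0}^{n-1}\langle Z_j^{h,\zeta},\Delta W_j\rangle.$$ $\mathcal Z_h^\beta$ is the set of $\zeta\in\mathcal Z_h$ with $\zeta_n\in C_{\mathrm b}^\beta(\mathbb R^d;\mathbb R^k)$ for every $n$, and $\Phi_{\lambda,h}(\zeta)=\mathbb E[\mathcal Y_0^{h,\zeta}]+\lambda\mathrm{Var}[\mathcal Y_0^{h,\zeta}]$.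 **Interpolation.** For a function or process $R_h$ on grid indices, $\hat R_{h}$ is its piecewise constant interpolation, $\hat R_{h,t}=R_{h,n}$ for $t\in[t_n,t_{n+1})$, with $\hat R_{h,T}$ equal to the last available value; for $\zeta_h\in\mathcal Z_h$, $\hat\zeta_h(t,x)=\zeta_{h,n}(x)$ for $t\in[t_n,t_{n+1})$ and $\hat\zeta_h(T,x)=\zeta_{h,N-1}(x)$. *)

theory Defs
  imports "HOL-Probability.Probability"
begin

section \<open>Function spaces\<close>

text \<open>
  Iterated Frechet derivatives: \<open>nderiv \<phi> [v\<^sub>1, \<dots>, v\<^sub>i] x\<close> is the \<open>i\<close>-th Frechet derivative of
  \<open>\<phi>\<close> at \<open>x\<close>, an \<open>i\<close>-linear map, evaluated at the directions \<open>v\<^sub>1, \<dots>, v\<^sub>i\<close>.  It is meaningful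
  only where \<open>diff_upto\<close> holds.
\<close>

fun nderiv :: "('a::real_normed_vector \<Rightarrow> 'b::real_normed_vector) \<Rightarrow> 'a list \<Rightarrow> 'a \<Rightarrow> 'b" where
  "nderiv \<phi> [] x = \<phi> x"
| "nderiv \<phi> (v # vs) x = frechet_derivative (nderiv \<phi> vs) (at x) v"

definition diff_upto :: "nat \<Rightarrow> ('a::real_normed_vector \<Rightarrow> 'b::real_normed_vector) \<Rightarrow> bool" where
  "diff_upto l \<phi> \<longleftrightarrow> (\<forall>vs x. length vs < l \<longrightarrow> nderiv \<phi> vs differentiable (at x))"

text \<open>The operator norm of the \<open>i\<close>-th derivative at a point, and its supremum over the space.\<close>

definition nderiv_norm ::
  "nat \<Rightarrow> ('a::real_normed_vector \<Rightarrow> 'b::real_normed_vector) \<Rightarrow> 'a \<Rightarrow> ennreal" where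
  "nderiv_norm i \<phi> x =
     (SUP vs\<in>{vs. length vs = i \<and> (\<forall>v\<in>set vs. norm v \<le> 1)}. ennreal (norm (nderiv \<phi> vs x)))"

definition dseminorm ::
  "nat \<Rightarrow> ('a::real_normed_vector \<Rightarrow> 'b::real_normed_vector) \<Rightarrow> ennreal" where
  "dseminorm i \<phi> = (SUP x. nderiv_norm i \<phi> x)"

definition Cb :: "nat \<Rightarrow> ('a::real_normed_vector \<Rightarrow> 'b::real_normed_vector) set" where
  "Cb l = {\<phi>. diff_upto l \<phi> \<and>
     (\<forall>vs. length vs \<le> l \<longrightarrow> continuous_on UNIV (nderiv \<phi> vs)) \<and>
     (\<forall>i\<in>{1..l}. dseminorm i \<phi> < \<infinity>)}"

text \<open>
  The norms \<open>|||\<cdot>|||\<close> and the spaces \<open>C\<^sub>H\<^sub>,\<^sub>b\<close> for time-dependent functions of one and of two space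
  variables.  The time argument is restricted to \<open>{0..T}\<close>.  Derivatives (including the order-\<open>0\<close>
  one, the function itself) are required to be jointly continuous in all arguments.  For \<open>\<alpha> = 0\<close>
  the Hoelder term is absent, and then the term at the origin is automatically finite, by continuity
  on the compact interval; hence \<open>CHb1\<close> and \<open>CHb2\<close> with \<open>\<alpha> = 0\<close> are the spaces
  of functions with bounded continuous derivatives, without a condition on the function itself.
\<close>

definition triple_norm1 ::
  "real \<Rightarrow> real \<Rightarrow> nat \<Rightarrow> (real \<Rightarrow> 'a::real_normed_vector \<Rightarrow> 'c::real_normed_vector) \<Rightarrow> ennreal" where
  "triple_norm1 T \<alpha> l \<phi> =
     (SUP t\<in>{0..T}. ennreal (norm (\<phi> t 0)))
     + (\<Sum>i=1..l. SUP t\<in>{0..T}. dseminorm i (\<phi> t))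
     + (if 0 < \<alpha> then
          (SUP x. SUP t\<in>{0..T}. SUP s\<in>{0..T} - {t}.
             ennreal (norm (\<phi> t x - \<phi> s x) / ((1 + norm x) * \<bar>s - t\<bar> powr \<alpha>)))
        else 0)"

definition triple_norm2 ::
  "real \<Rightarrow> real \<Rightarrow> nat \<Rightarrow> nat \<Rightarrow>
   (real \<Rightarrow> 'a::real_normed_vector \<Rightarrow> 'b::real_normed_vector \<Rightarrow> 'c::real_normed_vector) \<Rightarrow> ennreal" where
  "triple_norm2 T \<alpha> l\<^sub>1 l\<^sub>2 \<phi> =
     (SUP t\<in>{0..T}. ennreal (norm (\<phi> t 0 0)))
     + (\<Sum>i=1..l\<^sub>1. SUP t\<in>{0..T}. SUP z. dseminorm i (\<lambda>x. \<phi> t x z))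
     + (\<Sum>i=1..l\<^sub>2. SUP t\<in>{0..T}. SUP x. dseminorm i (\<lambda>z. \<phi> t x z))
     + (if 0 < \<alpha> then
          (SUP x. SUP z. SUP t\<in>{0..T}. SUP s\<in>{0..T} - {t}.
             ennreal (norm (\<phi> t x z - \<phi> s x z) / ((1 + norm x + norm z) * \<bar>s - t\<bar> powr \<alpha>)))
        else 0)"

definition CHb1 ::
  "real \<Rightarrow> real \<Rightarrow> nat \<Rightarrow> (real \<Rightarrow> 'a::real_normed_vector \<Rightarrow> 'c::real_normed_vector) set" where
  "CHb1 T \<alpha> l = {\<phi>.
     (\<forall>t\<in>{0..T}. diff_upto l (\<phi> t)) \<and>
     (\<forall>vs. length vs \<le> l \<longrightarrow> continuous_on ({0..T} \<times> UNIV) (\<lambda>(t, x). nderiv (\<phi> t) vs x)) \<and>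
     triple_norm1 T \<alpha> l \<phi> < \<infinity>}"

definition CHb2 ::
  "real \<Rightarrow> real \<Rightarrow> nat \<Rightarrow> nat \<Rightarrow>
   (real \<Rightarrow> 'a::real_normed_vector \<Rightarrow> 'b::real_normed_vector \<Rightarrow> 'c::real_normed_vector) set" where
  "CHb2 T \<alpha> l\<^sub>1 l\<^sub>2 = {\<phi>.
     (\<forall>t\<in>{0..T}. \<forall>z. diff_upto l\<^sub>1 (\<lambda>x. \<phi> t x z)) \<and>
     (\<forall>t\<in>{0..T}. \<forall>x. diff_upto l\<^sub>2 (\<lambda>z. \<phi> t x z)) \<and>
     (\<forall>vs. length vs \<le> l\<^sub>1 \<longrightarrow>
        continuous_on ({0..T} \<times> UNIV \<times> UNIV) (\<lambda>(t, x, z). nderiv (\<lambda>x. \<phi> t x z) vs x)) \<and>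
     (\<forall>vs. length vs \<le> l\<^sub>2 \<longrightarrow>
        continuous_on ({0..T} \<times> UNIV \<times> UNIV) (\<lambda>(t, x, z). nderiv (\<lambda>z. \<phi> t x z) vs z)) \<and>
     triple_norm2 T \<alpha> l\<^sub>1 l\<^sub>2 \<phi> < \<infinity>}"


section \<open>Data of the problem\<close>

text \<open>
  The record collects \<open>(\<Omega>, \<F>, \<P>)\<close>, \<open>T\<close>, \<open>(\<F>\<^sub>t)\<close>, \<open>W\<close>, \<open>x\<^sub>0\<close>, \<open>b\<close>, \<open>\<sigma>\<close>, \<open>f\<close>, \<open>g\<close>, in this order.  Functions of
  time are total on \<open>real\<close>; only their restrictions to \<open>{0..T}\<close> matter.
\<close>

record ('w, 'd::finite, 'k::finite) control_problem =
  pspace :: "'w measure"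
  horizon :: real
  filt :: "real \<Rightarrow> 'w measure"
  bm :: "real \<Rightarrow> 'w \<Rightarrow> real^'k"
  init :: "real^'d"
  drift :: "real \<Rightarrow> real^'d \<Rightarrow> real^'k \<Rightarrow> real^'d"
  diffusion :: "real \<Rightarrow> real^'d \<Rightarrow> real^'k^'d"
  driver :: "real \<Rightarrow> real^'d \<Rightarrow> real^'k \<Rightarrow> real"
  terminal :: "real^'d \<Rightarrow> real"

definition filtered_prob_space :: "('w, 'd::finite, 'k::finite) control_problem \<Rightarrow> bool" where
  "filtered_prob_space P \<longleftrightarrow>
     prob_space (pspace P) \<and>
     (\<forall>t\<in>{0..horizon P}. subalgebra (pspace P) (filt P t)) \<and>
     (\<forall>s t. 0 \<le> s \<and> s \<le> t \<and> t \<le> horizon P \<longrightarrow> sets (filt P s) \<subseteq> sets (filt P t))"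

definition brownian_motion :: "('w, 'd::finite, 'k::finite) control_problem \<Rightarrow> bool" where
  "brownian_motion P \<longleftrightarrow>
     (\<forall>t\<in>{0..horizon P}. bm P t \<in> borel_measurable (filt P t)) \<and>
     (AE \<omega> in pspace P. bm P 0 \<omega> = 0) \<and>
     (AE \<omega> in pspace P. continuous_on {0..horizon P} (\<lambda>t. bm P t \<omega>)) \<and>
     (\<forall>s t. 0 \<le> s \<and> s < t \<and> t \<le> horizon P \<longrightarrow>
        prob_space.indep_set (pspace P) (sets (filt P s))
          (sets (vimage_algebra (space (pspace P)) (\<lambda>\<omega>. bm P t \<omega> - bm P s \<omega>) borel)) \<and>
        prob_space.indep_vars (pspace P) (\<lambda>_. borel) (\<lambda>j \<omega>. (bm P t \<omega> - bm P s \<omega>) $ j) UNIV \<and>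
        (\<forall>j. distributed (pspace P) lborel (\<lambda>\<omega>. (bm P t \<omega> - bm P s \<omega>) $ j)
               (\<lambda>x. ennreal (normal_density 0 (sqrt (t - s)) x))))"


section \<open>Process spaces\<close>

text \<open>The norms take values in \<open>ennreal\<close>, so that no integrability is presupposed.\<close>

definition ennsqrt :: "ennreal \<Rightarrow> ennreal" where
  "ennsqrt x = (if x = \<infinity> then \<infinity> else ennreal (sqrt (enn2real x)))"

definition progressive ::
  "('w, 'd::finite, 'k::finite) control_problem \<Rightarrow> (real \<Rightarrow> 'w \<Rightarrow> 'e::euclidean_space) \<Rightarrow> bool" where
  "progressive P y \<longleftrightarrow> (\<forall>t\<in>{0..horizon P}.
     (\<lambda>(s, \<omega>). y s \<omega>) \<in> borel_measurable (restrict_space borel {0..t} \<Otimes>\<^sub>M filt P t))"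

definition S2_norm ::
  "('w, 'd::finite, 'k::finite) control_problem \<Rightarrow> (real \<Rightarrow> 'w \<Rightarrow> 'e::euclidean_space) \<Rightarrow> ennreal" where
  "S2_norm P y =
     (SUP t\<in>{0..horizon P}. ennsqrt (\<integral>\<^sup>+ \<omega>. ennreal ((norm (y t \<omega>))\<^sup>2) \<partial>pspace P))"

definition H2_norm ::
  "('w, 'd::finite, 'k::finite) control_problem \<Rightarrow> (real \<Rightarrow> 'w \<Rightarrow> 'e::euclidean_space) \<Rightarrow> ennreal" where
  "H2_norm P z = ennsqrt (\<integral>\<^sup>+ \<omega>.
     (\<integral>\<^sup>+ t. ennreal ((norm (z t \<omega>))\<^sup>2) * indicator {0..horizon P} t \<partial>lborel) \<partial>pspace P)"

definition S2 ::
  "('w, 'd::finite, 'k::finite) control_problem \<Rightarrow> (real \<Rightarrow> 'w \<Rightarrow> 'e::euclidean_space) set" where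
  "S2 P = {y. progressive P y \<and> S2_norm P y < \<infinity>}"

definition H2 ::
  "('w, 'd::finite, 'k::finite) control_problem \<Rightarrow> (real \<Rightarrow> 'w \<Rightarrow> 'e::euclidean_space) set" where
  "H2 P = {z. progressive P z \<and> H2_norm P z < \<infinity>}"


section \<open>The Ito integral\<close>

text \<open>
  The usual construction: the integral of \<open>z \<in> \<H>\<^sup>2\<close> is the mean-square limit of
  the elementary integrals of simple processes
  \<open>\<Sum>\<^bsub>i<n\<^esub> \<xi>\<^sub>i 1\<^bsub>(\<tau>\<^sub>i, \<tau>\<^sub>i\<^sub>+\<^sub>1]\<^esub>\<close> which converge to \<open>z\<close> in
  \<open>\<H>\<^sup>2\<close>, with \<open>\<xi>\<^sub>i\<close> square integrable and \<open>\<F>\<^bsub>\<tau>\<^sub>i\<^esub>\<close>-measurable.  It is determined up to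
  null sets.
\<close>

definition simple_data ::
  "('w, 'd::finite, 'k::finite) control_problem \<Rightarrow>
   nat \<Rightarrow> (nat \<Rightarrow> real) \<Rightarrow> (nat \<Rightarrow> 'w \<Rightarrow> real^'k) \<Rightarrow> bool" where
  "simple_data P n \<tau> \<xi> \<longleftrightarrow>
     0 \<le> \<tau> 0 \<and> (\<forall>i<n. \<tau> i \<le> \<tau> (Suc i)) \<and> \<tau> n \<le> horizon P \<and>
     (\<forall>i<n. \<xi> i \<in> borel_measurable (filt P (\<tau> i)) \<and>
            integrable (pspace P) (\<lambda>\<omega>. (norm (\<xi> i \<omega>))\<^sup>2))"

definition simple_process ::
  "nat \<Rightarrow> (nat \<Rightarrow> real) \<Rightarrow> (nat \<Rightarrow> 'w \<Rightarrow> real^'k::finite) \<Rightarrow> real \<Rightarrow> 'w \<Rightarrow> real^'k" where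
  "simple_process n \<tau> \<xi> t \<omega> = (\<Sum>i<n. indicator {\<tau> i<..\<tau> (Suc i)} t *\<^sub>R \<xi> i \<omega>)"

definition simple_integral ::
  "('w, 'd::finite, 'k::finite) control_problem \<Rightarrow>
   nat \<Rightarrow> (nat \<Rightarrow> real) \<Rightarrow> (nat \<Rightarrow> 'w \<Rightarrow> real^'k) \<Rightarrow> real \<Rightarrow> 'w \<Rightarrow> real" where
  "simple_integral P n \<tau> \<xi> t \<omega> =
     (\<Sum>i<n. \<xi> i \<omega> \<bullet> (bm P (min (\<tau> (Suc i)) t) \<omega> - bm P (min (\<tau> i) t) \<omega>))"

definition has_ito_integral ::
  "('w, 'd::finite, 'k::finite) control_problem \<Rightarrow>
   (real \<Rightarrow> 'w \<Rightarrow> real^'k) \<Rightarrow> real \<Rightarrow> ('w \<Rightarrow> real) \<Rightarrow> bool" where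
  "has_ito_integral P z t I \<longleftrightarrow>
     z \<in> H2 P \<and> I \<in> borel_measurable (pspace P) \<and>
     (\<exists>n \<tau> \<xi>. (\<forall>m. simple_data P (n m) (\<tau> m) (\<xi> m)) \<and>
        (\<lambda>m. H2_norm P (\<lambda>s \<omega>. simple_process (n m) (\<tau> m) (\<xi> m) s \<omega> - z s \<omega>)) \<longlonglongrightarrow> 0 \<and>
        (\<lambda>m. \<integral>\<^sup>+ \<omega>. ennreal ((simple_integral P (n m) (\<tau> m) (\<xi> m) t \<omega> - I \<omega>)\<^sup>2) \<partial>pspace P)
          \<longlonglongrightarrow> 0)"

definition ito_integrable ::
  "('w, 'd::finite, 'k::finite) control_problem \<Rightarrow> (real \<Rightarrow> 'w \<Rightarrow> real^'k) \<Rightarrow> bool" where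
  "ito_integrable P z \<longleftrightarrow> (\<forall>t\<in>{0..horizon P}. \<exists>I. has_ito_integral P z t I)"

text \<open>\<open>ito_integral P z t\<close> is \<open>\<integral>\<^sub>0\<^sup>t \<langle>z\<^sub>s, dW\<^sub>s\<rangle>\<close>; a matrix-valued integrand is integrated row by row.\<close>

definition ito_integral ::
  "('w, 'd::finite, 'k::finite) control_problem \<Rightarrow>
   (real \<Rightarrow> 'w \<Rightarrow> real^'k) \<Rightarrow> real \<Rightarrow> 'w \<Rightarrow> real" where
  "ito_integral P z t = (SOME I. has_ito_integral P z t I)"

definition ito_integral_vec ::
  "('w, 'd::finite, 'k::finite) control_problem \<Rightarrow>
   (real \<Rightarrow> 'w \<Rightarrow> real^'k^'d) \<Rightarrow> real \<Rightarrow> 'w \<Rightarrow> real^'d" where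
  "ito_integral_vec P H t \<omega> = (\<chi> i. ito_integral P (\<lambda>s \<omega>. H s \<omega> $ i) t \<omega>)"


section \<open>The continuous problem\<close>

definition cost ::
  "('w, 'd::finite, 'k::finite) control_problem \<Rightarrow>
   (real \<Rightarrow> 'w \<Rightarrow> real^'d) \<Rightarrow> (real \<Rightarrow> 'w \<Rightarrow> real^'k) \<Rightarrow> 'w \<Rightarrow> real" where
  "cost P X Z \<omega> =
     terminal P (X (horizon P) \<omega>)
     + (LINT t:{0..horizon P}|lborel. driver P t (X t \<omega>) (Z t \<omega>))
     - ito_integral P Z (horizon P) \<omega>"

text \<open>
  \<open>solves P \<zeta> X Y Z\<close>: all integrals in the system are well defined and \<open>(X, Y, Z)\<close> satisfies
  the system controlled by \<open>\<zeta>\<close>.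
\<close>

definition solves ::
  "('w, 'd::finite, 'k::finite) control_problem \<Rightarrow> (real \<Rightarrow> real^'d \<Rightarrow> real^'k) \<Rightarrow>
   (real \<Rightarrow> 'w \<Rightarrow> real^'d) \<Rightarrow> (real \<Rightarrow> 'w \<Rightarrow> real) \<Rightarrow> (real \<Rightarrow> 'w \<Rightarrow> real^'k) \<Rightarrow> bool" where
  "solves P \<zeta> X Y Z \<longleftrightarrow>
     X \<in> S2 P \<and> Y \<in> S2 P \<and> Z \<in> H2 P \<and>
     (AE \<omega> in pspace P. set_integrable lborel {0..horizon P} (\<lambda>s. drift P s (X s \<omega>) (Z s \<omega>))) \<and>
     (AE \<omega> in pspace P. set_integrable lborel {0..horizon P} (\<lambda>s. driver P s (X s \<omega>) (Z s \<omega>))) \<and>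
     (\<forall>i. ito_integrable P (\<lambda>s \<omega>. diffusion P s (X s \<omega>) $ i)) \<and>
     ito_integrable P Z \<and>
     integrable (pspace P) (cost P X Z) \<and>
     (\<forall>t\<in>{0..horizon P}. AE \<omega> in pspace P.
        X t \<omega> = init P + (LINT s:{0..t}|lborel. drift P s (X s \<omega>) (Z s \<omega>))
                + ito_integral_vec P (\<lambda>s \<omega>. diffusion P s (X s \<omega>)) t \<omega>) \<and>
     (\<forall>t\<in>{0..horizon P}. AE \<omega> in pspace P. Z t \<omega> = \<zeta> t (X t \<omega>)) \<and>
     (\<forall>t\<in>{0..horizon P}. AE \<omega> in pspace P.
        Y t \<omega> = integral\<^sup>L (pspace P) (cost P X Z)
                - (LINT s:{0..t}|lborel. driver P s (X s \<omega>) (Z s \<omega>))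
                + ito_integral P Z t \<omega>)"

text \<open>
  The set \<open>\<Z>\<close>.  That \<open>X\<^sup>\<zeta>\<close>, \<open>Y\<^sup>\<zeta>\<close>, \<open>Z\<^sup>\<zeta>\<close> are well defined means that the system has
  a solution which is unique up to modification; the choice made in \<open>X_of\<close>, \<open>Y_of\<close>, \<open>Z_of\<close> below
  is then immaterial, since expectations and the two norms do not depend on the modification.
\<close>

definition admissible ::
  "('w, 'd::finite, 'k::finite) control_problem \<Rightarrow> (real \<Rightarrow> real^'d \<Rightarrow> real^'k) set" where
  "admissible P = {\<zeta>.
     (\<lambda>(t, x). \<zeta> t x) \<in> borel_measurable (restrict_space borel {0..horizon P} \<Otimes>\<^sub>M borel) \<and>
     (\<exists>X Y Z. solves P \<zeta> X Y Z) \<and>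
     (\<forall>X Y Z X' Y' Z'. solves P \<zeta> X Y Z \<and> solves P \<zeta> X' Y' Z' \<longrightarrow>
        (\<forall>t\<in>{0..horizon P}. AE \<omega> in pspace P. X t \<omega> = X' t \<omega> \<and> Y t \<omega> = Y' t \<omega> \<and> Z t \<omega> = Z' t \<omega>))}"

definition admissible_smooth ::
  "('w, 'd::finite, 'k::finite) control_problem \<Rightarrow> real \<Rightarrow> nat \<Rightarrow> (real \<Rightarrow> real^'d \<Rightarrow> real^'k) set" where
  "admissible_smooth P \<alpha> \<beta> = admissible P \<inter> CHb1 (horizon P) \<alpha> \<beta>"

definition solution ::
  "('w, 'd::finite, 'k::finite) control_problem \<Rightarrow> (real \<Rightarrow> real^'d \<Rightarrow> real^'k) \<Rightarrow>
   (real \<Rightarrow> 'w \<Rightarrow> real^'d) \<times> (real \<Rightarrow> 'w \<Rightarrow> real) \<times> (real \<Rightarrow> 'w \<Rightarrow> real^'k)" where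
  "solution P \<zeta> = (SOME (X, Y, Z). solves P \<zeta> X Y Z)"

definition X_of ::
  "('w, 'd::finite, 'k::finite) control_problem \<Rightarrow> (real \<Rightarrow> real^'d \<Rightarrow> real^'k) \<Rightarrow>
   real \<Rightarrow> 'w \<Rightarrow> real^'d" where
  "X_of P \<zeta> = fst (solution P \<zeta>)"

definition Y_of ::
  "('w, 'd::finite, 'k::finite) control_problem \<Rightarrow> (real \<Rightarrow> real^'d \<Rightarrow> real^'k) \<Rightarrow>
   real \<Rightarrow> 'w \<Rightarrow> real" where
  "Y_of P \<zeta> = fst (snd (solution P \<zeta>))"

definition Z_of ::
  "('w, 'd::finite, 'k::finite) control_problem \<Rightarrow> (real \<Rightarrow> real^'d \<Rightarrow> real^'k) \<Rightarrow>
   real \<Rightarrow> 'w \<Rightarrow> real^'k" where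
  "Z_of P \<zeta> = snd (snd (solution P \<zeta>))"

definition cost_of ::
  "('w, 'd::finite, 'k::finite) control_problem \<Rightarrow> (real \<Rightarrow> real^'d \<Rightarrow> real^'k) \<Rightarrow> 'w \<Rightarrow> real" where
  "cost_of P \<zeta> = cost P (X_of P \<zeta>) (Z_of P \<zeta>)"

definition Phi ::
  "('w, 'd::finite, 'k::finite) control_problem \<Rightarrow> real \<Rightarrow> (real \<Rightarrow> real^'d \<Rightarrow> real^'k) \<Rightarrow> real" where
  "Phi P \<mu> \<zeta> = integral\<^sup>L (pspace P) (cost_of P \<zeta>)
                + \<mu> * prob_space.variance (pspace P) (cost_of P \<zeta>)"

text \<open>
  Uniqueness of the minimizer is uniqueness of the control process: \<open>\<zeta>\<close> can always be altered
  at a single time without affecting \<open>\<Phi>\<^sub>\<mu>\<close>, so minimizers are never unique as pointwise functions.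
  Maps \<open>\<zeta>\<close> which generate the same element \<open>Z\<^sup>\<zeta>\<close> of \<open>\<H>\<^sup>2\<close> are therefore identified.
\<close>

definition is_unique_minimizer ::
  "('w, 'd::finite, 'k::finite) control_problem \<Rightarrow> real \<Rightarrow> (real \<Rightarrow> real^'d \<Rightarrow> real^'k) \<Rightarrow> bool" where
  "is_unique_minimizer P \<mu> \<zeta> \<longleftrightarrow>
     is_arg_min (Phi P \<mu>) (\<lambda>\<eta>. \<eta> \<in> admissible P) \<zeta> \<and>
     (\<forall>\<eta>. is_arg_min (Phi P \<mu>) (\<lambda>\<eta>. \<eta> \<in> admissible P) \<eta> \<longrightarrow>
        H2_norm P (\<lambda>t \<omega>. Z_of P \<eta> t \<omega> - Z_of P \<zeta> t \<omega>) = 0)"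


section \<open>The discrete problem\<close>

definition step_sizes :: "real \<Rightarrow> real set" where
  "step_sizes T = {0<..<1} \<inter> {T / real N |N. 1 \<le> N}"

text \<open>For \<open>h \<in> step_sizes T\<close> the quotient \<open>T / h\<close> is a natural number.\<close>

definition nsteps :: "real \<Rightarrow> real \<Rightarrow> nat" where
  "nsteps T h = nat \<lfloor>T / h\<rfloor>"

definition grid :: "real \<Rightarrow> nat \<Rightarrow> real" where
  "grid h n = real n * h"

definition dW :: "('w, 'd::finite, 'k::finite) control_problem \<Rightarrow> real \<Rightarrow> nat \<Rightarrow> 'w \<Rightarrow> real^'k" where
  "dW P h n \<omega> = bm P (grid h (Suc n)) \<omega> - bm P (grid h n) \<omega>"

definition dfilt :: "('w, 'd::finite, 'k::finite) control_problem \<Rightarrow> real \<Rightarrow> nat \<Rightarrow> 'w measure" where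
  "dfilt P h n = sigma (space (pspace P))
     {dW P h m -` A \<inter> space (pspace P) |m A. m < n \<and> A \<in> sets borel}"

text \<open>Processes on the grid indices \<open>0, \<dots>, L\<close>.\<close>

definition S2h ::
  "('w, 'd::finite, 'k::finite) control_problem \<Rightarrow> real \<Rightarrow> nat \<Rightarrow>
   (nat \<Rightarrow> 'w \<Rightarrow> 'e::euclidean_space) set" where
  "S2h P h L = {y. \<forall>n\<le>L. y n \<in> borel_measurable (dfilt P h n) \<and>
                         integrable (pspace P) (\<lambda>\<omega>. (norm (y n \<omega>))\<^sup>2)}"

context
  notes sum.cong [fundef_cong]
begin

fun Xh ::
  "('w, 'd::finite, 'k::finite) control_problem \<Rightarrow> real \<Rightarrow> (nat \<Rightarrow> real^'d \<Rightarrow> real^'k) \<Rightarrow>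
   nat \<Rightarrow> 'w \<Rightarrow> real^'d" where
  "Xh P h \<zeta> n \<omega> =
     init P
     + (\<Sum>j<n. h *\<^sub>R drift P (grid h j) (Xh P h \<zeta> j \<omega>) (\<zeta> j (Xh P h \<zeta> j \<omega>)))
     + (\<Sum>j<n. diffusion P (grid h j) (Xh P h \<zeta> j \<omega>) *v dW P h j \<omega>)"

end

declare Xh.simps [simp del]

definition Zh ::
  "('w, 'd::finite, 'k::finite) control_problem \<Rightarrow> real \<Rightarrow> (nat \<Rightarrow> real^'d \<Rightarrow> real^'k) \<Rightarrow>
   nat \<Rightarrow> 'w \<Rightarrow> real^'k" where
  "Zh P h \<zeta> j \<omega> = \<zeta> j (Xh P h \<zeta> j \<omega>)"

definition cost_h ::
  "('w, 'd::finite, 'k::finite) control_problem \<Rightarrow> real \<Rightarrow> (nat \<Rightarrow> real^'d \<Rightarrow> real^'k) \<Rightarrow>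
   'w \<Rightarrow> real" where
  "cost_h P h \<zeta> \<omega> =
     terminal P (Xh P h \<zeta> (nsteps (horizon P) h) \<omega>)
     + (\<Sum>j<nsteps (horizon P) h. driver P (grid h j) (Xh P h \<zeta> j \<omega>) (Zh P h \<zeta> j \<omega>) * h)
     - (\<Sum>j<nsteps (horizon P) h. Zh P h \<zeta> j \<omega> \<bullet> dW P h j \<omega>)"

definition Yh ::
  "('w, 'd::finite, 'k::finite) control_problem \<Rightarrow> real \<Rightarrow> (nat \<Rightarrow> real^'d \<Rightarrow> real^'k) \<Rightarrow>
   nat \<Rightarrow> 'w \<Rightarrow> real" where
  "Yh P h \<zeta> n \<omega> =
     integral\<^sup>L (pspace P) (cost_h P h \<zeta>)
     - (\<Sum>j<n. driver P (grid h j) (Xh P h \<zeta> j \<omega>) (Zh P h \<zeta> j \<omega>) * h)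
     + (\<Sum>j<n. Zh P h \<zeta> j \<omega> \<bullet> dW P h j \<omega>)"

text \<open>The sets \<open>\<Z>\<^sub>h\<close> and \<open>\<Z>\<^sub>h\<^sup>\<beta>\<close>; only \<open>\<zeta> n\<close> with \<open>n < N\<^sub>h\<close> matters.\<close>

definition admissible_h ::
  "('w, 'd::finite, 'k::finite) control_problem \<Rightarrow> real \<Rightarrow> (nat \<Rightarrow> real^'d \<Rightarrow> real^'k) set" where
  "admissible_h P h = {\<zeta>.
     (\<forall>n<nsteps (horizon P) h. \<zeta> n \<in> borel_measurable borel) \<and>
     Xh P h \<zeta> \<in> S2h P h (nsteps (horizon P) h) \<and>
     Yh P h \<zeta> \<in> S2h P h (nsteps (horizon P) h) \<and>
     Zh P h \<zeta> \<in> S2h P h (nsteps (horizon P) h - 1) \<and>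
     integrable (pspace P) (cost_h P h \<zeta>)}"

definition admissible_h_smooth ::
  "('w, 'd::finite, 'k::finite) control_problem \<Rightarrow> real \<Rightarrow> nat \<Rightarrow> (nat \<Rightarrow> real^'d \<Rightarrow> real^'k) set" where
  "admissible_h_smooth P h \<beta> =
     admissible_h P h \<inter> {\<zeta>. \<forall>n<nsteps (horizon P) h. \<zeta> n \<in> Cb \<beta>}"

definition Phi_h ::
  "('w, 'd::finite, 'k::finite) control_problem \<Rightarrow> real \<Rightarrow> real \<Rightarrow>
   (nat \<Rightarrow> real^'d \<Rightarrow> real^'k) \<Rightarrow> real" where
  "Phi_h P \<mu> h \<zeta> = integral\<^sup>L (pspace P) (cost_h P h \<zeta>)
                    + \<mu> * prob_space.variance (pspace P) (cost_h P h \<zeta>)"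

text \<open>
  Piecewise constant interpolation of \<open>R\<^sub>0, \<dots>, R\<^sub>L\<close>: the value is \<open>R\<^sub>n\<close> on \<open>[t\<^sub>n, t\<^sub>n\<^sub>+\<^sub>1)\<close>, where
  \<open>L = N\<^sub>h\<close> or \<open>L = N\<^sub>h - 1\<close> is the last available index, and \<open>R\<^sub>L\<close> at \<open>T\<close>.
\<close>

definition interp :: "real \<Rightarrow> nat \<Rightarrow> (nat \<Rightarrow> 'b) \<Rightarrow> real \<Rightarrow> 'b" where
  "interp h L R t = R (min L (nat \<lfloor>t / h\<rfloor>))"

definition interp_state :: "real \<Rightarrow> real \<Rightarrow> (nat \<Rightarrow> 'b) \<Rightarrow> real \<Rightarrow> 'b" where
  "interp_state T h = interp h (nsteps T h)"

definition interp_control :: "real \<Rightarrow> real \<Rightarrow> (nat \<Rightarrow> 'b) \<Rightarrow> real \<Rightarrow> 'b" where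
  "interp_control T h = interp h (nsteps T h - 1)"

end

theory Submission
  imports Defs
begin

text \<open>
  The estimate is a stability statement for the Euler scheme driven by a perturbed control.  Write
  \<open>\<delta>\<close> for the largest mean-square gap between \<open>\<zeta>*\<close> and the discrete control along the
  discrete state, and \<open>\<phi>(t)\<close> for the mean-square error of the state.  On a grid cell
  \<open>[t\<^sub>j, t\<^sub>j\<^sub>+\<^sub>1)\<close> the coefficients at \<open>(s, X\<^sub>s, Z\<^sub>s)\<close> and at
  \<open>(t\<^sub>j, X\<^sup>h\<^sub>j, Z\<^sup>h\<^sub>j)\<close> differ in mean square by a multiple of
  \<open>h\<^sup>\<alpha> + \<delta> + \<phi>(s)\<close>: the Hoelder condition in time is applied at the point \<open>X\<^sub>s\<close> itself, so no
  regularity of \<open>t \<mapsto> X\<^sub>t\<close> is needed, and \<open>Z\<^sub>s = \<zeta>*(s, X\<^sub>s)\<close> reduces the control to the state.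
  Cauchy-Schwarz for the time integrals and the Ito isometry give
  \<open>\<phi>(t) \<le> C (h\<^sup>\<alpha> + \<delta> + \<integral>\<^sub>0\<^sup>t \<phi>)\<close>; Gronwall's inequality bounds the state error, and the errors of
  \<open>Z\<close> and \<open>Y\<close> follow from the same local estimates.
\<close>

text \<open>All weights from Hoelder continuity and linear growth fall on the continuous state,
  whose second moment is controlled by its S2 norm; this keeps the constants independent of h. For
  the scheme a moment bound depending on h suffices: it only guarantees that \<phi> is bounded,
  which the absorption argument in Gronwall's inequality requires. An Ito integral is accessible
  only as a limit along some unspecified sequence of simple processes, while the Euler sum of
  Brownian increments is exactly an elementary integral. The two are compared by an isometry for the
  difference of two elementary integrals on unrelated partitions, followed by a passage to the
  limit. The mean-square rate h^\<alpha> has two sources. The squared Hoelder factor h^(2\<alpha>)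
  is weakened to h^\<alpha>, and the unfinished cell between the last grid point and t contributes a
  term of order h, which is at most h^\<alpha> since h < 1 and \<alpha> \<le> 1. Taking square roots
  at the very end gives h^(\<alpha>/2).\<close>

section \<open>Lipschitz and Hoelder estimates\<close>

text \<open>Mean value inequality on the convex set \<open>UNIV\<close>. The seminorm tests the
  derivative only on directions of norm at most 1, so the operator norm bound is recovered by
  normalizing the direction.\<close>

lemma dseminorm1_bound:
  fixes \<phi> :: "'a::real_normed_vector \<Rightarrow> 'b::real_normed_vector"
  assumes d: "diff_upto l \<phi>" "1 \<le> l" and B: "dseminorm 1 \<phi> \<le> ennreal B" "0 \<le> B"
  shows "norm (\<phi> x - \<phi> y) \<le> B * norm (x - y)"
proof -
  have nil: "nderiv \<phi> [] = \<phi>" by (rule ext) simp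
  have diff: "\<phi> differentiable (at x)" for x
    using d(1)[unfolded diff_upto_def, rule_format, of "[]" x] d(2) by (simp add: nil)
  have der: "(\<phi> has_derivative frechet_derivative \<phi> (at x)) (at x)" for x
    using diff frechet_derivative_works by blast
  have le1: "norm (frechet_derivative \<phi> (at x) v) \<le> B" if "norm v \<le> 1" for x v
  proof -
    have "ennreal (norm (frechet_derivative \<phi> (at x) v)) \<le> nderiv_norm 1 \<phi> x"
      unfolding nderiv_norm_def using that by (intro SUP_upper2[of "[v]"]) (auto simp: nil)
    also have "\<dots> \<le> dseminorm 1 \<phi>"
      unfolding dseminorm_def by (rule SUP_upper) simp
    finally show ?thesis using B by (simp add: order.trans[of _ "dseminorm 1 \<phi>"] flip: ennreal_le_iff)
  qed
  have on: "onorm (frechet_derivative \<phi> (at x)) \<le> B" for x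
  proof (rule onorm_bound[OF B(2)])
    fix v
    interpret bounded_linear "frechet_derivative \<phi> (at x)"
      using der has_derivative_bounded_linear by blast
    show "norm (frechet_derivative \<phi> (at x) v) \<le> B * norm v"
    proof (cases "v = 0")
      case False
      have "norm (frechet_derivative \<phi> (at x) (v /\<^sub>R norm v)) \<le> B"
        by (rule le1) (use False in simp)
      then show ?thesis using False by (simp add: scaleR field_simps)
    qed (simp add: zero)
  qed
  have "norm (\<phi> x - \<phi> y) \<le> B * norm (x - y)"
    by (rule differentiable_bound[of UNIV \<phi> "\<lambda>x. frechet_derivative \<phi> (at x)"])
       (use der on in auto)
  then show ?thesis .
qed

text \<open>Each summand of the triple norm is at most the whole, so one number serves as Lipschitz
  constant, Hoelder constant and bound at the origin. The triangle inequality passes through (s, x),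
  which puts the Hoelder weight on x alone; x will be the continuous state.\<close>

lemma CHb1_estimate:
  fixes \<phi> :: "real \<Rightarrow> 'a::real_normed_vector \<Rightarrow> 'c::real_normed_vector"
  assumes \<phi>: "\<phi> \<in> CHb1 T \<alpha> l" and l: "1 \<le> l" and \<alpha>: "0 < \<alpha>"
  obtains K where "0 \<le> K"
    "\<And>t s x y. t \<in> {0..T} \<Longrightarrow> s \<in> {0..T} \<Longrightarrow>
       norm (\<phi> t x - \<phi> s y) \<le> K * (norm (x - y) + (1 + norm x) * \<bar>t - s\<bar> powr \<alpha>)"
    "\<And>t x. t \<in> {0..T} \<Longrightarrow> norm (\<phi> t x) \<le> K * (1 + norm x)"
proof -
  define K where "K = enn2real (triple_norm1 T \<alpha> l \<phi>)"
  have K: "triple_norm1 T \<alpha> l \<phi> = ennreal K" "0 \<le> K"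
    using \<phi> by (auto simp: CHb1_def K_def)
  have lip: "norm (\<phi> t x - \<phi> t y) \<le> K * norm (x - y)" if t: "t \<in> {0..T}" for t x y
  proof (rule dseminorm1_bound[of l])
    have "dseminorm 1 (\<phi> t) \<le> (\<Sum>i=1..l. SUP t\<in>{0..T}. dseminorm i (\<phi> t))"
      using t l by (intro order.trans[OF SUP_upper[OF t, of "\<lambda>t. dseminorm 1 (\<phi> t)"]] member_le_sum[of 1 _ "\<lambda>i. SUP t\<in>{0..T}. dseminorm i (\<phi> t)"]) auto
    also have "\<dots> \<le> triple_norm1 T \<alpha> l \<phi>"
      unfolding triple_norm1_def by (rule add_increasing2[OF zero_le add_increasing[OF zero_le order.refl]])
    finally show "dseminorm 1 (\<phi> t) \<le> ennreal K" by (simp add: K)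
  qed (use \<phi> t l K in \<open>auto simp: CHb1_def\<close>)
  have hoel: "norm (\<phi> t x - \<phi> s x) \<le> K * ((1 + norm x) * \<bar>t - s\<bar> powr \<alpha>)"
    if t: "t \<in> {0..T}" "s \<in> {0..T}" for t s x
  proof (cases "s = t")
    case False
    have "ennreal (norm (\<phi> t x - \<phi> s x) / ((1 + norm x) * \<bar>s - t\<bar> powr \<alpha>))
      \<le> (SUP x. SUP t\<in>{0..T}. SUP s\<in>{0..T} - {t}.
             ennreal (norm (\<phi> t x - \<phi> s x) / ((1 + norm x) * \<bar>s - t\<bar> powr \<alpha>)))"
      by (rule SUP_upper2[of x], simp, rule SUP_upper2[OF t(1)], rule SUP_upper2[of s])
         (use False t in auto)
    also have "\<dots> \<le> triple_norm1 T \<alpha> l \<phi>"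
      unfolding triple_norm1_def if_P[OF \<alpha>] by (rule add_increasing[OF zero_le order.refl])
    finally have "norm (\<phi> t x - \<phi> s x) / ((1 + norm x) * \<bar>s - t\<bar> powr \<alpha>) \<le> K"
      using K by simp
    moreover have "0 < (1 + norm x) * \<bar>s - t\<bar> powr \<alpha>"
      using False by (intro mult_pos_pos) (auto simp: add_pos_nonneg)
    ultimately show ?thesis by (simp add: pos_divide_le_eq abs_minus_commute mult.commute)
  qed simp
  have zero: "norm (\<phi> t 0) \<le> K" if "t \<in> {0..T}" for t
  proof -
    have "ennreal (norm (\<phi> t 0)) \<le> (SUP t\<in>{0..T}. ennreal (norm (\<phi> t 0)))"
      by (rule SUP_upper[OF that])
    also have "\<dots> \<le> triple_norm1 T \<alpha> l \<phi>"
      unfolding triple_norm1_def by (rule add_increasing2[OF zero_le add_increasing2[OF zero_le order.refl]])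
    finally show ?thesis using K by simp
  qed
  show ?thesis
  proof (rule that[OF K(2)])
    fix t s x y assume t: "t \<in> {0..T}" "s \<in> {0..T}"
    have "norm (\<phi> t x - \<phi> s y) \<le> norm (\<phi> t x - \<phi> s x) + norm (\<phi> s x - \<phi> s y)"
      by (rule norm_diff_triangle_le[OF order.refl order.refl])
    then show "norm (\<phi> t x - \<phi> s y) \<le> K * (norm (x - y) + (1 + norm x) * \<bar>t - s\<bar> powr \<alpha>)"
      using hoel[OF t, of x] lip[OF t(2), of x y] by (simp add: distrib_left)
  next
    fix t x assume t: "t \<in> {0..T}"
    have "norm (\<phi> t x) \<le> norm (\<phi> t x - \<phi> t 0) + norm (\<phi> t 0)"
      by (metis diff_add_cancel norm_triangle_ineq)
    then show "norm (\<phi> t x) \<le> K * (1 + norm x)"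
      using lip[OF t, of x 0] zero[OF t] by (simp add: distrib_left)
  qed
qed

text \<open>Only the pure partial derivatives are bounded, so time and the two space variables are
  changed one at a time: (t, x, z), (s, x, z), (s, y, z), (s, y, w).\<close>

lemma CHb2_estimate:
  fixes \<phi> :: "real \<Rightarrow> 'a::real_normed_vector \<Rightarrow> 'b::real_normed_vector \<Rightarrow> 'c::real_normed_vector"
  assumes \<phi>: "\<phi> \<in> CHb2 T \<alpha> l m" and l: "1 \<le> l" "1 \<le> m" and \<alpha>: "0 < \<alpha>"
  obtains K where "0 \<le> K"
    "\<And>t s x y z w. t \<in> {0..T} \<Longrightarrow> s \<in> {0..T} \<Longrightarrow>
       norm (\<phi> t x z - \<phi> s y w)
         \<le> K * (norm (x - y) + norm (z - w) + (1 + norm x + norm z) * \<bar>t - s\<bar> powr \<alpha>)"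
    "\<And>t x z. t \<in> {0..T} \<Longrightarrow> norm (\<phi> t x z) \<le> K * (1 + norm x + norm z)"
proof -
  define K where "K = enn2real (triple_norm2 T \<alpha> l m \<phi>)"
  have K: "triple_norm2 T \<alpha> l m \<phi> = ennreal K" "0 \<le> K"
    using \<phi> by (auto simp: CHb2_def K_def)
  have lip1: "norm (\<phi> t x z - \<phi> t y z) \<le> K * norm (x - y)" if t: "t \<in> {0..T}" for t x y z
  proof (rule dseminorm1_bound[of l "\<lambda>x. \<phi> t x z"])
    have "dseminorm 1 (\<lambda>x. \<phi> t x z) \<le> (SUP t\<in>{0..T}. SUP z. dseminorm 1 (\<lambda>x. \<phi> t x z))"
      by (rule SUP_upper2[OF t], rule SUP_upper2[of z]) auto
    also have "\<dots> \<le> (\<Sum>i=1..l. SUP t\<in>{0..T}. SUP z. dseminorm i (\<lambda>x. \<phi> t x z))"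
      using l by (intro member_le_sum[of 1 _ "\<lambda>i. SUP t\<in>{0..T}. SUP z. dseminorm i (\<lambda>x. \<phi> t x z)"]) auto
    also have "\<dots> \<le> triple_norm2 T \<alpha> l m \<phi>"
      unfolding triple_norm2_def by (rule add_increasing2[OF zero_le add_increasing2[OF zero_le add_increasing[OF zero_le order.refl]]])
    finally show "dseminorm 1 (\<lambda>x. \<phi> t x z) \<le> ennreal K" by (simp add: K)
  qed (use \<phi> t l K in \<open>auto simp: CHb2_def\<close>)
  have lip2: "norm (\<phi> t x z - \<phi> t x w) \<le> K * norm (z - w)" if t: "t \<in> {0..T}" for t x z w
  proof (rule dseminorm1_bound[of m "\<lambda>z. \<phi> t x z"])
    have "dseminorm 1 (\<lambda>z. \<phi> t x z) \<le> (SUP t\<in>{0..T}. SUP x. dseminorm 1 (\<lambda>z. \<phi> t x z))"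
      by (rule SUP_upper2[OF t], rule SUP_upper2[of x]) auto
    also have "\<dots> \<le> (\<Sum>i=1..m. SUP t\<in>{0..T}. SUP x. dseminorm i (\<lambda>z. \<phi> t x z))"
      using l by (intro member_le_sum[of 1 _ "\<lambda>i. SUP t\<in>{0..T}. SUP x. dseminorm i (\<lambda>z. \<phi> t x z)"]) auto
    also have "\<dots> \<le> triple_norm2 T \<alpha> l m \<phi>"
      unfolding triple_norm2_def by (rule add_increasing2[OF zero_le add_increasing[OF zero_le order.refl]])
    finally show "dseminorm 1 (\<lambda>z. \<phi> t x z) \<le> ennreal K" by (simp add: K)
  qed (use \<phi> t l K in \<open>auto simp: CHb2_def\<close>)
  have hoel: "norm (\<phi> t x z - \<phi> s x z) \<le> K * ((1 + norm x + norm z) * \<bar>t - s\<bar> powr \<alpha>)"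
    if t: "t \<in> {0..T}" "s \<in> {0..T}" for t s x z
  proof (cases "s = t")
    case False
    have "ennreal (norm (\<phi> t x z - \<phi> s x z) / ((1 + norm x + norm z) * \<bar>s - t\<bar> powr \<alpha>))
      \<le> (SUP x. SUP z. SUP t\<in>{0..T}. SUP s\<in>{0..T} - {t}.
             ennreal (norm (\<phi> t x z - \<phi> s x z) / ((1 + norm x + norm z) * \<bar>s - t\<bar> powr \<alpha>)))"
      by (rule SUP_upper2[of x], simp, rule SUP_upper2[of z], simp, rule SUP_upper2[OF t(1)],
          rule SUP_upper2[of s]) (use False t in auto)
    also have "\<dots> \<le> triple_norm2 T \<alpha> l m \<phi>"
      unfolding triple_norm2_def if_P[OF \<alpha>] by (rule add_increasing[OF zero_le order.refl])
    finally have "norm (\<phi> t x z - \<phi> s x z) / ((1 + norm x + norm z) * \<bar>s - t\<bar> powr \<alpha>) \<le> K"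
      using K by simp
    moreover have "0 < (1 + norm x + norm z) * \<bar>s - t\<bar> powr \<alpha>"
      using False by (intro mult_pos_pos) (auto simp: add_pos_nonneg)
    ultimately show ?thesis by (simp add: pos_divide_le_eq abs_minus_commute mult.commute)
  qed simp
  have zero: "norm (\<phi> t 0 0) \<le> K" if "t \<in> {0..T}" for t
  proof -
    have "ennreal (norm (\<phi> t 0 0)) \<le> (SUP t\<in>{0..T}. ennreal (norm (\<phi> t 0 0)))"
      by (rule SUP_upper[OF that])
    also have "\<dots> \<le> triple_norm2 T \<alpha> l m \<phi>"
      unfolding triple_norm2_def by (rule add_increasing2[OF zero_le add_increasing2[OF zero_le add_increasing2[OF zero_le order.refl]]])
    finally show ?thesis using K by simp
  qed
  show ?thesis
  proof (rule that[OF K(2)])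
    fix t s x y z w assume t: "t \<in> {0..T}" "s \<in> {0..T}"
    have "norm (\<phi> t x z - \<phi> s y w)
        \<le> norm (\<phi> t x z - \<phi> s x z) + (norm (\<phi> s x z - \<phi> s y z) + norm (\<phi> s y z - \<phi> s y w))"
      by (intro norm_diff_triangle_le[OF order.refl] order.refl)
    then show "norm (\<phi> t x z - \<phi> s y w)
         \<le> K * (norm (x - y) + norm (z - w) + (1 + norm x + norm z) * \<bar>t - s\<bar> powr \<alpha>)"
      using hoel[OF t, of x z] lip1[OF t(2), of x z y] lip2[OF t(2), of y z w]
      by (simp add: distrib_left)
  next
    fix t x z assume t: "t \<in> {0..T}"
    have "norm (\<phi> t x z - 0) \<le> norm (\<phi> t x z - \<phi> t 0 z) + (norm (\<phi> t 0 z - \<phi> t 0 0) + norm (\<phi> t 0 0 - 0))"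
      by (intro norm_diff_triangle_le[OF order.refl] order.refl)
    then show "norm (\<phi> t x z) \<le> K * (1 + norm x + norm z)"
      using lip1[OF t, of x z 0] lip2[OF t, of 0 z 0] zero[OF t] by (simp add: distrib_left)
  qed
qed

lemma Cb_lipschitz:
  assumes "\<phi> \<in> Cb 1"
  obtains K where "0 \<le> K" "\<And>x y. norm (\<phi> x - \<phi> y) \<le> K * norm (x - y)"
proof -
  define K where "K = enn2real (dseminorm 1 \<phi>)"
  have "dseminorm 1 \<phi> = ennreal K"
    using assms by (auto simp: Cb_def K_def)
  then show ?thesis
    using dseminorm1_bound[of 1 \<phi> K] assms that[of K] by (auto simp: Cb_def K_def)
qed

section \<open>The Ito isometry\<close>

lemma borel_measurable_vec_component [measurable (raw)]:
  fixes f :: "'w \<Rightarrow> 'a::euclidean_space^'n"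
  assumes "f \<in> borel_measurable N"
  shows "(\<lambda>\<omega>. f \<omega> $ i) \<in> borel_measurable N"
  by (rule measurable_compose[OF assms]) (intro borel_measurable_continuous_onI continuous_intros)

lemma integral_double_sum:
  fixes f :: "'i \<Rightarrow> 'j \<Rightarrow> 'a \<Rightarrow> real"
  assumes "\<And>i j. i \<in> I \<Longrightarrow> j \<in> J \<Longrightarrow> integrable N (f i j)"
  shows "(\<integral>x. (\<Sum>i\<in>I. \<Sum>j\<in>J. f i j x) \<partial>N) = (\<Sum>i\<in>I. \<Sum>j\<in>J. \<integral>x. f i j x \<partial>N)"
  using assms by (simp add: Bochner_Integration.integral_sum Bochner_Integration.integrable_sum)

locale brownian_setup =
  fixes P :: "('w, 'd::finite, 'k::finite) control_problem"
  assumes horizon_pos: "0 < horizon P"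
    and filtered: "filtered_prob_space P"
    and brownian: "brownian_motion P"
begin

abbreviation "T \<equiv> horizon P"
abbreviation "M \<equiv> pspace P"
abbreviation "W \<equiv> bm P"

sublocale prob_space M
  using filtered by (simp add: filtered_prob_space_def)

lemma filt_subalgebra: "t \<in> {0..T} \<Longrightarrow> subalgebra M (filt P t)"
  using filtered by (simp add: filtered_prob_space_def)

lemma measurable_filt_pspace: "f \<in> measurable (filt P t) N \<Longrightarrow> t \<in> {0..T} \<Longrightarrow> f \<in> measurable M N"
  using filt_subalgebra measurable_from_subalg by blast

lemma measurable_filt_mono:
  assumes "f \<in> measurable (filt P s) N" "0 \<le> s" "s \<le> t" "t \<le> T"
  shows "f \<in> measurable (filt P t) N"
proof (rule measurable_from_subalg[OF _ assms(1)])
  show "subalgebra (filt P t) (filt P s)"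
    using assms filtered filt_subalgebra[of s] filt_subalgebra[of t]
    by (auto simp: subalgebra_def filtered_prob_space_def)
qed

lemma bm_measurable_filt: "t \<in> {0..T} \<Longrightarrow> W t \<in> borel_measurable (filt P t)"
  using brownian by (simp add: brownian_motion_def)

lemma bm_measurable [measurable]: "t \<in> {0..T} \<Longrightarrow> W t \<in> borel_measurable M"
  using bm_measurable_filt measurable_filt_pspace by blast

lemma increment_measurable_filt:
  assumes "0 \<le> a" "a \<le> b" "b \<le> T"
  shows "(\<lambda>\<omega>. W b \<omega> - W a \<omega>) \<in> borel_measurable (filt P b)"
  using assms measurable_filt_mono[OF bm_measurable_filt[of a], of b]
  by (intro borel_measurable_diff bm_measurable_filt) auto

text \<open>Independence is given between two sigma-algebras and is inherited by the smaller ones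
  generated by \<open>U\<close> and by \<open>g\<close> of the increment. The free \<open>g\<close>
  will be a coordinate or a product of two coordinates.\<close>

lemma indep_var_increment:
  fixes U :: "'w \<Rightarrow> real" and g :: "real^'k \<Rightarrow> real"
  assumes ab: "0 \<le> a" "a < b" "b \<le> T"
    and U: "U \<in> borel_measurable (filt P a)" and g: "g \<in> borel_measurable borel"
  shows "indep_var borel U borel (\<lambda>\<omega>. g (W b \<omega> - W a \<omega>))"
proof -
  have a: "a \<in> {0..T}" and b: "b \<in> {0..T}" using ab by auto
  note sp = filt_subalgebra[OF a, unfolded subalgebra_def]
  have UM: "U \<in> borel_measurable M" using measurable_filt_pspace[OF U a] .
  define V where "V = vimage_algebra (space M) (\<lambda>\<omega>. W b \<omega> - W a \<omega>) (borel :: (real^'k) measure)"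
  have ind: "indep_set (sets (filt P a)) (sets V)"
    using brownian ab unfolding brownian_motion_def V_def by blast
  have dV: "(\<lambda>\<omega>. W b \<omega> - W a \<omega>) \<in> measurable V borel"
    unfolding V_def by (rule measurable_vimage_algebra1) simp
  have gV: "(\<lambda>\<omega>. g (W b \<omega> - W a \<omega>)) \<in> measurable V borel"
    using measurable_compose[OF dV g] .
  have spV: "space V = space M" by (simp add: V_def)
  have 1: "sigma_sets (space M) {U -` A \<inter> space M |A. A \<in> sets borel} \<subseteq> sets (filt P a)"
    unfolding conjunct1[OF sp, symmetric]
    by (rule sets.sigma_sets_subset) (use measurable_sets[OF U] in auto)
  have 2: "sigma_sets (space M) {(\<lambda>\<omega>. g (W b \<omega> - W a \<omega>)) -` A \<inter> space M |A. A \<in> sets borel} \<subseteq> sets V"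
    unfolding spV[symmetric]
    by (rule sets.sigma_sets_subset) (use measurable_sets[OF gV] in auto)
  have ind2: "indep_set (sigma_sets (space M) {U -` A \<inter> space M |A. A \<in> sets borel})
    (sigma_sets (space M) {(\<lambda>\<omega>. g (W b \<omega> - W a \<omega>)) -` A \<inter> space M |A. A \<in> sets borel})"
    using ind unfolding indep_set_def
    by (rule indep_sets_mono_sets) (simp add: 1 2 split: bool.split)
  have "(\<lambda>\<omega>. g (W b \<omega> - W a \<omega>)) \<in> borel_measurable M"
    using a b g by measurable
  then show ?thesis
    using UM ind2 by (simp add: indep_var_eq)
qed

text \<open>The diagonal case is the Gaussian variance; off the diagonal, independence of the
  coordinates factors the expectation into two zero means. The strict \<open>a < b\<close> reflects
  that a density exists only for nondegenerate increments; the product lemmas below treat equal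
  endpoints separately.\<close>

lemma increment_moments:
  assumes ab: "0 \<le> a" "a < b" "b \<le> T"
  shows "integrable M (\<lambda>\<omega>. (W b \<omega> - W a \<omega>) $ i)"
    and "expectation (\<lambda>\<omega>. (W b \<omega> - W a \<omega>) $ i) = 0"
    and "integrable M (\<lambda>\<omega>. (W b \<omega> - W a \<omega>) $ i * (W b \<omega> - W a \<omega>) $ j)"
    and "expectation (\<lambda>\<omega>. (W b \<omega> - W a \<omega>) $ i * (W b \<omega> - W a \<omega>) $ j) = (if i = j then b - a else 0)"
proof -
  let ?D = "\<lambda>i \<omega>. (W b \<omega> - W a \<omega>) $ i"
  define s where "s = sqrt (b - a)"
  have s: "0 < s" "s\<^sup>2 = b - a" using ab by (auto simp: s_def)
  have D: "distributed M lborel (?D i) (\<lambda>x. ennreal (normal_density 0 s x))" for i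
    using brownian ab unfolding brownian_motion_def s_def by blast
  have ind: "indep_vars (\<lambda>_. borel) ?D UNIV"
    using brownian ab unfolding brownian_motion_def by blast
  show int1: "integrable M (?D i)" for i
    by (rule distributed_integrable_var[OF D normal_density_nonneg integrable_normal_moment_nz_1[OF s(1)]])
  show exp1: "expectation (?D i) = 0" for i
    using normal_distributed_expectation[OF s(1) D] .
  have int2: "integrable M (\<lambda>\<omega>. ?D i \<omega> * ?D i \<omega>)" for i
    using distributed_integrable[OF D[of i], of "\<lambda>x. x^2"] integrable_normal_moment[OF s(1), of 0 2]
    by (simp add: power2_eq_square)
  have exp2: "expectation (\<lambda>\<omega>. ?D i \<omega> * ?D i \<omega>) = b - a" for i
    using normal_distributed_variance[OF s(1) D[of i]] exp1[of i] s(2) by (simp add: power2_eq_square)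
  have indij: "indep_var borel (?D i) borel (?D j)" if "i \<noteq> j"
  proof -
    \<comment> \<open>Pairwise independence is read off the joint one by restricting to two disjoint
      singletons of indices.\<close>
    have "indep_var borel ((\<lambda>x. x i) \<circ> (\<lambda>\<omega>. restrict (\<lambda>i. ?D i \<omega>) {i})) borel ((\<lambda>x. x j) \<circ> (\<lambda>\<omega>. restrict (\<lambda>i. ?D i \<omega>) {j}))"
      using that by (intro indep_var_compose[OF indep_var_restrict[OF ind]]) auto
    then show ?thesis by (simp add: comp_def)
  qed
  show "integrable M (\<lambda>\<omega>. ?D i \<omega> * ?D j \<omega>)"
    using int2 indep_var_integrable[OF indij int1 int1] by (cases "i = j") auto
  show "expectation (\<lambda>\<omega>. ?D i \<omega> * ?D j \<omega>) = (if i = j then b - a else 0)"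
    using exp2 indep_var_lebesgue_integral[OF indij int1 int1] exp1 by (cases "i = j") auto
qed

lemma integrable_mult_of_squares:
  fixes f g :: "'w \<Rightarrow> real"
  assumes [measurable]: "f \<in> borel_measurable M" "g \<in> borel_measurable M"
    and "integrable M (\<lambda>\<omega>. (f \<omega>)\<^sup>2)" "integrable M (\<lambda>\<omega>. (g \<omega>)\<^sup>2)"
  shows "integrable M (\<lambda>\<omega>. f \<omega> * g \<omega>)"
proof (rule Bochner_Integration.integrable_bound)
  show "integrable M (\<lambda>\<omega>. (f \<omega>)\<^sup>2 + (g \<omega>)\<^sup>2)" using assms by simp
  show "AE \<omega> in M. norm (f \<omega> * g \<omega>) \<le> norm ((f \<omega>)\<^sup>2 + (g \<omega>)\<^sup>2)"
  proof (rule AE_I2)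
    fix \<omega>
    have "2 * \<bar>f \<omega> * g \<omega>\<bar> \<le> (f \<omega>)\<^sup>2 + (g \<omega>)\<^sup>2"
      using sum_squares_bound[of "\<bar>f \<omega>\<bar>" "\<bar>g \<omega>\<bar>"] by (simp add: abs_mult)
    then show "norm (f \<omega> * g \<omega>) \<le> norm ((f \<omega>)\<^sup>2 + (g \<omega>)\<^sup>2)"
      unfolding real_norm_def by linarith
  qed
qed simp

lemma integrable_square_component:
  fixes \<xi> :: "'w \<Rightarrow> real^'n::finite"
  assumes [measurable]: "\<xi> \<in> borel_measurable M" and "integrable M (\<lambda>\<omega>. (norm (\<xi> \<omega>))\<^sup>2)"
  shows "integrable M (\<lambda>\<omega>. (\<xi> \<omega> $ i)\<^sup>2)"
proof (rule Bochner_Integration.integrable_bound[OF assms(2)])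
  show "AE \<omega> in M. norm ((\<xi> \<omega> $ i)\<^sup>2) \<le> norm ((norm (\<xi> \<omega>))\<^sup>2)"
    by (rule AE_I2) (simp add: component_le_norm_cart flip: abs_le_square_iff)
qed simp

text \<open>In coordinates, the factor \<open>\<xi> \<omega> $ i * \<eta> \<omega> $ j\<close> is
  known at time a, hence independent of the product of the increments i and j, whose mean is b - a
  for i = j and 0 otherwise. Only the diagonal survives, and it sums to the inner product.\<close>

lemma same_increment_product:
  assumes ab: "0 \<le> a" "a \<le> b" "b \<le> T"
    and \<xi>: "\<xi> \<in> borel_measurable (filt P a)" "integrable M (\<lambda>\<omega>. (norm (\<xi> \<omega> :: real^'k))\<^sup>2)"
    and \<eta>: "\<eta> \<in> borel_measurable (filt P a)" "integrable M (\<lambda>\<omega>. (norm (\<eta> \<omega> :: real^'k))\<^sup>2)"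
  shows "integrable M (\<lambda>\<omega>. (\<xi> \<omega> \<bullet> (W b \<omega> - W a \<omega>)) * (\<eta> \<omega> \<bullet> (W b \<omega> - W a \<omega>)))"
    and "expectation (\<lambda>\<omega>. (\<xi> \<omega> \<bullet> (W b \<omega> - W a \<omega>)) * (\<eta> \<omega> \<bullet> (W b \<omega> - W a \<omega>)))
      = expectation (\<lambda>\<omega>. \<xi> \<omega> \<bullet> \<eta> \<omega>) * (b - a)"
proof -
  let ?D = "\<lambda>i \<omega>. (W b \<omega> - W a \<omega>) $ i"
  have a: "a \<in> {0..T}" using ab by auto
  have [measurable]: "\<xi> \<in> borel_measurable M" "\<eta> \<in> borel_measurable M"
    using measurable_filt_pspace \<xi> \<eta> a by blast+
  have int0: "integrable M (\<lambda>\<omega>. \<xi> \<omega> $ i * \<eta> \<omega> $ j)" for i j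
    using \<xi>(2) \<eta>(2) by (intro integrable_mult_of_squares integrable_square_component) auto
  have F: "(\<lambda>\<omega>. \<xi> \<omega> $ i * \<eta> \<omega> $ j) \<in> borel_measurable (filt P a)" for i j
    using \<xi>(1) \<eta>(1) by measurable
  have eq: "(\<xi> \<omega> \<bullet> (W b \<omega> - W a \<omega>)) * (\<eta> \<omega> \<bullet> (W b \<omega> - W a \<omega>))
     = (\<Sum>i\<in>UNIV. \<Sum>j\<in>UNIV. (\<xi> \<omega> $ i * \<eta> \<omega> $ j) * (?D i \<omega> * ?D j \<omega>))" for \<omega>
    unfolding inner_vec_def sum_product by (intro sum.cong refl) (simp add: mult_ac)
  have "integrable M (\<lambda>\<omega>. (\<xi> \<omega> $ i * \<eta> \<omega> $ j) * (?D i \<omega> * ?D j \<omega>)) \<and>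
     expectation (\<lambda>\<omega>. (\<xi> \<omega> $ i * \<eta> \<omega> $ j) * (?D i \<omega> * ?D j \<omega>))
       = expectation (\<lambda>\<omega>. \<xi> \<omega> $ i * \<eta> \<omega> $ j) * (if i = j then b - a else 0)" for i j
  proof (cases "a = b")
    case False
    then have ab': "0 \<le> a" "a < b" "b \<le> T" using ab by auto
    have "indep_var borel (\<lambda>\<omega>. \<xi> \<omega> $ i * \<eta> \<omega> $ j) borel (\<lambda>\<omega>. ?D i \<omega> * ?D j \<omega>)"
      by (rule indep_var_increment[OF ab' F, of "\<lambda>x. x $ i * x $ j"]) measurable
    note ind = this int0 increment_moments(3)[OF ab']
    show ?thesis
      using indep_var_integrable[OF ind] indep_var_lebesgue_integral[OF ind] increment_moments(4)[OF ab', of i j]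
      by simp
  qed simp
  note * = this
  show "integrable M (\<lambda>\<omega>. (\<xi> \<omega> \<bullet> (W b \<omega> - W a \<omega>)) * (\<eta> \<omega> \<bullet> (W b \<omega> - W a \<omega>)))"
    unfolding eq by (intro Bochner_Integration.integrable_sum conjunct1[OF *])
  have "expectation (\<lambda>\<omega>. (\<xi> \<omega> \<bullet> (W b \<omega> - W a \<omega>)) * (\<eta> \<omega> \<bullet> (W b \<omega> - W a \<omega>)))
     = (\<Sum>i\<in>UNIV. \<Sum>j\<in>UNIV. expectation (\<lambda>\<omega>. \<xi> \<omega> $ i * \<eta> \<omega> $ j) * (if i = j then b - a else 0))"
    unfolding eq by (simp only: integral_double_sum[OF conjunct1[OF *]] conjunct2[OF *])
  also have "\<dots> = (\<Sum>i\<in>UNIV. expectation (\<lambda>\<omega>. \<xi> \<omega> $ i * \<eta> \<omega> $ i)) * (b - a)"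
    by (simp add: if_distrib sum_distrib_right cong: if_cong)
  also have "(\<Sum>i\<in>UNIV. expectation (\<lambda>\<omega>. \<xi> \<omega> $ i * \<eta> \<omega> $ i)) = expectation (\<lambda>\<omega>. \<xi> \<omega> \<bullet> \<eta> \<omega>)"
    using int0 by (simp add: inner_vec_def)
  finally show "expectation (\<lambda>\<omega>. (\<xi> \<omega> \<bullet> (W b \<omega> - W a \<omega>)) * (\<eta> \<omega> \<bullet> (W b \<omega> - W a \<omega>)))
      = expectation (\<lambda>\<omega>. \<xi> \<omega> \<bullet> \<eta> \<omega>) * (b - a)" .
qed

lemma increment_term_square:
  assumes "0 \<le> a" "a \<le> b" "b \<le> T"
    and "\<xi> \<in> borel_measurable (filt P a)" "integrable M (\<lambda>\<omega>. (norm (\<xi> \<omega> :: real^'k))\<^sup>2)"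
  shows "integrable M (\<lambda>\<omega>. (\<xi> \<omega> \<bullet> (W b \<omega> - W a \<omega>))\<^sup>2)"
  using same_increment_product(1)[OF assms assms(4,5)] by (simp add: power2_eq_square)

text \<open>Martingale orthogonality: everything known at time c is independent of an increment
  starting at c, which has mean zero.\<close>

lemma later_increment_product:
  assumes cd: "0 \<le> c" "c \<le> d" "d \<le> T"
    and U: "U \<in> borel_measurable (filt P c)" "integrable M (\<lambda>\<omega>. (U \<omega> :: real)\<^sup>2)"
    and \<eta>: "\<eta> \<in> borel_measurable (filt P c)" "integrable M (\<lambda>\<omega>. (norm (\<eta> \<omega> :: real^'k))\<^sup>2)"
  shows "integrable M (\<lambda>\<omega>. U \<omega> * (\<eta> \<omega> \<bullet> (W d \<omega> - W c \<omega>)))"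
    and "expectation (\<lambda>\<omega>. U \<omega> * (\<eta> \<omega> \<bullet> (W d \<omega> - W c \<omega>))) = 0"
proof -
  let ?D = "\<lambda>i \<omega>. (W d \<omega> - W c \<omega>) $ i"
  have c: "c \<in> {0..T}" using cd by auto
  have [measurable]: "U \<in> borel_measurable M" "\<eta> \<in> borel_measurable M"
    using measurable_filt_pspace U \<eta> c by blast+
  have int0: "integrable M (\<lambda>\<omega>. U \<omega> * \<eta> \<omega> $ j)" for j
    using U(2) \<eta>(2) by (intro integrable_mult_of_squares integrable_square_component) auto
  have F: "(\<lambda>\<omega>. U \<omega> * \<eta> \<omega> $ j) \<in> borel_measurable (filt P c)" for j
    using U(1) \<eta>(1) by measurable
  have eq: "U \<omega> * (\<eta> \<omega> \<bullet> (W d \<omega> - W c \<omega>)) = (\<Sum>j\<in>UNIV. (U \<omega> * \<eta> \<omega> $ j) * ?D j \<omega>)" for \<omega>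
    by (simp add: inner_vec_def sum_distrib_left mult_ac)
  have *: "integrable M (\<lambda>\<omega>. (U \<omega> * \<eta> \<omega> $ j) * ?D j \<omega>) \<and> expectation (\<lambda>\<omega>. (U \<omega> * \<eta> \<omega> $ j) * ?D j \<omega>) = 0" for j
  proof (cases "c = d")
    case False
    then have cd': "0 \<le> c" "c < d" "d \<le> T" using cd by auto
    have "indep_var borel (\<lambda>\<omega>. U \<omega> * \<eta> \<omega> $ j) borel (\<lambda>\<omega>. ?D j \<omega>)"
      by (rule indep_var_increment[OF cd' F, of "\<lambda>x. x $ j"]) measurable
    note ind = this int0 increment_moments(1)[OF cd']
    show ?thesis
      using indep_var_integrable[OF ind] indep_var_lebesgue_integral[OF ind] increment_moments(2)[OF cd', of j]
      by simp
  qed simp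
  show "integrable M (\<lambda>\<omega>. U \<omega> * (\<eta> \<omega> \<bullet> (W d \<omega> - W c \<omega>)))"
    unfolding eq by (intro Bochner_Integration.integrable_sum conjunct1[OF *])
  show "expectation (\<lambda>\<omega>. U \<omega> * (\<eta> \<omega> \<bullet> (W d \<omega> - W c \<omega>))) = 0"
    unfolding eq by (simp only: Bochner_Integration.integral_sum conjunct1[OF *] conjunct2[OF *] sum.neutral_const)
qed

lemma increment_term_split:
  "x \<bullet> (W c \<omega> - W a \<omega>) = x \<bullet> (W b \<omega> - W a \<omega>) + x \<bullet> (W c \<omega> - W b \<omega>)"
  by (simp add: inner_diff_right)

text \<open>The longer increment is cut at b. Its first part shares the interval with the shorter
  one, and its second part is orthogonal to everything known at b.\<close>

lemma same_start_product:
  assumes ab: "0 \<le> a" "a \<le> b" "b \<le> d" "d \<le> T"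
    and \<xi>: "\<xi> \<in> borel_measurable (filt P a)" "integrable M (\<lambda>\<omega>. (norm (\<xi> \<omega> :: real^'k))\<^sup>2)"
    and \<eta>: "\<eta> \<in> borel_measurable (filt P a)" "integrable M (\<lambda>\<omega>. (norm (\<eta> \<omega> :: real^'k))\<^sup>2)"
  shows "integrable M (\<lambda>\<omega>. (\<xi> \<omega> \<bullet> (W b \<omega> - W a \<omega>)) * (\<eta> \<omega> \<bullet> (W d \<omega> - W a \<omega>)))"
    and "expectation (\<lambda>\<omega>. (\<xi> \<omega> \<bullet> (W b \<omega> - W a \<omega>)) * (\<eta> \<omega> \<bullet> (W d \<omega> - W a \<omega>)))
      = expectation (\<lambda>\<omega>. \<xi> \<omega> \<bullet> \<eta> \<omega>) * (b - a)"
proof -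
  have eq: "(\<xi> \<omega> \<bullet> (W b \<omega> - W a \<omega>)) * (\<eta> \<omega> \<bullet> (W d \<omega> - W a \<omega>))
    = (\<xi> \<omega> \<bullet> (W b \<omega> - W a \<omega>)) * (\<eta> \<omega> \<bullet> (W b \<omega> - W a \<omega>))
      + (\<xi> \<omega> \<bullet> (W b \<omega> - W a \<omega>)) * (\<eta> \<omega> \<bullet> (W d \<omega> - W b \<omega>))" for \<omega>
    by (subst increment_term_split[of "\<eta> \<omega>" d \<omega> a b]) (simp add: distrib_left)
  have \<xi>b: "\<xi> \<in> borel_measurable (filt P b)" and \<eta>b: "\<eta> \<in> borel_measurable (filt P b)"
    using measurable_filt_mono \<xi> \<eta> ab by (meson order.trans)+
  have U: "(\<lambda>\<omega>. \<xi> \<omega> \<bullet> (W b \<omega> - W a \<omega>)) \<in> borel_measurable (filt P b)"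
    using ab \<xi>b by (intro borel_measurable_inner increment_measurable_filt) auto
  have U2: "integrable M (\<lambda>\<omega>. (\<xi> \<omega> \<bullet> (W b \<omega> - W a \<omega>))\<^sup>2)"
    using increment_term_square ab \<xi> by simp
  have 0: "0 \<le> b" "b \<le> T" using ab by auto
  note 1 = same_increment_product[OF ab(1,2) 0(2) \<xi> \<eta>]
  note 2 = later_increment_product[OF 0(1) ab(3,4) U U2 \<eta>b \<eta>(2)]
  show "integrable M (\<lambda>\<omega>. (\<xi> \<omega> \<bullet> (W b \<omega> - W a \<omega>)) * (\<eta> \<omega> \<bullet> (W d \<omega> - W a \<omega>)))"
    unfolding eq using 1 2 by simp
  show "expectation (\<lambda>\<omega>. (\<xi> \<omega> \<bullet> (W b \<omega> - W a \<omega>)) * (\<eta> \<omega> \<bullet> (W d \<omega> - W a \<omega>)))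
      = expectation (\<lambda>\<omega>. \<xi> \<omega> \<bullet> \<eta> \<omega>) * (b - a)"
    unfolding eq using 1 2 by simp
qed

definition increment_data :: "real \<Rightarrow> real \<Rightarrow> ('w \<Rightarrow> real^'k) \<Rightarrow> bool" where
  "increment_data a b \<xi> \<longleftrightarrow> 0 \<le> a \<and> a \<le> b \<and> b \<le> T \<and> \<xi> \<in> borel_measurable (filt P a) \<and>
     integrable M (\<lambda>\<omega>. (norm (\<xi> \<omega>))\<^sup>2)"

text \<open>The kernel is the length of the overlap of the two intervals. If they are disjoint, the
  later increment is orthogonal to the earlier term. Otherwise the earlier interval is cut at c: the
  part before c is orthogonal to the later term, and the rest starts at the same point c.\<close>

lemma ordered_increment_product:
  assumes \<xi>: "increment_data a b \<xi>" and \<eta>: "increment_data c d \<eta>" and ac: "a \<le> c"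
  shows "expectation (\<lambda>\<omega>. (\<xi> \<omega> \<bullet> (W b \<omega> - W a \<omega>)) * (\<eta> \<omega> \<bullet> (W d \<omega> - W c \<omega>)))
      = expectation (\<lambda>\<omega>. \<xi> \<omega> \<bullet> \<eta> \<omega>) * max 0 (min b d - max a c)"
proof (cases "b \<le> c")
  case True
  have "(\<lambda>\<omega>. \<xi> \<omega> \<bullet> (W b \<omega> - W a \<omega>)) \<in> borel_measurable (filt P c)"
    using \<xi> \<eta> True ac unfolding increment_data_def
    by (intro borel_measurable_inner measurable_filt_mono[OF increment_measurable_filt, of a b c]
          measurable_filt_mono[of \<xi> a borel c]) auto
  moreover have "integrable M (\<lambda>\<omega>. (\<xi> \<omega> \<bullet> (W b \<omega> - W a \<omega>))\<^sup>2)"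
    using increment_term_square \<xi> unfolding increment_data_def by simp
  ultimately show ?thesis
    using later_increment_product(2)[of c d "\<lambda>\<omega>. \<xi> \<omega> \<bullet> (W b \<omega> - W a \<omega>)" \<eta>] \<eta> True
    unfolding increment_data_def by (simp add: max_def min_def)
next
  case False
  have eq: "(\<xi> \<omega> \<bullet> (W b \<omega> - W a \<omega>)) * (\<eta> \<omega> \<bullet> (W d \<omega> - W c \<omega>))
    = (\<xi> \<omega> \<bullet> (W c \<omega> - W a \<omega>)) * (\<eta> \<omega> \<bullet> (W d \<omega> - W c \<omega>))
      + (\<xi> \<omega> \<bullet> (W b \<omega> - W c \<omega>)) * (\<eta> \<omega> \<bullet> (W d \<omega> - W c \<omega>))" for \<omega>
    by (subst increment_term_split[of "\<xi> \<omega>" b \<omega> a c]) (simp add: distrib_right)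
  have \<xi>c: "\<xi> \<in> borel_measurable (filt P c)"
    using measurable_filt_mono[of \<xi> a borel c] \<xi> \<eta> ac unfolding increment_data_def by auto
  have U: "(\<lambda>\<omega>. \<xi> \<omega> \<bullet> (W c \<omega> - W a \<omega>)) \<in> borel_measurable (filt P c)"
    using \<xi> \<eta> \<xi>c ac unfolding increment_data_def
    by (intro borel_measurable_inner increment_measurable_filt) auto
  have U2: "integrable M (\<lambda>\<omega>. (\<xi> \<omega> \<bullet> (W c \<omega> - W a \<omega>))\<^sup>2)"
    using increment_term_square[of a c \<xi>] \<xi> \<eta> ac False unfolding increment_data_def by simp
  have 1: "integrable M (\<lambda>\<omega>. (\<xi> \<omega> \<bullet> (W c \<omega> - W a \<omega>)) * (\<eta> \<omega> \<bullet> (W d \<omega> - W c \<omega>)))"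
    "expectation (\<lambda>\<omega>. (\<xi> \<omega> \<bullet> (W c \<omega> - W a \<omega>)) * (\<eta> \<omega> \<bullet> (W d \<omega> - W c \<omega>))) = 0"
    using later_increment_product[OF _ _ _ U U2, of d \<eta>] \<eta> unfolding increment_data_def by auto
  have 2: "integrable M (\<lambda>\<omega>. (\<xi> \<omega> \<bullet> (W b \<omega> - W c \<omega>)) * (\<eta> \<omega> \<bullet> (W d \<omega> - W c \<omega>))) \<and>
    expectation (\<lambda>\<omega>. (\<xi> \<omega> \<bullet> (W b \<omega> - W c \<omega>)) * (\<eta> \<omega> \<bullet> (W d \<omega> - W c \<omega>)))
      = expectation (\<lambda>\<omega>. \<xi> \<omega> \<bullet> \<eta> \<omega>) * (min b d - c)"
  proof (cases "b \<le> d")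
    case True
    then show ?thesis
      using same_start_product[of c b d \<xi> \<eta>] \<xi>c \<xi> \<eta> False unfolding increment_data_def by auto
  next
    case bd: False
    then show ?thesis
      using same_start_product[of c d b \<eta> \<xi>] \<xi>c \<xi> \<eta> False unfolding increment_data_def
      by (auto simp: mult.commute inner_commute)
  qed
  show ?thesis
    unfolding eq using 1 2 \<xi> \<eta> ac False unfolding increment_data_def by (simp add: max_def min_def)
qed

lemma increment_product:
  assumes \<xi>: "increment_data a b \<xi>" and \<eta>: "increment_data c d \<eta>"
  shows "expectation (\<lambda>\<omega>. (\<xi> \<omega> \<bullet> (W b \<omega> - W a \<omega>)) * (\<eta> \<omega> \<bullet> (W d \<omega> - W c \<omega>)))
      = expectation (\<lambda>\<omega>. \<xi> \<omega> \<bullet> \<eta> \<omega>) * max 0 (min b d - max a c)"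
proof (cases "a \<le> c")
  case False
  then show ?thesis
    using ordered_increment_product[OF \<eta> \<xi>]
    by (simp only: mult.commute[of "\<xi> _ \<bullet> _"] inner_commute[of "\<xi> _" "\<eta> _"] min.commute[of b] max.commute[of a])
qed (use ordered_increment_product[OF \<xi> \<eta>] in simp)

lemma increment_data_measurable:
  "increment_data a b \<xi> \<Longrightarrow> \<xi> \<in> borel_measurable M"
  unfolding increment_data_def by (intro measurable_filt_pspace[of \<xi> a]) auto

lemma increment_data_bm_measurable:
  assumes d: "increment_data a b \<xi>"
  shows "(\<lambda>\<omega>. \<xi> \<omega> \<bullet> (W b \<omega> - W a \<omega>)) \<in> borel_measurable M"
proof -
  have "W a \<in> borel_measurable M" "W b \<in> borel_measurable M"
    using d by (auto simp: increment_data_def intro!: bm_measurable)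
  then show ?thesis
    using increment_data_measurable[OF d] by (simp add: borel_measurable_inner)
qed

lemma increment_data_square:
  "increment_data a b \<xi> \<Longrightarrow> integrable M (\<lambda>\<omega>. (\<xi> \<omega> \<bullet> (W b \<omega> - W a \<omega>))\<^sup>2)"
  using increment_term_square[of a b \<xi>] by (simp add: increment_data_def)

lemma increment_product_integrable:
  assumes \<xi>: "increment_data a b \<xi>" and \<eta>: "increment_data c d \<eta>"
  shows "integrable M (\<lambda>\<omega>. (\<xi> \<omega> \<bullet> (W b \<omega> - W a \<omega>)) * (\<eta> \<omega> \<bullet> (W d \<omega> - W c \<omega>)))"
    and "integrable M (\<lambda>\<omega>. \<xi> \<omega> \<bullet> \<eta> \<omega>)"
proof -
  note [measurable] = increment_data_measurable[OF \<xi>] increment_data_measurable[OF \<eta>]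
  show "integrable M (\<lambda>\<omega>. (\<xi> \<omega> \<bullet> (W b \<omega> - W a \<omega>)) * (\<eta> \<omega> \<bullet> (W d \<omega> - W c \<omega>)))"
    by (intro integrable_mult_of_squares increment_data_bm_measurable[OF \<xi>] increment_data_bm_measurable[OF \<eta>]
          increment_data_square[OF \<xi>] increment_data_square[OF \<eta>])
  have "integrable M (\<lambda>\<omega>. \<xi> \<omega> $ i * \<eta> \<omega> $ i)" for i
    using \<xi> \<eta> by (intro integrable_mult_of_squares integrable_square_component)
      (auto simp: increment_data_def)
  then show "integrable M (\<lambda>\<omega>. \<xi> \<omega> \<bullet> \<eta> \<omega>)" by (simp add: inner_vec_def)
qed

text \<open>Indexing by an arbitrary finite set, with possibly overlapping intervals, makes the difference
  of two elementary integrals elementary again, so that no common refinement of partitions is needed.\<close>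

lemma ito_isometry_elementary:
  assumes I: "finite I" and data: "\<And>i. i \<in> I \<Longrightarrow> increment_data (a i) (b i) (\<xi> i)"
  shows "(\<integral>\<^sup>+ \<omega>. ennreal ((\<Sum>i\<in>I. \<xi> i \<omega> \<bullet> (W (b i) \<omega> - W (a i) \<omega>))\<^sup>2) \<partial>M)
    = (\<integral>\<^sup>+ \<omega>. (\<integral>\<^sup>+ s. ennreal ((norm (\<Sum>i\<in>I. indicator {a i<..b i} s *\<^sub>R \<xi> i \<omega>))\<^sup>2) \<partial>lborel) \<partial>M)"
proof -
  \<comment> \<open>The Gram matrix of the interval indicators with respect to Lebesgue measure. It
    is also the kernel in \<open>increment_product\<close>, which is why the two sides of the
    isometry agree term by term.\<close>
  let ?m = "\<lambda>i j. max 0 (min (b i) (b j) - max (a i) (a j))"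
  have int: "integrable lborel (\<lambda>s. indicator {a i<..b i} s * indicator {a j<..b j} s :: real)"
    "(\<integral>s. indicator {a i<..b i} s * indicator {a j<..b j} s \<partial>lborel) = ?m i j" for i j
  proof -
    have "indicator {a i<..b i} s * indicator {a j<..b j} s
      = (indicator {max (a i) (a j)<..min (b i) (b j)} s :: real)" for s
      by (auto simp: indicator_def)
    moreover have "measure lborel {max (a i) (a j)<..min (b i) (b j)} = ?m i j"
      by (cases "max (a i) (a j) \<le> min (b i) (b j)") auto
    moreover have "emeasure lborel {max (a i) (a j)<..min (b i) (b j)} < \<infinity>"
      by (cases "max (a i) (a j) \<le> min (b i) (b j)") auto
    ultimately show "integrable lborel (\<lambda>s. indicator {a i<..b i} s * indicator {a j<..b j} s :: real)"
      "(\<integral>s. indicator {a i<..b i} s * indicator {a j<..b j} s \<partial>lborel) = ?m i j"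
      by auto
  qed
  have sq: "(norm (\<Sum>i\<in>I. indicator {a i<..b i} s *\<^sub>R \<xi> i \<omega>))\<^sup>2
    = (\<Sum>i\<in>I. \<Sum>j\<in>I. (indicator {a i<..b i} s * indicator {a j<..b j} s) * (\<xi> i \<omega> \<bullet> \<xi> j \<omega>))" for s \<omega>
    unfolding power2_norm_eq_inner by (simp only: inner_sum_left, simp only: inner_sum_right)
      (intro sum.cong refl, simp add: mult_ac)
  \<comment> \<open>The double sum may contain terms of either sign, and \<open>ennreal\<close>
    truncates at 0; its nonnegativity is inherited from the integrated square.\<close>
  have inner: "(\<integral>\<^sup>+ s. ennreal ((norm (\<Sum>i\<in>I. indicator {a i<..b i} s *\<^sub>R \<xi> i \<omega>))\<^sup>2) \<partial>lborel)
    = ennreal (\<Sum>i\<in>I. \<Sum>j\<in>I. ?m i j * (\<xi> i \<omega> \<bullet> \<xi> j \<omega>))"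
    and pos: "0 \<le> (\<Sum>i\<in>I. \<Sum>j\<in>I. ?m i j * (\<xi> i \<omega> \<bullet> \<xi> j \<omega>))" for \<omega>
  proof -
    let ?f = "\<lambda>s. (\<Sum>i\<in>I. \<Sum>j\<in>I. (indicator {a i<..b i} s * indicator {a j<..b j} s) * (\<xi> i \<omega> \<bullet> \<xi> j \<omega>))"
    have fi: "integrable lborel ?f"
      using int by (intro Bochner_Integration.integrable_sum integrable_mult_left) auto
    have val: "(\<integral>s. ?f s \<partial>lborel) = (\<Sum>i\<in>I. \<Sum>j\<in>I. ?m i j * (\<xi> i \<omega> \<bullet> \<xi> j \<omega>))"
      using int by (simp add: Bochner_Integration.integral_sum Bochner_Integration.integrable_sum integrable_mult_left)
    have nn: "0 \<le> ?f s" for s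
      using sq[of s \<omega>] by (metis zero_le_power2)
    show "(\<integral>\<^sup>+ s. ennreal ((norm (\<Sum>i\<in>I. indicator {a i<..b i} s *\<^sub>R \<xi> i \<omega>))\<^sup>2) \<partial>lborel)
      = ennreal (\<Sum>i\<in>I. \<Sum>j\<in>I. ?m i j * (\<xi> i \<omega> \<bullet> \<xi> j \<omega>))"
      unfolding sq using nn_integral_eq_integral[OF fi] nn val by simp
    show "0 \<le> (\<Sum>i\<in>I. \<Sum>j\<in>I. ?m i j * (\<xi> i \<omega> \<bullet> \<xi> j \<omega>))"
      unfolding val[symmetric] using nn by (intro Bochner_Integration.integral_nonneg) auto
  qed
  let ?t = "\<lambda>i \<omega>. \<xi> i \<omega> \<bullet> (W (b i) \<omega> - W (a i) \<omega>)"
  have L: "integrable M (\<lambda>\<omega>. \<Sum>i\<in>I. \<Sum>j\<in>I. ?t i \<omega> * ?t j \<omega>)"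
    by (intro Bochner_Integration.integrable_sum increment_product_integrable(1)[OF data data])
  have R: "integrable M (\<lambda>\<omega>. \<Sum>i\<in>I. \<Sum>j\<in>I. ?m i j * (\<xi> i \<omega> \<bullet> \<xi> j \<omega>))"
    by (intro Bochner_Integration.integrable_sum integrable_mult_right increment_product_integrable(2)[OF data data])
  have "expectation (\<lambda>\<omega>. \<Sum>i\<in>I. \<Sum>j\<in>I. ?t i \<omega> * ?t j \<omega>)
      = (\<Sum>i\<in>I. \<Sum>j\<in>I. expectation (\<lambda>\<omega>. ?t i \<omega> * ?t j \<omega>))"
    by (intro integral_double_sum increment_product_integrable(1)[OF data data])
  also have "\<dots> = (\<Sum>i\<in>I. \<Sum>j\<in>I. expectation (\<lambda>\<omega>. ?m i j * (\<xi> i \<omega> \<bullet> \<xi> j \<omega>)))"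
    using increment_product[OF data data] by (intro sum.cong refl) (simp add: mult.commute)
  also have "\<dots> = expectation (\<lambda>\<omega>. \<Sum>i\<in>I. \<Sum>j\<in>I. ?m i j * (\<xi> i \<omega> \<bullet> \<xi> j \<omega>))"
    by (intro integral_double_sum[symmetric] integrable_mult_right increment_product_integrable(2)[OF data data])
  finally have eq: "expectation (\<lambda>\<omega>. \<Sum>i\<in>I. \<Sum>j\<in>I. ?t i \<omega> * ?t j \<omega>)
    = expectation (\<lambda>\<omega>. \<Sum>i\<in>I. \<Sum>j\<in>I. ?m i j * (\<xi> i \<omega> \<bullet> \<xi> j \<omega>))" .
  have "(\<integral>\<^sup>+ \<omega>. ennreal ((\<Sum>i\<in>I. ?t i \<omega>)\<^sup>2) \<partial>M) = ennreal (expectation (\<lambda>\<omega>. \<Sum>i\<in>I. \<Sum>j\<in>I. ?t i \<omega> * ?t j \<omega>))"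
  proof -
    have "(\<Sum>i\<in>I. ?t i \<omega>)\<^sup>2 = (\<Sum>i\<in>I. \<Sum>j\<in>I. ?t i \<omega> * ?t j \<omega>)" for \<omega>
      by (simp add: power2_eq_square sum_product)
    then show ?thesis
      using nn_integral_eq_integral[OF L] by (metis (no_types, lifting) AE_I2 zero_le_power2 nn_integral_cong)
  qed
  also have "\<dots> = (\<integral>\<^sup>+ \<omega>. ennreal (\<Sum>i\<in>I. \<Sum>j\<in>I. ?m i j * (\<xi> i \<omega> \<bullet> \<xi> j \<omega>)) \<partial>M)"
    unfolding eq using nn_integral_eq_integral[OF R] pos by simp
  finally show ?thesis unfolding inner .
qed

end

section \<open>Comparison of Ito integrals with elementary integrals\<close>

lemma ennsqrt_mult_self: "ennsqrt x * ennsqrt x = x"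
proof (cases x)
  case (real r)
  then show ?thesis by (simp add: ennsqrt_def ennreal_mult[symmetric] flip: ennreal_mult)
qed (simp add: ennsqrt_def ennreal_top_mult)

lemma ennsqrt_le: "x \<le> y * y \<Longrightarrow> ennsqrt x \<le> y"
proof (cases y)
  case (real r)
  assume le: "x \<le> y * y"
  then obtain q where q: "x = ennreal q" "0 \<le> q"
    using real by (cases x) (auto simp: top_unique ennreal_mult_eq_top_iff)
  then have "q \<le> r * r" using le real by (simp add: ennreal_mult[symmetric])
  then have "sqrt q \<le> r" using real by (intro real_le_lsqrt) (auto simp: power2_eq_square)
  then show ?thesis using q real by (simp add: ennsqrt_def ennreal_le_iff)
qed simp

lemma norm_add_square_le:
  fixes x y :: "'a::real_normed_vector"
  shows "(norm (x + y))\<^sup>2 \<le> 2 * (norm x)\<^sup>2 + 2 * (norm y)\<^sup>2"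
proof -
  have "(norm (x + y))\<^sup>2 \<le> (norm x + norm y)\<^sup>2"
    by (intro power_mono norm_triangle_ineq) simp
  also have "\<dots> \<le> 2 * (norm x)\<^sup>2 + 2 * (norm y)\<^sup>2"
    using sum_squares_bound[of "norm x" "norm y"] by (simp add: power2_sum)
  finally show ?thesis .
qed

lemma ennreal_norm_add_square_le:
  "ennreal ((norm (x + y))\<^sup>2) \<le> 2 * ennreal ((norm x)\<^sup>2) + 2 * ennreal ((norm y)\<^sup>2)"
proof -
  have "ennreal ((norm (x + y))\<^sup>2) \<le> ennreal (2 * (norm x)\<^sup>2 + 2 * (norm y)\<^sup>2)"
    by (intro ennreal_leI norm_add_square_le)
  then show ?thesis by (simp add: ennreal_mult ennreal_plus)
qed

lemma nn_integral_norm_add_square_le: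
  fixes f g :: "'a \<Rightarrow> 'b::euclidean_space"
  assumes [measurable]: "f \<in> borel_measurable N" "g \<in> borel_measurable N"
  shows "(\<integral>\<^sup>+ x. ennreal ((norm (f x + g x))\<^sup>2) \<partial>N)
    \<le> 2 * (\<integral>\<^sup>+ x. ennreal ((norm (f x))\<^sup>2) \<partial>N) + 2 * (\<integral>\<^sup>+ x. ennreal ((norm (g x))\<^sup>2) \<partial>N)"
proof -
  have "(\<integral>\<^sup>+ x. ennreal ((norm (f x + g x))\<^sup>2) \<partial>N)
    \<le> (\<integral>\<^sup>+ x. 2 * ennreal ((norm (f x))\<^sup>2) + 2 * ennreal ((norm (g x))\<^sup>2) \<partial>N)"
    by (intro nn_integral_mono ennreal_norm_add_square_le)
  also have "\<dots> = 2 * (\<integral>\<^sup>+ x. ennreal ((norm (f x))\<^sup>2) \<partial>N) + 2 * (\<integral>\<^sup>+ x. ennreal ((norm (g x))\<^sup>2) \<partial>N)"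
    by (simp add: nn_integral_add nn_integral_cmult)
  finally show ?thesis .
qed

text \<open>Clamping the time extends a progressive process from \<open>{0..T}\<close> to a jointly measurable one on the
  whole line.\<close>

definition clamp_time :: "real \<Rightarrow> real \<Rightarrow> real" where
  "clamp_time T s = max 0 (min T s)"

lemma clamp_time_eq: "s \<in> {0..T} \<Longrightarrow> clamp_time T s = s"
  by (simp add: clamp_time_def)

lemma clamp_time_mem: "0 \<le> T \<Longrightarrow> clamp_time T s \<in> {0..T}"
  by (simp add: clamp_time_def)

lemma clamp_time_measurable [measurable]: "clamp_time T \<in> borel_measurable borel"
  unfolding clamp_time_def[abs_def] by measurable

text \<open>Progressive measurability at the final time is joint measurability on
  \<open>{0..T}\<close> with respect to \<open>filt P T\<close>. It transfers to \<open>M\<close>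
  because the identity from \<open>M\<close> to a sub-sigma-algebra is measurable.\<close>

lemma (in brownian_setup) progressive_joint_measurable:
  assumes "progressive P z"
  shows "(\<lambda>(s, \<omega>). z (clamp_time T s) \<omega>) \<in> borel_measurable (lborel \<Otimes>\<^sub>M M)"
proof -
  have T: "T \<in> {0..T}" using horizon_pos by simp
  have z: "(\<lambda>(s, \<omega>). z s \<omega>) \<in> borel_measurable (restrict_space borel {0..T} \<Otimes>\<^sub>M filt P T)"
    using assms T unfolding progressive_def by blast
  have id: "(\<lambda>\<omega>. \<omega>) \<in> measurable M (filt P T)"
    using filt_subalgebra[OF T] measurable_from_subalg[of M "filt P T" "\<lambda>\<omega>. \<omega>" "filt P T"] by simp
  have 1: "(\<lambda>p. clamp_time T (fst p)) \<in> measurable (lborel \<Otimes>\<^sub>M M) (restrict_space borel {0..T})"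
    using horizon_pos by (intro measurable_restrict_space2) (auto intro!: clamp_time_mem)
  have 2: "(\<lambda>p. snd p) \<in> measurable (lborel \<Otimes>\<^sub>M M) (filt P T)"
    by (rule measurable_compose[OF measurable_snd id])
  have "(\<lambda>p. (\<lambda>(s, \<omega>). z s \<omega>) (clamp_time T (fst p), snd p)) \<in> borel_measurable (lborel \<Otimes>\<^sub>M M)"
    by (rule measurable_compose[OF measurable_Pair[OF 1 2] z])
  then show ?thesis by (simp add: case_prod_beta')
qed

section \<open>Elementary integrals stopped at a fixed time, and their limits\<close>

context brownian_setup
begin

lemma simple_data_mono:
  assumes "simple_data P n \<tau> \<xi>" "i \<le> n"
  shows "0 \<le> \<tau> i" "\<tau> i \<le> T"
proof -
  have *: "\<tau> i \<le> \<tau> j" if "i \<le> j" "j \<le> n" for i j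
    using that
  proof (induction j rule: dec_induct)
    case (step k)
    have "\<tau> k \<le> \<tau> (Suc k)" using assms(1) step by (simp add: simple_data_def)
    then show ?case using step by simp
  qed simp
  show "0 \<le> \<tau> i" "\<tau> i \<le> T"
    using *[of 0 i] *[of i n] assms by (auto simp: simple_data_def)
qed

text \<open>For \<open>\<tau> i > t\<close> the stopped interval degenerates to the point t, at
  which \<open>\<xi> i\<close> need not be known yet. Replacing it by 0 restores adaptedness and
  leaves the term unchanged, because its increment vanishes.\<close>

lemma simple_data_stopped:
  assumes \<xi>: "simple_data P n \<tau> \<xi>" and i: "i < n" and t: "t \<in> {0..T}"
  shows "increment_data (min (\<tau> i) t) (min (\<tau> (Suc i)) t) (\<lambda>\<omega>. if \<tau> i \<le> t then \<xi> i \<omega> else 0)"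
proof -
  have "\<tau> i \<le> \<tau> (Suc i)" "\<xi> i \<in> borel_measurable (filt P (\<tau> i))" "integrable M (\<lambda>\<omega>. (norm (\<xi> i \<omega>))\<^sup>2)"
    using \<xi> i by (auto simp: simple_data_def)
  then show ?thesis
    using simple_data_mono[OF \<xi>, of i] i t by (cases "\<tau> i \<le> t") (auto simp: increment_data_def)
qed

lemma simple_integral_stopped:
  assumes \<xi>: "simple_data P n \<tau> \<xi>"
  shows "simple_integral P n \<tau> \<xi> t \<omega> =
    (\<Sum>i<n. (if \<tau> i \<le> t then \<xi> i \<omega> else 0) \<bullet> (W (min (\<tau> (Suc i)) t) \<omega> - W (min (\<tau> i) t) \<omega>))"
  unfolding simple_integral_def
proof (intro sum.cong refl)
  fix i assume "i \<in> {..<n}"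
  then have "\<tau> i \<le> \<tau> (Suc i)" using \<xi> by (simp add: simple_data_def)
  then show "\<xi> i \<omega> \<bullet> (W (min (\<tau> (Suc i)) t) \<omega> - W (min (\<tau> i) t) \<omega>) =
    (if \<tau> i \<le> t then \<xi> i \<omega> else 0) \<bullet> (W (min (\<tau> (Suc i)) t) \<omega> - W (min (\<tau> i) t) \<omega>)"
    by (simp add: min_absorb2)
qed

lemma simple_process_stopped:
  assumes \<xi>: "simple_data P n \<tau> \<xi>"
  shows "indicator {0..t} s *\<^sub>R simple_process n \<tau> \<xi> s \<omega> =
    (\<Sum>i<n. indicator {min (\<tau> i) t<..min (\<tau> (Suc i)) t} s *\<^sub>R (if \<tau> i \<le> t then \<xi> i \<omega> else 0))"
  unfolding simple_process_def scaleR_sum_right scaleR_scaleR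
proof (intro sum.cong refl)
  fix i assume "i \<in> {..<n}"
  then have "0 \<le> \<tau> i" "\<tau> i \<le> \<tau> (Suc i)" using \<xi> simple_data_mono[OF \<xi>, of i] by (simp_all add: simple_data_def)
  then show "(indicator {0..t} s * indicator {\<tau> i<..\<tau> (Suc i)} s) *\<^sub>R \<xi> i \<omega>
     = indicator {min (\<tau> i) t<..min (\<tau> (Suc i)) t} s *\<^sub>R (if \<tau> i \<le> t then \<xi> i \<omega> else 0)"
    by (auto simp: indicator_def min_def)
qed

text \<open>The two partitions are placed side by side over the disjoint union of their index sets,
  with the second family of coefficients negated; the elementary isometry tolerates the resulting
  overlaps.\<close>

lemma simple_integral_diff_isometry:
  assumes A: "simple_data P n \<tau> \<xi>" and B: "simple_data P m \<theta> \<eta>" and t: "t \<in> {0..T}"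
  shows "(\<integral>\<^sup>+ \<omega>. ennreal ((simple_integral P n \<tau> \<xi> t \<omega> - simple_integral P m \<theta> \<eta> t \<omega>)\<^sup>2) \<partial>M)
    = (\<integral>\<^sup>+ \<omega>. (\<integral>\<^sup>+ s. ennreal ((norm (simple_process n \<tau> \<xi> s \<omega> - simple_process m \<theta> \<eta> s \<omega>))\<^sup>2)
         * indicator {0..t} s \<partial>lborel) \<partial>M)"
proof -
  define a where "a = case_sum (\<lambda>i. min (\<tau> i) t) (\<lambda>i. min (\<theta> i) t)"
  define b where "b = case_sum (\<lambda>i. min (\<tau> (Suc i)) t) (\<lambda>i. min (\<theta> (Suc i)) t)"
  define \<rho> where "\<rho> = case_sum (\<lambda>i \<omega>. if \<tau> i \<le> t then \<xi> i \<omega> else 0) (\<lambda>i \<omega>. - (if \<theta> i \<le> t then \<eta> i \<omega> else 0))"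
  let ?I = "{..<n} <+> {..<m}"
  have neg: "increment_data u v (\<lambda>\<omega>. - r \<omega>)" if "increment_data u v r" for u v r
    using that by (simp add: increment_data_def)
  have data: "increment_data (a i) (b i) (\<rho> i)" if "i \<in> ?I" for i
    using that simple_data_stopped[OF A _ t] neg[OF simple_data_stopped[OF B _ t]]
    by (cases i) (auto simp: a_def b_def \<rho>_def)
  have SI: "simple_integral P n \<tau> \<xi> t \<omega> - simple_integral P m \<theta> \<eta> t \<omega>
      = (\<Sum>i\<in>?I. \<rho> i \<omega> \<bullet> (W (b i) \<omega> - W (a i) \<omega>))" for \<omega>
    unfolding simple_integral_stopped[OF A] simple_integral_stopped[OF B]
    by (subst sum.Plus) (simp_all add: a_def b_def \<rho>_def sum_negf)
  have SP: "indicator {0..t} s *\<^sub>R (simple_process n \<tau> \<xi> s \<omega> - simple_process m \<theta> \<eta> s \<omega>)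
      = (\<Sum>i\<in>?I. indicator {a i<..b i} s *\<^sub>R \<rho> i \<omega>)" for s \<omega>
    unfolding scaleR_diff_right simple_process_stopped[OF A] simple_process_stopped[OF B]
    by (subst sum.Plus) (simp_all add: a_def b_def \<rho>_def sum_negf)
  have "ennreal ((norm (simple_process n \<tau> \<xi> s \<omega> - simple_process m \<theta> \<eta> s \<omega>))\<^sup>2) * indicator {0..t} s
      = ennreal ((norm (\<Sum>i\<in>?I. indicator {a i<..b i} s *\<^sub>R \<rho> i \<omega>))\<^sup>2)" for s \<omega>
    unfolding SP[symmetric] by (simp add: indicator_def)
  then show ?thesis
    unfolding SI using ito_isometry_elementary[of ?I a b \<rho>] data by simp
qed

lemma simple_data_measurable:
  assumes "simple_data P n \<tau> \<xi>" "i < n"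
  shows "\<xi> i \<in> borel_measurable M"
  using assms simple_data_mono[OF assms(1), of i] by (intro measurable_filt_pspace[of "\<xi> i" "\<tau> i"]) (auto simp: simple_data_def)

lemma simple_process_measurable:
  assumes "simple_data P n \<tau> \<xi>"
  shows "(\<lambda>(s, \<omega>). simple_process n \<tau> \<xi> s \<omega>) \<in> borel_measurable (lborel \<Otimes>\<^sub>M M)"
proof -
  have [measurable]: "\<xi> i \<in> borel_measurable M" if "i \<in> {..<n}" for i
    using simple_data_measurable[OF assms] that by simp
  show ?thesis unfolding simple_process_def by measurable
qed

lemma simple_integral_measurable:
  assumes \<xi>: "simple_data P n \<tau> \<xi>" and t: "t \<in> {0..T}"
  shows "simple_integral P n \<tau> \<xi> t \<in> borel_measurable M"
  unfolding simple_integral_stopped[OF \<xi>, abs_def]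
  using increment_data_bm_measurable[OF simple_data_stopped[OF \<xi> _ t]]
  by (intro borel_measurable_sum) simp

text \<open>The factor 4 replaces the sharp constant 1: it comes from using
  \<open>(x + y)\<^sup>2 \<le> 2 x\<^sup>2 + 2 y\<^sup>2\<close> twice in place of Minkowski's inequality.\<close>

lemma ito_integral_compare:
  assumes I: "has_ito_integral P z t I" and t: "t \<in> {0..T}" and \<xi>: "simple_data P n \<tau> \<xi>"
  shows "(\<integral>\<^sup>+ \<omega>. ennreal ((I \<omega> - simple_integral P n \<tau> \<xi> t \<omega>)\<^sup>2) \<partial>M)
    \<le> 4 * (\<integral>\<^sup>+ \<omega>. (\<integral>\<^sup>+ s. ennreal ((norm (z s \<omega> - simple_process n \<tau> \<xi> s \<omega>))\<^sup>2) * indicator {0..t} s \<partial>lborel) \<partial>M)"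
    (is "?L \<le> 4 * ?R")
proof -
  have z: "z \<in> H2 P" and [measurable]: "I \<in> borel_measurable M" using I by (auto simp: has_ito_integral_def)
  obtain n' \<tau>' \<xi>' where d: "\<And>m. simple_data P (n' m) (\<tau>' m) (\<xi>' m)"
    and H: "(\<lambda>m. H2_norm P (\<lambda>s \<omega>. simple_process (n' m) (\<tau>' m) (\<xi>' m) s \<omega> - z s \<omega>)) \<longlonglongrightarrow> 0"
    and e: "(\<lambda>m. \<integral>\<^sup>+ \<omega>. ennreal ((simple_integral P (n' m) (\<tau>' m) (\<xi>' m) t \<omega> - I \<omega>)\<^sup>2) \<partial>M) \<longlonglongrightarrow> 0"
    using I unfolding has_ito_integral_def by blast
  let ?SI = "\<lambda>m. simple_integral P (n' m) (\<tau>' m) (\<xi>' m) t"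
  let ?SP = "\<lambda>m. simple_process (n' m) (\<tau>' m) (\<xi>' m)"
  let ?H = "\<lambda>m. H2_norm P (\<lambda>s \<omega>. ?SP m s \<omega> - z s \<omega>)"
  let ?e = "\<lambda>m. \<integral>\<^sup>+ \<omega>. ennreal ((?SI m \<omega> - I \<omega>)\<^sup>2) \<partial>M"
  have zm[measurable]: "(\<lambda>(s, \<omega>). z (clamp_time T s) \<omega>) \<in> borel_measurable (lborel \<Otimes>\<^sub>M M)"
    by (rule progressive_joint_measurable) (use z in \<open>simp add: H2_def\<close>)
  have SIm[measurable]: "?SI m \<in> borel_measurable M" for m
    by (rule simple_integral_measurable[OF d t])
  have SI0[measurable]: "simple_integral P n \<tau> \<xi> t \<in> borel_measurable M"
    by (rule simple_integral_measurable[OF \<xi> t])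
  note [measurable] = simple_process_measurable[OF \<xi>] simple_process_measurable[OF d]
  \<comment> \<open>The m-th approximant supplied by \<open>has_ito_integral\<close> is inserted
    between the integrals, at cost \<open>?e m\<close>. The isometry turns the remaining difference
    into one of integrands, where z is inserted at cost \<open>?H m\<close> squared. Both costs
    vanish as m grows.\<close>
  have bound: "?L \<le> 2 * ?e m + 2 * (2 * (?H m * ?H m) + 2 * ?R)" for m
  proof -
    have "?L = (\<integral>\<^sup>+ \<omega>. ennreal ((norm ((I \<omega> - ?SI m \<omega>) + (?SI m \<omega> - simple_integral P n \<tau> \<xi> t \<omega>)))\<^sup>2) \<partial>M)"
      by simp
    also have "\<dots> \<le> 2 * (\<integral>\<^sup>+ \<omega>. ennreal ((norm (I \<omega> - ?SI m \<omega>))\<^sup>2) \<partial>M)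
       + 2 * (\<integral>\<^sup>+ \<omega>. ennreal ((norm (?SI m \<omega> - simple_integral P n \<tau> \<xi> t \<omega>))\<^sup>2) \<partial>M)"
      by (rule nn_integral_norm_add_square_le) measurable
    also have "(\<integral>\<^sup>+ \<omega>. ennreal ((norm (I \<omega> - ?SI m \<omega>))\<^sup>2) \<partial>M) = ?e m"
      by (simp add: power2_commute)
    also have "(\<integral>\<^sup>+ \<omega>. ennreal ((norm (?SI m \<omega> - simple_integral P n \<tau> \<xi> t \<omega>))\<^sup>2) \<partial>M)
      = (\<integral>\<^sup>+ \<omega>. (\<integral>\<^sup>+ s. ennreal ((norm (?SP m s \<omega> - simple_process n \<tau> \<xi> s \<omega>))\<^sup>2) * indicator {0..t} s \<partial>lborel) \<partial>M)"
      using simple_integral_diff_isometry[OF d \<xi> t] by simp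
    also have "\<dots> \<le> (\<integral>\<^sup>+ \<omega>. 2 * (\<integral>\<^sup>+ s. ennreal ((norm (?SP m s \<omega> - z (clamp_time T s) \<omega>))\<^sup>2) * indicator {0..T} s \<partial>lborel)
       + 2 * (\<integral>\<^sup>+ s. ennreal ((norm (z (clamp_time T s) \<omega> - simple_process n \<tau> \<xi> s \<omega>))\<^sup>2) * indicator {0..t} s \<partial>lborel) \<partial>M)"
    proof (rule nn_integral_mono)
      fix \<omega> assume [measurable]: "\<omega> \<in> space M"
      have "(\<integral>\<^sup>+ s. ennreal ((norm (?SP m s \<omega> - simple_process n \<tau> \<xi> s \<omega>))\<^sup>2) * indicator {0..t} s \<partial>lborel)
        \<le> (\<integral>\<^sup>+ s. 2 * (ennreal ((norm (?SP m s \<omega> - z (clamp_time T s) \<omega>))\<^sup>2) * indicator {0..T} s)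
          + 2 * (ennreal ((norm (z (clamp_time T s) \<omega> - simple_process n \<tau> \<xi> s \<omega>))\<^sup>2) * indicator {0..t} s) \<partial>lborel)"
      proof (rule nn_integral_mono)
        fix s
        show "ennreal ((norm (?SP m s \<omega> - simple_process n \<tau> \<xi> s \<omega>))\<^sup>2) * indicator {0..t} s
          \<le> 2 * (ennreal ((norm (?SP m s \<omega> - z (clamp_time T s) \<omega>))\<^sup>2) * indicator {0..T} s)
          + 2 * (ennreal ((norm (z (clamp_time T s) \<omega> - simple_process n \<tau> \<xi> s \<omega>))\<^sup>2) * indicator {0..t} s)"
          using ennreal_norm_add_square_le[of "?SP m s \<omega> - z (clamp_time T s) \<omega>" "z (clamp_time T s) \<omega> - simple_process n \<tau> \<xi> s \<omega>"] t
          by (auto simp: indicator_def)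
      qed
      also have "\<dots> = 2 * (\<integral>\<^sup>+ s. ennreal ((norm (?SP m s \<omega> - z (clamp_time T s) \<omega>))\<^sup>2) * indicator {0..T} s \<partial>lborel)
       + 2 * (\<integral>\<^sup>+ s. ennreal ((norm (z (clamp_time T s) \<omega> - simple_process n \<tau> \<xi> s \<omega>))\<^sup>2) * indicator {0..t} s \<partial>lborel)"
        by (simp add: nn_integral_add nn_integral_cmult)
      finally show "(\<integral>\<^sup>+ s. ennreal ((norm (?SP m s \<omega> - simple_process n \<tau> \<xi> s \<omega>))\<^sup>2) * indicator {0..t} s \<partial>lborel) \<le> \<dots>" .
    qed
    also have "\<dots> = 2 * (\<integral>\<^sup>+ \<omega>. (\<integral>\<^sup>+ s. ennreal ((norm (?SP m s \<omega> - z (clamp_time T s) \<omega>))\<^sup>2) * indicator {0..T} s \<partial>lborel) \<partial>M)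
      + 2 * (\<integral>\<^sup>+ \<omega>. (\<integral>\<^sup>+ s. ennreal ((norm (z (clamp_time T s) \<omega> - simple_process n \<tau> \<xi> s \<omega>))\<^sup>2) * indicator {0..t} s \<partial>lborel) \<partial>M)"
      by (simp add: nn_integral_add nn_integral_cmult)
    also have "(\<integral>\<^sup>+ \<omega>. (\<integral>\<^sup>+ s. ennreal ((norm (?SP m s \<omega> - z (clamp_time T s) \<omega>))\<^sup>2) * indicator {0..T} s \<partial>lborel) \<partial>M)
      = ?H m * ?H m"
      unfolding H2_norm_def ennsqrt_mult_self
      by (intro nn_integral_cong) (auto simp: indicator_def clamp_time_eq)
    also have "(\<integral>\<^sup>+ \<omega>. (\<integral>\<^sup>+ s. ennreal ((norm (z (clamp_time T s) \<omega> - simple_process n \<tau> \<xi> s \<omega>))\<^sup>2) * indicator {0..t} s \<partial>lborel) \<partial>M)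
      = ?R"
      using t by (intro nn_integral_cong) (auto simp: indicator_def clamp_time_eq)
    finally show ?thesis by (simp add: add_left_mono mult_left_mono)
  qed
  have "(\<lambda>m. 2 * ?e m + 2 * (2 * (?H m * ?H m) + 2 * ?R)) \<longlonglongrightarrow> 2 * 0 + 2 * (2 * (0 * 0) + 2 * ?R)"
    by (intro tendsto_add tendsto_mult_ennreal tendsto_const H e) auto
  then have "?L \<le> 2 * 0 + 2 * (2 * (0 * 0) + 2 * ?R)"
    by (rule LIMSEQ_le_const) (use bound in blast)
  then show ?thesis by (simp add: mult.assoc[symmetric])
qed

end

section \<open>Gronwall's inequality\<close>

text \<open>The bound \<open>R\<close> excludes an infinite weighted supremum \<open>S\<close>, for
  which the inequality \<open>S \<le> A + S / 2\<close> would carry no information. It does not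
  enter the conclusion, so it may depend on h in the application.\<close>

lemma gronwall_ennreal:
  fixes \<phi> :: "real \<Rightarrow> ennreal"
  assumes le: "\<And>t. t \<in> {0..T} \<Longrightarrow> \<phi> t \<le> A + ennreal B * (\<integral>\<^sup>+ s. \<phi> s * indicator {0..t} s \<partial>lborel)"
    and bdd: "\<And>t. t \<in> {0..T} \<Longrightarrow> \<phi> t \<le> ennreal R"
    and B: "0 < B" and t: "t \<in> {0..T}"
  shows "\<phi> t \<le> ennreal (2 * exp (2 * B * T)) * A"
proof -
  \<comment> \<open>In the norm weighted by \<open>exp (- 2 B t)\<close> the integral operator is a contraction with constant \<open>1/2\<close>.\<close>
  define S where "S = (SUP t\<in>{0..T}. ennreal (exp (- (2 * B * t))) * \<phi> t)"
  have exp_cancel: "ennreal (exp (2 * B * s)) * (ennreal (exp (- (2 * B * s))) * x) = x" for s x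
    by (simp add: mult.assoc[symmetric] flip: ennreal_mult exp_add)
  have exp_cancel': "ennreal (exp (- (2 * B * s))) * (ennreal (exp (2 * B * s)) * x) = x" for s x
    by (simp add: mult.assoc[symmetric] flip: ennreal_mult exp_add)
  have \<phi>S: "\<phi> s \<le> ennreal (exp (2 * B * s)) * S" if "s \<in> {0..T}" for s
  proof -
    have "ennreal (exp (- (2 * B * s))) * \<phi> s \<le> S"
      unfolding S_def by (rule SUP_upper[OF that])
    from mult_left_mono[OF this, of "ennreal (exp (2 * B * s))"] show ?thesis
      unfolding exp_cancel by simp
  qed
  \<comment> \<open>The exponent 2 B makes the integral of the weight at most exp (2 B t) / (2 B),
    so that multiplication by B leaves the factor 1/2.\<close>
  have step: "ennreal (exp (- (2 * B * t))) * \<phi> t \<le> A + ennreal (1/2) * S" if t: "t \<in> {0..T}" for t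
  proof -
    have "(\<integral>\<^sup>+ s. \<phi> s * indicator {0..t} s \<partial>lborel) \<le> (\<integral>\<^sup>+ s. S * (ennreal (exp (2 * B * s)) * indicator {0..t} s) \<partial>lborel)"
      using \<phi>S t by (intro nn_integral_mono) (auto simp: indicator_def mult.commute)
    also have "\<dots> = S * (\<integral>\<^sup>+ s. ennreal (exp (2 * B * s)) * indicator {0..t} s \<partial>lborel)"
      by (rule nn_integral_cmult) measurable
    also have "(\<integral>\<^sup>+ s. ennreal (exp (2 * B * s)) * indicator {0..t} s \<partial>lborel)
      = ennreal (exp (2 * B * t) / (2 * B) - exp (2 * B * 0) / (2 * B))"
      using t B by (intro nn_integral_FTC_Icc) (auto intro!: derivative_eq_intros)
    also have "\<dots> \<le> ennreal (exp (2 * B * t) * (1 / (2 * B)))"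
      using B by (intro ennreal_leI) simp
    finally have "\<phi> t \<le> A + ennreal B * (S * ennreal (exp (2 * B * t) * (1 / (2 * B))))"
      using le[OF t] by (meson add_left_mono mult_left_mono order.trans zero_le)
    also have "ennreal B * (S * ennreal (exp (2 * B * t) * (1 / (2 * B)))) = ennreal (exp (2 * B * t)) * (ennreal (1/2) * S)"
    proof -
      have "ennreal B * ennreal (exp (2 * B * t) * (1 / (2 * B))) = ennreal (exp (2 * B * t)) * ennreal (1/2)"
        using B by (subst ennreal_mult[symmetric], simp, simp, subst ennreal_mult[symmetric]) simp_all
      then show ?thesis by (metis mult.assoc mult.commute)
    qed
    finally have "ennreal (exp (- (2 * B * t))) * \<phi> t
       \<le> ennreal (exp (- (2 * B * t))) * (A + ennreal (exp (2 * B * t)) * (ennreal (1/2) * S))"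
      by (rule mult_left_mono) simp
    also have "\<dots> = ennreal (exp (- (2 * B * t))) * A + ennreal (1/2) * S"
      unfolding distrib_left exp_cancel' by simp
    also have "ennreal (exp (- (2 * B * t))) * A \<le> 1 * A"
      using t B by (intro mult_right_mono) (auto intro!: ennreal_leI simp flip: ennreal_1)
    finally show ?thesis by (simp add: add_right_mono)
  qed
  have S1: "S \<le> A + ennreal (1/2) * S"
    unfolding S_def by (rule SUP_least) (use step S_def in simp)
  have S2: "S \<le> ennreal R"
    unfolding S_def
  proof (rule SUP_least)
    fix t assume t: "t \<in> {0..T}"
    have "ennreal (exp (- (2 * B * t))) * \<phi> t \<le> 1 * ennreal R"
      using t B bdd[OF t] by (intro mult_mono) (auto intro!: ennreal_leI simp flip: ennreal_1)
    then show "ennreal (exp (- (2 * B * t))) * \<phi> t \<le> ennreal R" by simp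
  qed
  \<comment> \<open>Absorption of half of the finite number S into the left side; for infinite A
    there is nothing to prove.\<close>
  have S3: "S \<le> 2 * A"
  proof (cases A)
    case (real a)
    obtain r where r: "S = ennreal r" "0 \<le> r"
      using S2 by (cases S) (auto simp: top_unique)
    have "ennreal (a + 1/2 * r) = ennreal a + ennreal (1/2) * ennreal r"
      using r(2) real(1) by (subst ennreal_mult[symmetric], simp, simp, subst ennreal_plus[symmetric]) simp_all
    then have "ennreal r \<le> ennreal (a + 1/2 * r)"
      using S1 unfolding r(1) real(2) by (simp only:)
    moreover have "0 \<le> a + 1/2 * r" using r real by simp
    ultimately have "r \<le> a + 1/2 * r" by (simp only: ennreal_le_iff)
    then have "r \<le> 2 * a" by simp
    then have "ennreal r \<le> ennreal (2 * a)" by (rule ennreal_leI)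
    then show ?thesis using r real by (simp add: ennreal_mult)
  qed (simp add: ennreal_mult_top)
  have "\<phi> t \<le> ennreal (exp (2 * B * t)) * S" by (rule \<phi>S[OF t])
  also have "\<dots> \<le> ennreal (exp (2 * B * T)) * (2 * A)"
    using t B S3 by (intro mult_mono ennreal_leI) auto
  also have "\<dots> = ennreal (2 * exp (2 * B * T)) * A"
    by (simp add: ennreal_mult mult_ac)
  finally show ?thesis .
qed

section \<open>Discretization errors of integrals\<close>

lemma step_sizes_facts:
  assumes "h \<in> step_sizes T"
  shows "0 < h" "h < 1" "real (nsteps T h) * h = T" "1 \<le> nsteps T h"
proof -
  obtain N where N: "h = T / real N" "1 \<le> N"
    using assms unfolding step_sizes_def by blast
  have h: "0 < h" "h < 1" using assms by (auto simp: step_sizes_def)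
  with N have "T / h = real N" by (auto simp: field_simps)
  then have "nsteps T h = N" by (simp add: nsteps_def)
  with N h show "0 < h" "h < 1" "real (nsteps T h) * h = T" "1 \<le> nsteps T h" by auto
qed

lemma floor_index_facts:
  assumes h: "h \<in> step_sizes T" and t: "t \<in> {0..T}"
  shows "nat \<lfloor>t / h\<rfloor> \<le> nsteps T h" "grid h (nat \<lfloor>t / h\<rfloor>) \<le> t" "t < grid h (Suc (nat \<lfloor>t / h\<rfloor>))"
proof -
  note f = step_sizes_facts[OF h]
  have 0: "real (nat \<lfloor>t / h\<rfloor>) = of_int \<lfloor>t / h\<rfloor>" using t f by simp
  have "real (nat \<lfloor>t / h\<rfloor>) \<le> t / h" "t / h < real (nat \<lfloor>t / h\<rfloor>) + 1"
    unfolding 0 by linarith+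
  then show 1: "grid h (nat \<lfloor>t / h\<rfloor>) \<le> t" "t < grid h (Suc (nat \<lfloor>t / h\<rfloor>))"
    using f(1) by (auto simp: grid_def field_simps)
  have "real (nat \<lfloor>t / h\<rfloor>) * h \<le> real (nsteps T h) * h" using 1 t f by (simp add: grid_def)
  then show "nat \<lfloor>t / h\<rfloor> \<le> nsteps T h" using f(1) by simp
qed

lemma floor_index_eq:
  assumes "0 < h" "grid h j \<le> s" "s < grid h (Suc j)"
  shows "nat \<lfloor>s / h\<rfloor> = j"
proof -
  have "real j \<le> s / h" "s / h < real j + 1"
    using assms by (auto simp: grid_def field_simps)
  then have "\<lfloor>s / h\<rfloor> = int j" by linarith
  then show ?thesis by simp
qed

lemma grid_mono: "0 < h \<Longrightarrow> i \<le> j \<Longrightarrow> grid h i \<le> grid h j"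
  by (simp add: grid_def)

lemma grid_mem:
  assumes "h \<in> step_sizes T" "j \<le> nsteps T h"
  shows "grid h j \<in> {0..T}"
  using step_sizes_facts[OF assms(1)] grid_mono[of h j "nsteps T h"] assms(2) by (simp add: grid_def)

text \<open>Cells are open on the left, as for simple processes, whereas the interpolation uses
  cells closed on the left; up to \<open>grid h n\<close> the two differ only at grid points, a null
  set. Beyond \<open>grid h n\<close> the value is 0, so only completed cells count.\<close>

definition step_process ::
  "nat \<Rightarrow> real \<Rightarrow> (nat \<Rightarrow> 'w \<Rightarrow> 'b::real_vector) \<Rightarrow> real \<Rightarrow> 'w \<Rightarrow> 'b" where
  "step_process n h R s \<omega> = (\<Sum>i<n. indicator {grid h i<..grid h (Suc i)} s *\<^sub>R R i \<omega>)"

lemma simple_process_grid: "simple_process n (grid h) R = step_process n h R"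
  by (simp add: simple_process_def step_process_def fun_eq_iff)

lemma step_process_inside:
  assumes "0 < h" "j < n" "grid h j < s" "s < grid h (Suc j)"
  shows "step_process n h R s \<omega> = R j \<omega>"
proof -
  have "indicator {grid h i<..grid h (Suc i)} s *\<^sub>R R i \<omega> = (if i = j then R j \<omega> else 0)" for i
  proof (cases "i = j")
    case False
    then have "i < j \<or> j < i" by auto
    then show ?thesis
      using grid_mono[OF assms(1), of "Suc i" j] grid_mono[OF assms(1), of "Suc j" i] assms(3,4) by auto
  qed (use assms in simp)
  then show ?thesis unfolding step_process_def using assms(2) by simp
qed

lemma step_process_after:
  assumes "0 < h" "grid h n < s"
  shows "step_process n h R s \<omega> = 0"
  unfolding step_process_def
proof (rule sum.neutral, rule ballI)
  fix i assume "i \<in> {..<n}"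
  then have "grid h (Suc i) \<le> grid h n" by (intro grid_mono assms) auto
  then show "indicator {grid h i<..grid h (Suc i)} s *\<^sub>R R i \<omega> = 0" using assms(2) by simp
qed

context brownian_setup
begin

lemma fubini_nn:
  assumes "case_prod u \<in> borel_measurable (lborel \<Otimes>\<^sub>M M)"
  shows "(\<integral>\<^sup>+ \<omega>. (\<integral>\<^sup>+ s. u s \<omega> \<partial>lborel) \<partial>M) = (\<integral>\<^sup>+ s. (\<integral>\<^sup>+ \<omega>. u s \<omega> \<partial>M) \<partial>lborel)"
proof -
  interpret pair_sigma_finite lborel M ..
  show ?thesis by (rule Fubini'[OF assms])
qed

lemma step_process_measurable:
  assumes "\<And>j. j < n \<Longrightarrow> R j \<in> borel_measurable M"
  shows "(\<lambda>(s, \<omega>). step_process n h R s \<omega> :: 'b::euclidean_space) \<in> borel_measurable (lborel \<Otimes>\<^sub>M M)"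
proof -
  have [measurable]: "R j \<in> borel_measurable M" if "j \<in> {..<n}" for j
    using assms that by simp
  show ?thesis unfolding step_process_def by measurable
qed

text \<open>After Fubini the time axis is split. On completed cells \<open>near\<close> applies; on
  the unfinished cell between \<open>grid h n\<close> and t the step process vanishes, so the full
  second moment of F counts there, over a length below h.\<close>

lemma step_process_error:
  fixes F :: "real \<Rightarrow> 'w \<Rightarrow> 'b::euclidean_space"
  assumes h: "h \<in> step_sizes T"
    and F: "(\<lambda>(s, \<omega>). F s \<omega>) \<in> borel_measurable (lborel \<Otimes>\<^sub>M M)"
    and R: "\<And>j. j < nsteps T h \<Longrightarrow> R j \<in> borel_measurable M"
    and \<Psi>[measurable]: "\<Psi> \<in> borel_measurable lborel"
    and near: "\<And>j s. j < nsteps T h \<Longrightarrow> grid h j < s \<Longrightarrow> s < grid h (Suc j) \<Longrightarrow>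
        (\<integral>\<^sup>+ \<omega>. ennreal ((norm (F s \<omega> - R j \<omega>))\<^sup>2) \<partial>M) \<le> \<Psi> s"
    and bdd: "\<And>s. s \<in> {0..T} \<Longrightarrow> (\<integral>\<^sup>+ \<omega>. ennreal ((norm (F s \<omega>))\<^sup>2) \<partial>M) \<le> c"
    and t: "t \<in> {0..T}" and n: "n = nat \<lfloor>t / h\<rfloor>"
  shows "(\<integral>\<^sup>+ \<omega>. (\<integral>\<^sup>+ s. ennreal ((norm (F s \<omega> - step_process n h R s \<omega>))\<^sup>2) * indicator {0..t} s \<partial>lborel) \<partial>M)
    \<le> (\<integral>\<^sup>+ s. \<Psi> s * indicator {0..t} s \<partial>lborel) + c * ennreal h"
proof -
  note f = step_sizes_facts[OF h]
  note g = floor_index_facts[OF h t, folded n]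
  have Rn: "R j \<in> borel_measurable M" if "j < n" for j using R g(1) that by simp
  note [measurable] = F step_process_measurable[of n R h, OF Rn]
  have "(\<integral>\<^sup>+ \<omega>. (\<integral>\<^sup>+ s. ennreal ((norm (F s \<omega> - step_process n h R s \<omega>))\<^sup>2) * indicator {0..t} s \<partial>lborel) \<partial>M)
    = (\<integral>\<^sup>+ s. (\<integral>\<^sup>+ \<omega>. ennreal ((norm (F s \<omega> - step_process n h R s \<omega>))\<^sup>2) * indicator {0..t} s \<partial>M) \<partial>lborel)"
    by (rule fubini_nn) measurable
  also have "\<dots> \<le> (\<integral>\<^sup>+ s. \<Psi> s * indicator {0..t} s + c * indicator {grid h n..t} s \<partial>lborel)"
  proof (rule nn_integral_mono_AE)
    \<comment> \<open>Off the finitely many grid points every s lies strictly inside a cell, where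
      \<open>near\<close> is available.\<close>
    have "AE s in lborel. s \<notin> grid h ` {..nsteps T h}"
      by (intro AE_not_in finite_imp_null_set_lborel) simp
    then show "AE s in lborel. (\<integral>\<^sup>+ \<omega>. ennreal ((norm (F s \<omega> - step_process n h R s \<omega>))\<^sup>2) * indicator {0..t} s \<partial>M)
      \<le> \<Psi> s * indicator {0..t} s + c * indicator {grid h n..t} s"
    proof (rule AE_mp, intro AE_I2 impI)
      fix s assume s: "s \<notin> grid h ` {..nsteps T h}"
      show "(\<integral>\<^sup>+ \<omega>. ennreal ((norm (F s \<omega> - step_process n h R s \<omega>))\<^sup>2) * indicator {0..t} s \<partial>M)
        \<le> \<Psi> s * indicator {0..t} s + c * indicator {grid h n..t} s"
      proof (cases "s \<in> {0..t}")
        case True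
        then have sT: "s \<in> {0..T}" using t by auto
        define j where "j = nat \<lfloor>s / h\<rfloor>"
        note gj = floor_index_facts[OF h sT, folded j_def]
        have js: "grid h j < s" using s gj by (cases "grid h j = s") auto
        have jn: "j \<le> n" using True f(1) unfolding j_def n by (intro nat_mono floor_mono divide_right_mono) auto
        show ?thesis
        proof (cases "j = n")
          case jn: True
          have "(\<integral>\<^sup>+ \<omega>. ennreal ((norm (F s \<omega> - step_process n h R s \<omega>))\<^sup>2) * indicator {0..t} s \<partial>M)
            = (\<integral>\<^sup>+ \<omega>. ennreal ((norm (F s \<omega>))\<^sup>2) \<partial>M)"
            using True by (simp add: step_process_after[OF f(1) js[unfolded jn]])
          also have "\<dots> \<le> c" by (rule bdd[OF sT])
          also have "c \<le> \<Psi> s * indicator {0..t} s + c * indicator {grid h n..t} s"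
            using js True jn by simp
          finally show ?thesis .
        next
          case False
          then have jn: "j < n" using jn by simp
          have "(\<integral>\<^sup>+ \<omega>. ennreal ((norm (F s \<omega> - step_process n h R s \<omega>))\<^sup>2) * indicator {0..t} s \<partial>M)
            = (\<integral>\<^sup>+ \<omega>. ennreal ((norm (F s \<omega> - R j \<omega>))\<^sup>2) \<partial>M)"
            using True by (simp add: step_process_inside[OF f(1) jn js gj(3)])
          also have "\<dots> \<le> \<Psi> s" using jn g(1) js gj(3) by (intro near) auto
          also have "\<Psi> s \<le> \<Psi> s * indicator {0..t} s + c * indicator {grid h n..t} s"
            using True by simp
          finally show ?thesis .
        qed
      qed simp
    qed
  qed
  also have "\<dots> = (\<integral>\<^sup>+ s. \<Psi> s * indicator {0..t} s \<partial>lborel) + c * ennreal (t - grid h n)"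
    using g(2) by (simp add: nn_integral_add nn_integral_cmult)
  also have "\<dots> \<le> (\<integral>\<^sup>+ s. \<Psi> s * indicator {0..t} s \<partial>lborel) + c * ennreal h"
    using g(3) by (intro add_left_mono mult_left_mono ennreal_leI) (auto simp: grid_def algebra_simps)
  finally show ?thesis .
qed

lemma step_process_integral:
  fixes R :: "nat \<Rightarrow> 'w \<Rightarrow> 'b::euclidean_space"
  assumes h: "0 < h" and n: "grid h n \<le> t"
  shows "set_integrable lborel {0..t} (\<lambda>s. step_process n h R s \<omega>)"
    and "(LINT s:{0..t}|lborel. step_process n h R s \<omega>) = (\<Sum>j<n. h *\<^sub>R R j \<omega>)"
proof -
  have eq: "indicator {0..t} s *\<^sub>R step_process n h R s \<omega>
    = (\<Sum>i<n. indicator {grid h i<..grid h (Suc i)} s *\<^sub>R R i \<omega>)" for s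
    unfolding step_process_def scaleR_sum_right scaleR_scaleR
  proof (intro sum.cong refl)
    fix i assume "i \<in> {..<n}"
    then have "grid h (Suc i) \<le> grid h n" "grid h 0 \<le> grid h i"
      using grid_mono[OF h] by auto
    then have "grid h (Suc i) \<le> t" "0 \<le> grid h i"
      using n by (auto simp: grid_def[of h 0])
    then show "(indicator {0..t} s * indicator {grid h i<..grid h (Suc i)} s) *\<^sub>R R i \<omega>
      = indicator {grid h i<..grid h (Suc i)} s *\<^sub>R R i \<omega>"
      by (auto simp: indicator_def)
  qed
  have int: "integrable lborel (\<lambda>s. indicator {grid h i<..grid h (Suc i)} s *\<^sub>R R i \<omega>)"
    "(\<integral>s. indicator {grid h i<..grid h (Suc i)} s *\<^sub>R R i \<omega> \<partial>lborel) = h *\<^sub>R R i \<omega>" for i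
    using grid_mono[OF h, of i "Suc i"] by (auto simp: grid_def algebra_simps)
  show "set_integrable lborel {0..t} (\<lambda>s. step_process n h R s \<omega>)"
    unfolding set_integrable_def eq using int by (intro Bochner_Integration.integrable_sum) auto
  show "(LINT s:{0..t}|lborel. step_process n h R s \<omega>) = (\<Sum>j<n. h *\<^sub>R R j \<omega>)"
    unfolding set_lebesgue_integral_def eq using int by (subst Bochner_Integration.integral_sum) auto
qed

text \<open>Cauchy-Schwarz against the indicator of the interval, whose squared norm is t.\<close>

lemma norm_set_integral_square_le:
  fixes u :: "real \<Rightarrow> 'b::euclidean_space"
  assumes u: "set_integrable lborel {0..t} u" and t: "0 \<le> t"
  shows "ennreal ((norm (LINT s:{0..t}|lborel. u s))\<^sup>2)
    \<le> ennreal t * (\<integral>\<^sup>+ s. ennreal ((norm (u s))\<^sup>2) * indicator {0..t} s \<partial>lborel)"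
proof -
  let ?v = "\<lambda>s. indicator {0..t} s *\<^sub>R u s"
  have v: "integrable lborel ?v" using u by (simp add: set_integrable_def)
  then have [measurable]: "?v \<in> borel_measurable lborel" by simp
  have "ennreal (norm (LINT s:{0..t}|lborel. u s)) \<le> (\<integral>\<^sup>+ s. ennreal (norm (?v s)) \<partial>lborel)"
    unfolding set_lebesgue_integral_def using integral_norm_bound_ennreal[OF v] by simp
  also have "\<dots> = (\<integral>\<^sup>+ s. ennreal (norm (?v s)) * indicator {0..t} s \<partial>lborel)"
    by (intro nn_integral_cong) (auto simp: indicator_def)
  finally have "(ennreal (norm (LINT s:{0..t}|lborel. u s)))\<^sup>2
      \<le> (\<integral>\<^sup>+ s. ennreal (norm (?v s)) * indicator {0..t} s \<partial>lborel)\<^sup>2"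
    by (intro power_mono) auto
  also have "\<dots> \<le> (\<integral>\<^sup>+ s. (ennreal (norm (?v s)))\<^sup>2 \<partial>lborel) * (\<integral>\<^sup>+ s. (indicator {0..t} s)\<^sup>2 \<partial>lborel)"
    by (rule Cauchy_Schwarz_nn_integral) measurable
  also have "(\<integral>\<^sup>+ s. (indicator {0..t} s)\<^sup>2 \<partial>lborel) = ennreal t"
  proof -
    have "(\<integral>\<^sup>+ s. (indicator {0..t} s)\<^sup>2 \<partial>lborel) = (\<integral>\<^sup>+ s. indicator {0..t} s \<partial>lborel)"
      by (intro nn_integral_cong) (simp add: indicator_def)
    then show ?thesis using t by simp
  qed
  also have "(\<integral>\<^sup>+ s. (ennreal (norm (?v s)))\<^sup>2 \<partial>lborel) = (\<integral>\<^sup>+ s. ennreal ((norm (u s))\<^sup>2) * indicator {0..t} s \<partial>lborel)"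
    by (intro nn_integral_cong) (auto simp: indicator_def ennreal_power)
  finally show ?thesis by (simp add: ennreal_power mult.commute)
qed

text \<open>The Euler sum is exactly the integral of the step process up to t, so the difference is
  a single integral, to which Cauchy-Schwarz applies; the factor t it produces is bounded by
  \<open>T\<close>.\<close>

lemma time_integral_error:
  fixes F :: "real \<Rightarrow> 'w \<Rightarrow> 'b::euclidean_space"
  assumes h: "h \<in> step_sizes T"
    and F: "(\<lambda>(s, \<omega>). F s \<omega>) \<in> borel_measurable (lborel \<Otimes>\<^sub>M M)"
    and R: "\<And>j. j < nsteps T h \<Longrightarrow> R j \<in> borel_measurable M"
    and \<Psi>: "\<Psi> \<in> borel_measurable lborel"
    and near: "\<And>j s. j < nsteps T h \<Longrightarrow> grid h j < s \<Longrightarrow> s < grid h (Suc j) \<Longrightarrow>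
        (\<integral>\<^sup>+ \<omega>. ennreal ((norm (F s \<omega> - R j \<omega>))\<^sup>2) \<partial>M) \<le> \<Psi> s"
    and bdd: "\<And>s. s \<in> {0..T} \<Longrightarrow> (\<integral>\<^sup>+ \<omega>. ennreal ((norm (F s \<omega>))\<^sup>2) \<partial>M) \<le> c"
    and t: "t \<in> {0..T}" and n: "n = nat \<lfloor>t / h\<rfloor>"
    and int: "AE \<omega> in M. set_integrable lborel {0..T} (\<lambda>s. F s \<omega>)"
  shows "(\<integral>\<^sup>+ \<omega>. ennreal ((norm ((LINT s:{0..t}|lborel. F s \<omega>) - (\<Sum>j<n. h *\<^sub>R R j \<omega>)))\<^sup>2) \<partial>M)
    \<le> ennreal T * ((\<integral>\<^sup>+ s. \<Psi> s * indicator {0..t} s \<partial>lborel) + c * ennreal h)"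
proof -
  note f = step_sizes_facts[OF h]
  note g = floor_index_facts[OF h t, folded n]
  have Rn: "R j \<in> borel_measurable M" if "j < n" for j using R g(1) that by simp
  note [measurable] = F step_process_measurable[of n R h, OF Rn]
  have "(\<integral>\<^sup>+ \<omega>. ennreal ((norm ((LINT s:{0..t}|lborel. F s \<omega>) - (\<Sum>j<n. h *\<^sub>R R j \<omega>)))\<^sup>2) \<partial>M)
    \<le> (\<integral>\<^sup>+ \<omega>. ennreal T * (\<integral>\<^sup>+ s. ennreal ((norm (F s \<omega> - step_process n h R s \<omega>))\<^sup>2) * indicator {0..t} s \<partial>lborel) \<partial>M)"
  proof (rule nn_integral_mono_AE, use int in eventually_elim)
    case (elim \<omega>)
    then have Fi: "set_integrable lborel {0..t} (\<lambda>s. F s \<omega>)"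
      by (rule set_integrable_subset) (use t in auto)
    note S = step_process_integral[OF f(1) g(2), of R \<omega>]
    have "(LINT s:{0..t}|lborel. F s \<omega>) - (\<Sum>j<n. h *\<^sub>R R j \<omega>)
      = (LINT s:{0..t}|lborel. F s \<omega> - step_process n h R s \<omega>)"
      unfolding S(2)[symmetric] by (rule set_integral_diff(2)[OF Fi S(1), symmetric])
    then have "ennreal ((norm ((LINT s:{0..t}|lborel. F s \<omega>) - (\<Sum>j<n. h *\<^sub>R R j \<omega>)))\<^sup>2)
      \<le> ennreal t * (\<integral>\<^sup>+ s. ennreal ((norm (F s \<omega> - step_process n h R s \<omega>))\<^sup>2) * indicator {0..t} s \<partial>lborel)"
      using norm_set_integral_square_le[OF set_integral_diff(1)[OF Fi S(1)]] t by simp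
    also have "\<dots> \<le> ennreal T * (\<integral>\<^sup>+ s. ennreal ((norm (F s \<omega> - step_process n h R s \<omega>))\<^sup>2) * indicator {0..t} s \<partial>lborel)"
      using t by (intro mult_right_mono ennreal_leI) auto
    finally show ?case .
  qed
  also have "\<dots> = ennreal T * (\<integral>\<^sup>+ \<omega>. (\<integral>\<^sup>+ s. ennreal ((norm (F s \<omega> - step_process n h R s \<omega>))\<^sup>2) * indicator {0..t} s \<partial>lborel) \<partial>M)"
    by (rule nn_integral_cmult) measurable
  also have "\<dots> \<le> ennreal T * ((\<integral>\<^sup>+ s. \<Psi> s * indicator {0..t} s \<partial>lborel) + c * ennreal h)"
    by (intro mult_left_mono step_process_error[OF h F R \<Psi> near bdd t n]) auto
  finally show ?thesis .
qed

text \<open>The grid points up to n with the adapted values \<open>R\<close> form admissible data of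
  a simple process, and the Euler sum is its elementary integral at t, since all its cells end
  before t. The integrand z is represented on \<open>{0..T}\<close> by a jointly measurable F, later
  the clamped process.\<close>

lemma ito_integral_error:
  assumes h: "h \<in> step_sizes T"
    and F: "(\<lambda>(s, \<omega>). F s \<omega>) \<in> borel_measurable (lborel \<Otimes>\<^sub>M M)"
    and R: "\<And>j. j < nsteps T h \<Longrightarrow> R j \<in> borel_measurable (filt P (grid h j))"
    and R2: "\<And>j. j < nsteps T h \<Longrightarrow> integrable M (\<lambda>\<omega>. (norm (R j \<omega>))\<^sup>2)"
    and \<Psi>: "\<Psi> \<in> borel_measurable lborel"
    and near: "\<And>j s. j < nsteps T h \<Longrightarrow> grid h j < s \<Longrightarrow> s < grid h (Suc j) \<Longrightarrow>
        (\<integral>\<^sup>+ \<omega>. ennreal ((norm (F s \<omega> - R j \<omega>))\<^sup>2) \<partial>M) \<le> \<Psi> s"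
    and bdd: "\<And>s. s \<in> {0..T} \<Longrightarrow> (\<integral>\<^sup>+ \<omega>. ennreal ((norm (F s \<omega>))\<^sup>2) \<partial>M) \<le> c"
    and t: "t \<in> {0..T}" and n: "n = nat \<lfloor>t / h\<rfloor>"
    and z: "\<And>s \<omega>. s \<in> {0..T} \<Longrightarrow> z s \<omega> = F s \<omega>" and I: "has_ito_integral P z t I"
  shows "(\<integral>\<^sup>+ \<omega>. ennreal ((I \<omega> - (\<Sum>j<n. R j \<omega> \<bullet> dW P h j \<omega>))\<^sup>2) \<partial>M)
    \<le> 4 * ((\<integral>\<^sup>+ s. \<Psi> s * indicator {0..t} s \<partial>lborel) + c * ennreal h)"
proof -
  note f = step_sizes_facts[OF h]
  note g = floor_index_facts[OF h t, folded n]
  have RM: "R j \<in> borel_measurable M" if "j < nsteps T h" for j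
    using measurable_filt_pspace[OF R[OF that]] grid_mem[OF h, of j] that by simp
  have sd: "simple_data P n (grid h) R"
  proof -
    have "grid h 0 = 0" by (simp add: grid_def)
    then show ?thesis
      using R R2 g(1,2) t by (auto simp: simple_data_def intro: grid_mono[OF f(1)])
  qed
  have "simple_integral P n (grid h) R t \<omega> = (\<Sum>j<n. R j \<omega> \<bullet> dW P h j \<omega>)" for \<omega>
    unfolding simple_integral_def dW_def
  proof (intro sum.cong refl)
    fix i assume "i \<in> {..<n}"
    then have "grid h (Suc i) \<le> t" "grid h i \<le> t"
      using grid_mono[OF f(1), of "Suc i" n] grid_mono[OF f(1), of i n] g(2) by auto
    then show "R i \<omega> \<bullet> (W (min (grid h (Suc i)) t) \<omega> - W (min (grid h i) t) \<omega>)
      = R i \<omega> \<bullet> (W (grid h (Suc i)) \<omega> - W (grid h i) \<omega>)" by (simp add: min_absorb1)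
  qed
  then have "(\<integral>\<^sup>+ \<omega>. ennreal ((I \<omega> - (\<Sum>j<n. R j \<omega> \<bullet> dW P h j \<omega>))\<^sup>2) \<partial>M)
     \<le> 4 * (\<integral>\<^sup>+ \<omega>. (\<integral>\<^sup>+ s. ennreal ((norm (z s \<omega> - step_process n h R s \<omega>))\<^sup>2) * indicator {0..t} s \<partial>lborel) \<partial>M)"
    using ito_integral_compare[OF I t sd] by (simp add: simple_process_grid)
  also have "(\<integral>\<^sup>+ \<omega>. (\<integral>\<^sup>+ s. ennreal ((norm (z s \<omega> - step_process n h R s \<omega>))\<^sup>2) * indicator {0..t} s \<partial>lborel) \<partial>M)
    = (\<integral>\<^sup>+ \<omega>. (\<integral>\<^sup>+ s. ennreal ((norm (F s \<omega> - step_process n h R s \<omega>))\<^sup>2) * indicator {0..t} s \<partial>lborel) \<partial>M)"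
    using t z by (intro nn_integral_cong) (auto simp: indicator_def)
  also have "\<dots> \<le> (\<integral>\<^sup>+ s. \<Psi> s * indicator {0..t} s \<partial>lborel) + c * ennreal h"
    by (rule step_process_error[OF h F RM \<Psi> near bdd t n])
  finally show ?thesis by (simp add: mult_left_mono)
qed

end

section \<open>The controlled system and its Euler scheme\<close>

text \<open>The 6 is a product: 3 from squaring a sum of three terms and 2 from (1 + x)^2 \<le> 2 (1
  + x^2). The hypothesis \<open>e \<le> 1\<close> weakens e^2 to e, which fixes the mean-square rate
  h^\<alpha>. With e = 1 and y = w = 0 the same inequality yields the growth bounds.\<close>

lemma square_bound:
  fixes q c e x y w :: real
  assumes "q \<le> c * (y + (1 + x) * e + w)" "0 \<le> q" "0 \<le> c" "0 \<le> e" "e \<le> 1" "0 \<le> x" "0 \<le> y" "0 \<le> w"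
  shows "q\<^sup>2 \<le> 6 * c\<^sup>2 * (e * (1 + x\<^sup>2) + y\<^sup>2 + w\<^sup>2)"
proof -
  have "q\<^sup>2 \<le> (c * (y + (1 + x) * e + w))\<^sup>2" using assms by (intro power_mono) auto
  also have "\<dots> = c\<^sup>2 * (y + (1 + x) * e + w)\<^sup>2" by (simp add: power_mult_distrib)
  also have "(y + (1 + x) * e + w)\<^sup>2 \<le> 3 * (y\<^sup>2 + ((1 + x) * e)\<^sup>2 + w\<^sup>2)"
    using sum_squares_bound[of y "(1 + x) * e"] sum_squares_bound[of y w] sum_squares_bound[of "(1 + x) * e" w]
    by (simp add: power2_eq_square algebra_simps)
  also have "((1 + x) * e)\<^sup>2 \<le> 2 * (e * (1 + x\<^sup>2))"
  proof -
    have "(1 + x)\<^sup>2 \<le> 2 * (1 + x\<^sup>2)" using sum_squares_bound[of 1 x] by (simp add: power2_sum)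
    moreover have "e\<^sup>2 \<le> e" using assms by (simp add: power2_eq_square mult_left_le)
    ultimately have "(1 + x)\<^sup>2 * e\<^sup>2 \<le> 2 * (1 + x\<^sup>2) * e"
      using assms by (intro mult_mono) auto
    then show ?thesis by (simp add: power_mult_distrib mult_ac)
  qed
  also have "c\<^sup>2 * (3 * (y\<^sup>2 + 2 * (e * (1 + x\<^sup>2)) + w\<^sup>2)) \<le> c\<^sup>2 * (6 * (e * (1 + x\<^sup>2) + y\<^sup>2 + w\<^sup>2))"
    using assms by (intro mult_left_mono) auto
  also have "\<dots> = 6 * c\<^sup>2 * (e * (1 + x\<^sup>2) + y\<^sup>2 + w\<^sup>2)" by (simp add: algebra_simps)
  finally show ?thesis by (simp add: mult_left_mono)
qed

lemma ennreal_mult_add_one: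
  assumes "0 \<le> a" "0 \<le> q"
  shows "ennreal a * (1 + ennreal q) = ennreal (a * (1 + q))"
proof -
  have "1 + ennreal q = ennreal (1 + q)" using assms by (simp add: ennreal_plus)
  then show ?thesis using assms by (simp add: ennreal_mult)
qed

lemma (in brownian_setup) time_integral_measurable:
  fixes F :: "real \<Rightarrow> 'w \<Rightarrow> 'b::euclidean_space"
  assumes F: "(\<lambda>(s, \<omega>). F s \<omega>) \<in> borel_measurable (lborel \<Otimes>\<^sub>M M)"
  shows "(\<lambda>\<omega>. LINT s:{0..t}|lborel. F s \<omega>) \<in> borel_measurable M"
proof -
  have [measurable]: "(\<lambda>(\<omega>, s). F s \<omega>) \<in> borel_measurable (M \<Otimes>\<^sub>M lborel)"
    using measurable_compose[OF measurable_pair_swap' F] by (simp add: case_prod_beta')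
  show ?thesis unfolding set_lebesgue_integral_def by measurable
qed

text \<open>The step size does not occur here. Every constant defined in this locale is therefore
  independent of h, as the order of quantifiers in the theorem demands.\<close>

locale controlled_system = brownian_setup P
  for P :: "('w, 'd::finite, 'k::finite) control_problem" +
  fixes \<alpha> K m :: real and \<zeta> :: "real \<Rightarrow> real^'d \<Rightarrow> real^'k"
    and X :: "real \<Rightarrow> 'w \<Rightarrow> real^'d" and Y :: "real \<Rightarrow> 'w \<Rightarrow> real" and Z :: "real \<Rightarrow> 'w \<Rightarrow> real^'k"
  assumes sol: "solves P \<zeta> X Y Z"
    and \<alpha>: "0 < \<alpha>" "\<alpha> \<le> 1"
    and K: "0 \<le> K" and m: "0 \<le> m"
    and drift_lipschitz: "\<And>t s x y z w. t \<in> {0..horizon P} \<Longrightarrow> s \<in> {0..horizon P} \<Longrightarrow>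
       norm (drift P t x z - drift P s y w)
         \<le> K * (norm (x - y) + norm (z - w) + (1 + norm x + norm z) * \<bar>t - s\<bar> powr \<alpha>)"
    and drift_growth: "\<And>t x z. t \<in> {0..horizon P} \<Longrightarrow> norm (drift P t x z) \<le> K * (1 + norm x + norm z)"
    and driver_lipschitz: "\<And>t s x y z w. t \<in> {0..horizon P} \<Longrightarrow> s \<in> {0..horizon P} \<Longrightarrow>
       norm (driver P t x z - driver P s y w)
         \<le> K * (norm (x - y) + norm (z - w) + (1 + norm x + norm z) * \<bar>t - s\<bar> powr \<alpha>)"
    and driver_growth: "\<And>t x z. t \<in> {0..horizon P} \<Longrightarrow> norm (driver P t x z) \<le> K * (1 + norm x + norm z)"
    and diffusion_lipschitz: "\<And>t s x y. t \<in> {0..horizon P} \<Longrightarrow> s \<in> {0..horizon P} \<Longrightarrow>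
       norm (diffusion P t x - diffusion P s y) \<le> K * (norm (x - y) + (1 + norm x) * \<bar>t - s\<bar> powr \<alpha>)"
    and diffusion_growth: "\<And>t x. t \<in> {0..horizon P} \<Longrightarrow> norm (diffusion P t x) \<le> K * (1 + norm x)"
    and control_lipschitz: "\<And>t s x y. t \<in> {0..horizon P} \<Longrightarrow> s \<in> {0..horizon P} \<Longrightarrow>
       norm (\<zeta> t x - \<zeta> s y) \<le> K * (norm (x - y) + (1 + norm x) * \<bar>t - s\<bar> powr \<alpha>)"
    and control_growth: "\<And>t x. t \<in> {0..horizon P} \<Longrightarrow> norm (\<zeta> t x) \<le> K * (1 + norm x)"
    and terminal_lipschitz: "\<And>x y. norm (terminal P x - terminal P y) \<le> K * norm (x - y)"
    and drift_continuous: "continuous_on ({0..horizon P} \<times> UNIV \<times> UNIV) (\<lambda>(t, x, z). drift P t x z)"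
    and driver_continuous: "continuous_on ({0..horizon P} \<times> UNIV \<times> UNIV) (\<lambda>(t, x, z). driver P t x z)"
    and diffusion_continuous: "continuous_on ({0..horizon P} \<times> UNIV) (\<lambda>(t, x). diffusion P t x)"
    and moment: "\<And>s. s \<in> {0..horizon P} \<Longrightarrow> (\<integral>\<^sup>+ \<omega>. ennreal ((norm (X s \<omega>))\<^sup>2) \<partial>pspace P) \<le> ennreal m"
begin

text \<open>A common bound for three constants: \<open>K * (2 * K + 3)\<close> for a coefficient
  composed with the feedback, \<open>K + 1\<close> for the feedback itself, and
  \<open>K * (1 + K)\<close> for linear growth of the composition.\<close>

definition lip_const :: real where "lip_const = (K + 1) * (2 * K + 3)"

lemma lip_const_bounds: "K + 1 \<le> lip_const" "K * (2 * K + 3) \<le> lip_const" "K \<le> lip_const" "K * (1 + K) \<le> lip_const" "0 \<le> lip_const" "1 \<le> lip_const"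
proof -
  have "0 \<le> K * K" using K by simp
  then show "K + 1 \<le> lip_const" "K * (2 * K + 3) \<le> lip_const" "K \<le> lip_const" "K * (1 + K) \<le> lip_const" "0 \<le> lip_const" "1 \<le> lip_const"
    using K by (auto simp: lip_const_def algebra_simps)
qed

section \<open>Pointwise estimates along the feedback control\<close>

lemma control_difference:
  assumes t: "t \<in> {0..T}" "s \<in> {0..T}" and e: "\<bar>t - s\<bar> powr \<alpha> \<le> e"
  shows "norm (\<zeta> t x - v) \<le> (K + 1) * (norm (x - y) + (1 + norm x) * e + norm (\<zeta> s y - v))"
proof -
  have "norm (\<zeta> t x - v) \<le> norm (\<zeta> t x - \<zeta> s y) + norm (\<zeta> s y - v)"
    by (rule norm_diff_triangle_le[OF order.refl order.refl])
  also have "\<dots> \<le> K * (norm (x - y) + (1 + norm x) * e) + norm (\<zeta> s y - v)"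
  proof -
    have "K * (norm (x - y) + (1 + norm x) * \<bar>t - s\<bar> powr \<alpha>) \<le> K * (norm (x - y) + (1 + norm x) * e)"
      using K e by (intro mult_left_mono add_left_mono) auto
    then show ?thesis using control_lipschitz[OF t, of x y] by simp
  qed
  \<comment> \<open>The gap to v carries the factor 1; raising K to K + 1 lets all three terms share
    one constant.\<close>
  also have "\<dots> \<le> (K + 1) * (norm (x - y) + (1 + norm x) * e) + (K + 1) * norm (\<zeta> s y - v)"
  proof -
    have "0 \<le> e" using e powr_ge_zero order.trans by blast
    then show ?thesis using K by (intro add_mono mult_right_mono mult_left_le_one_le) (auto simp: distrib_right)
  qed
  finally show ?thesis by (simp add: distrib_left add.assoc)
qed

lemma control_difference_square:
  assumes t: "t \<in> {0..T}" "s \<in> {0..T}" and e: "\<bar>t - s\<bar> powr \<alpha> \<le> e" "e \<le> 1"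
  shows "(norm (\<zeta> t x - v))\<^sup>2 \<le> 6 * lip_const\<^sup>2 * (e * (1 + (norm x)\<^sup>2) + (norm (x - y))\<^sup>2 + (norm (\<zeta> s y - v))\<^sup>2)"
proof (rule square_bound)
  have e0: "0 \<le> e" using e powr_ge_zero order.trans by blast
  then show "0 \<le> e" .
  show "norm (\<zeta> t x - v) \<le> lip_const * (norm (x - y) + (1 + norm x) * e + norm (\<zeta> s y - v))"
    by (rule order.trans[OF control_difference[OF t e(1), of x v y]]) (intro mult_right_mono lip_const_bounds, use e0 in auto)
qed (use lip_const_bounds e in auto)

lemma controlled_difference_square:
  assumes lip: "norm (u t x (\<zeta> t x) - u s y v)
         \<le> K * (norm (x - y) + norm (\<zeta> t x - v) + (1 + norm x + norm (\<zeta> t x)) * \<bar>t - s\<bar> powr \<alpha>)"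
    and t: "t \<in> {0..T}" "s \<in> {0..T}" and e: "\<bar>t - s\<bar> powr \<alpha> \<le> e" "e \<le> 1"
  shows "(norm (u t x (\<zeta> t x) - u s y v))\<^sup>2
    \<le> 6 * lip_const\<^sup>2 * (e * (1 + (norm x)\<^sup>2) + (norm (x - y))\<^sup>2 + (norm (\<zeta> s y - v))\<^sup>2)"
proof (rule square_bound)
  have e0: "0 \<le> e" using e powr_ge_zero order.trans by blast
  then show "0 \<le> e" .
  let ?Q = "norm (x - y) + (1 + norm x) * e + norm (\<zeta> s y - v)"
  have Q: "0 \<le> ?Q" "norm (x - y) \<le> ?Q" "(1 + norm x) * e \<le> ?Q" using e0 by auto
  have "(1 + norm x + norm (\<zeta> t x)) * \<bar>t - s\<bar> powr \<alpha> \<le> ((1 + K) * (1 + norm x)) * e"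
    using control_growth[OF t(1), of x] e e0 K by (intro mult_mono) (auto simp: algebra_simps)
  also have "\<dots> = (1 + K) * ((1 + norm x) * e)" by simp
  also have "\<dots> \<le> (1 + K) * ?Q" using K Q by (intro mult_left_mono) auto
  \<comment> \<open>The three contributions are 1 from the state, K + 1 from the control, and 1 + K
    from the Hoelder weight, in which the control is absorbed by its linear growth; together they
    give 2 K + 3.\<close>
  finally have "norm (x - y) + norm (\<zeta> t x - v) + (1 + norm x + norm (\<zeta> t x)) * \<bar>t - s\<bar> powr \<alpha>
    \<le> ?Q + (K + 1) * ?Q + (1 + K) * ?Q"
    using Q(2) control_difference[OF t e(1), of x v y] by linarith
  also have "\<dots> = (2 * K + 3) * ?Q" by (simp add: algebra_simps)
  finally have "norm (u t x (\<zeta> t x) - u s y v) \<le> K * ((2 * K + 3) * ?Q)"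
    using lip K by (meson mult_left_mono order.trans)
  also have "\<dots> = (K * (2 * K + 3)) * ?Q" by simp
  also have "\<dots> \<le> lip_const * ?Q" using Q lip_const_bounds by (intro mult_right_mono) auto
  finally show "norm (u t x (\<zeta> t x) - u s y v) \<le> lip_const * ?Q" .
qed (use lip_const_bounds e in auto)

lemma controlled_growth_square:
  assumes gr: "norm (u t x (\<zeta> t x)) \<le> K * (1 + norm x + norm (\<zeta> t x))" and t: "t \<in> {0..T}"
  shows "(norm (u t x (\<zeta> t x)))\<^sup>2 \<le> 6 * lip_const\<^sup>2 * (1 + (norm x)\<^sup>2)"
proof -
  have "norm (u t x (\<zeta> t x)) \<le> K * (1 + norm x + K * (1 + norm x))"
    using gr control_growth[OF t, of x] K by (meson add_left_mono mult_left_mono order.trans)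
  also have "\<dots> = (K * (1 + K)) * (1 + norm x)" by (simp add: algebra_simps)
  also have "\<dots> \<le> lip_const * (1 + norm x)" using lip_const_bounds by (intro mult_right_mono) auto
  finally show ?thesis
    using square_bound[of "norm (u t x (\<zeta> t x))" lip_const 0 "norm x" 1 0] lip_const_bounds by simp
qed

text \<open>The diffusion does not see the control. The free w only gives the bound the shape shared
  by the drift, driver and control estimates, so that one expectation lemma covers all four.\<close>

lemma diffusion_difference_square:
  assumes t: "t \<in> {0..T}" "s \<in> {0..T}" and e: "\<bar>t - s\<bar> powr \<alpha> \<le> e" "e \<le> 1"
  shows "(norm (diffusion P t x - diffusion P s y))\<^sup>2
    \<le> 6 * lip_const\<^sup>2 * (e * (1 + (norm x)\<^sup>2) + (norm (x - y))\<^sup>2 + (norm w)\<^sup>2)"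
proof (rule square_bound)
  have e0: "0 \<le> e" using e powr_ge_zero order.trans by blast
  then show "0 \<le> e" .
  have "norm (diffusion P t x - diffusion P s y) \<le> K * (norm (x - y) + (1 + norm x) * e + norm w)"
    by (rule order.trans[OF diffusion_lipschitz[OF t]], intro mult_left_mono K)
       (use e in \<open>auto intro!: add_increasing2 mult_left_mono\<close>)
  also have "\<dots> \<le> lip_const * (norm (x - y) + (1 + norm x) * e + norm w)"
    using lip_const_bounds e0 by (intro mult_right_mono) auto
  finally show "norm (diffusion P t x - diffusion P s y) \<le> lip_const * (norm (x - y) + (1 + norm x) * e + norm w)" .
qed (use lip_const_bounds e in auto)

lemma diffusion_growth_square:
  assumes t: "t \<in> {0..T}"
  shows "(norm (diffusion P t x))\<^sup>2 \<le> 6 * lip_const\<^sup>2 * (1 + (norm x)\<^sup>2)"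
proof -
  have "norm (diffusion P t x) \<le> lip_const * (1 + norm x)"
    by (rule order.trans[OF diffusion_growth[OF t]]) (intro mult_right_mono lip_const_bounds, auto)
  then show ?thesis
    using square_bound[of "norm (diffusion P t x)" lip_const 0 "norm x" 1 0] lip_const_bounds by simp
qed

lemma control_growth_square:
  assumes t: "t \<in> {0..T}"
  shows "(norm (\<zeta> t x))\<^sup>2 \<le> 6 * lip_const\<^sup>2 * (1 + (norm x)\<^sup>2)"
proof -
  have "norm (\<zeta> t x) \<le> lip_const * (1 + norm x)"
    by (rule order.trans[OF control_growth[OF t]]) (intro mult_right_mono lip_const_bounds, auto)
  then show ?thesis
    using square_bound[of "norm (\<zeta> t x)" lip_const 0 "norm x" 1 0] lip_const_bounds by simp
qed

section \<open>Measurability and second moments of the coefficients along the solution\<close>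

definition Xc :: "real \<Rightarrow> 'w \<Rightarrow> real^'d" where "Xc s = X (clamp_time T s)"
definition Zc :: "real \<Rightarrow> 'w \<Rightarrow> real^'k" where "Zc s = Z (clamp_time T s)"
definition drift_c :: "real \<Rightarrow> 'w \<Rightarrow> real^'d" where
  "drift_c s \<omega> = drift P (clamp_time T s) (Xc s \<omega>) (Zc s \<omega>)"
definition driver_c :: "real \<Rightarrow> 'w \<Rightarrow> real" where
  "driver_c s \<omega> = driver P (clamp_time T s) (Xc s \<omega>) (Zc s \<omega>)"
definition diffusion_c :: "real \<Rightarrow> 'w \<Rightarrow> real^'k^'d" where
  "diffusion_c s \<omega> = diffusion P (clamp_time T s) (Xc s \<omega>)"

lemma X_S2: "X \<in> S2 P" and Z_H2: "Z \<in> H2 P"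
  using sol by (simp_all add: solves_def)

lemma Xc_joint [measurable]: "(\<lambda>(s, \<omega>). Xc s \<omega>) \<in> borel_measurable (lborel \<Otimes>\<^sub>M M)"
  unfolding Xc_def by (rule progressive_joint_measurable) (use X_S2 in \<open>simp add: S2_def\<close>)

lemma Zc_joint [measurable]: "(\<lambda>(s, \<omega>). Zc s \<omega>) \<in> borel_measurable (lborel \<Otimes>\<^sub>M M)"
  unfolding Zc_def by (rule progressive_joint_measurable) (use Z_H2 in \<open>simp add: H2_def\<close>)

lemma section_measurable:
  assumes "(\<lambda>(s, \<omega>). F s \<omega>) \<in> borel_measurable (lborel \<Otimes>\<^sub>M M)"
  shows "F s \<in> borel_measurable M"
  using measurable_compose[OF measurable_Pair1'[of s lborel M] assms] by simp

lemma X_measurable: "s \<in> {0..T} \<Longrightarrow> X s \<in> borel_measurable M"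
  using section_measurable[OF Xc_joint, of s] by (simp add: Xc_def clamp_time_eq)

lemma clamp_continuous: "continuous_on UNIV (clamp_time T)"
  unfolding clamp_time_def[abs_def] by (intro continuous_intros)

lemma clamp_T: "clamp_time T s \<in> {0..T}"
  using horizon_pos by (intro clamp_time_mem) simp

text \<open>Continuity is known only for times in \<open>{0..T}\<close>; precomposition with the
  continuous clamp extends it to the whole space, and continuity there gives Borel
  measurability.\<close>

lemma continuous_coefficient_measurable:
  fixes u :: "real \<Rightarrow> real^'d \<Rightarrow> real^'k \<Rightarrow> 'b::euclidean_space"
  assumes "continuous_on ({0..T} \<times> UNIV \<times> UNIV) (\<lambda>(t, x, z). u t x z)"
  shows "(\<lambda>(t, x, z). u (clamp_time T t) x z) \<in> borel_measurable borel"
proof (rule borel_measurable_continuous_onI)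
  have "continuous_on UNIV (\<lambda>p. (clamp_time T (fst p), fst (snd p), snd (snd p)) :: real \<times> (real^'d) \<times> (real^'k))"
    by (intro continuous_intros continuous_on_compose2[OF clamp_continuous]) auto
  then have "continuous_on UNIV (\<lambda>p :: real \<times> (real^'d) \<times> (real^'k).
      (\<lambda>(t, x, z). u t x z) (clamp_time T (fst p), fst (snd p), snd (snd p)))"
    by (rule continuous_on_compose2[OF assms]) (use clamp_T in auto)
  then show "continuous_on UNIV (\<lambda>(t, x, z). u (clamp_time T t) x z)"
    by (simp add: case_prod_beta')
qed

lemma diffusion_measurable: "(\<lambda>(t, x). diffusion P (clamp_time T t) x) \<in> borel_measurable borel"
proof (rule borel_measurable_continuous_onI)
  have "continuous_on UNIV (\<lambda>p. (clamp_time T (fst p), snd p) :: real \<times> (real^'d))"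
    by (intro continuous_intros continuous_on_compose2[OF clamp_continuous]) auto
  then have "continuous_on UNIV (\<lambda>p :: real \<times> (real^'d). (\<lambda>(t, x). diffusion P t x) (clamp_time T (fst p), snd p))"
    by (rule continuous_on_compose2[OF diffusion_continuous]) (use clamp_T in auto)
  then show "continuous_on UNIV (\<lambda>(t, x). diffusion P (clamp_time T t) x)"
    by (simp add: case_prod_beta')
qed

lemma coefficient_joint:
  fixes u :: "real \<Rightarrow> real^'d \<Rightarrow> real^'k \<Rightarrow> 'b::euclidean_space"
  assumes "continuous_on ({0..T} \<times> UNIV \<times> UNIV) (\<lambda>(t, x, z). u t x z)"
  shows "(\<lambda>(s, \<omega>). u (clamp_time T s) (Xc s \<omega>) (Zc s \<omega>)) \<in> borel_measurable (lborel \<Otimes>\<^sub>M M)"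
proof -
  have "(\<lambda>p. (fst p, Xc (fst p) (snd p), Zc (fst p) (snd p))) \<in> borel_measurable (lborel \<Otimes>\<^sub>M M)"
    using Xc_joint Zc_joint by (intro borel_measurable_Pair) (auto simp: case_prod_beta')
  from measurable_compose[OF this continuous_coefficient_measurable[OF assms]] show ?thesis
    by (simp add: case_prod_beta')
qed

lemma drift_c_joint: "(\<lambda>(s, \<omega>). drift_c s \<omega>) \<in> borel_measurable (lborel \<Otimes>\<^sub>M M)"
  unfolding drift_c_def by (rule coefficient_joint[OF drift_continuous])

lemma driver_c_joint: "(\<lambda>(s, \<omega>). driver_c s \<omega>) \<in> borel_measurable (lborel \<Otimes>\<^sub>M M)"
  unfolding driver_c_def by (rule coefficient_joint[OF driver_continuous])

lemma diffusion_c_joint: "(\<lambda>(s, \<omega>). diffusion_c s \<omega>) \<in> borel_measurable (lborel \<Otimes>\<^sub>M M)"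
proof -
  have "(\<lambda>p. (fst p, Xc (fst p) (snd p))) \<in> borel_measurable (lborel \<Otimes>\<^sub>M M)"
    using Xc_joint by (intro borel_measurable_Pair) (auto simp: case_prod_beta')
  from measurable_compose[OF this diffusion_measurable] show ?thesis
    by (simp add: case_prod_beta' diffusion_c_def)
qed

lemma coefficient_section_measurable:
  fixes u :: "real \<Rightarrow> real^'d \<Rightarrow> real^'k \<Rightarrow> 'b::euclidean_space"
  assumes u: "continuous_on ({0..T} \<times> UNIV \<times> UNIV) (\<lambda>(t, x, z). u t x z)"
    and t: "t \<in> {0..T}" and "f \<in> borel_measurable N" "g \<in> borel_measurable N"
  shows "(\<lambda>\<omega>. u t (f \<omega>) (g \<omega>)) \<in> borel_measurable N"
proof -
  have "(\<lambda>\<omega>. (t, f \<omega>, g \<omega>)) \<in> borel_measurable N"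
    using assms by (intro borel_measurable_Pair) auto
  from measurable_compose[OF this continuous_coefficient_measurable[OF u]] show ?thesis
    using t by (simp add: clamp_time_eq)
qed

lemma diffusion_section_measurable:
  assumes t: "t \<in> {0..T}" and "f \<in> borel_measurable N"
  shows "(\<lambda>\<omega>. diffusion P t (f \<omega>)) \<in> borel_measurable N"
proof -
  have "(\<lambda>\<omega>. (t, f \<omega>)) \<in> borel_measurable N"
    using assms by (intro borel_measurable_Pair) auto
  from measurable_compose[OF this diffusion_measurable] show ?thesis
    using t by (simp add: clamp_time_eq)
qed

lemma lipschitz_measurable:
  fixes u :: "'b::euclidean_space \<Rightarrow> 'c::euclidean_space"
  assumes "\<And>x y. norm (u x - u y) \<le> K * norm (x - y)"
  shows "u \<in> borel_measurable borel"
proof (intro borel_measurable_continuous_onI)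
  have "K-lipschitz_on UNIV u"
    using assms K by (intro lipschitz_onI) (auto simp: dist_norm)
  then show "continuous_on UNIV u" by (rule lipschitz_on_continuous_on)
qed

lemma control_section_measurable: "t \<in> {0..T} \<Longrightarrow> \<zeta> t \<in> borel_measurable borel"
  using control_lipschitz[of t t] by (intro lipschitz_measurable) auto

lemma terminal_measurable: "terminal P \<in> borel_measurable borel"
  by (intro lipschitz_measurable terminal_lipschitz)

text \<open>The exceptional null set depends on s. This is enough, because the local estimates are
  taken under the expectation at a fixed time.\<close>

lemma Z_eq: "s \<in> {0..T} \<Longrightarrow> AE \<omega> in M. Zc s \<omega> = \<zeta> s (Xc s \<omega>)"
  using sol by (simp add: solves_def Zc_def Xc_def clamp_time_eq)

text \<open>The factor of \<open>square_bound\<close> times a bound for the mean of 1 + |X|^2. It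
  serves both as second moment bound of the integrands and as constant of the local errors.\<close>

definition growth_const :: real where "growth_const = 6 * lip_const\<^sup>2 * (1 + m)"

lemma growth_const_pos: "0 < growth_const"
  using lip_const_bounds m by (auto simp: growth_const_def)

lemma growth_expectation:
  assumes s: "s \<in> {0..T}" and le: "AE \<omega> in M. v \<omega> \<le> 6 * lip_const\<^sup>2 * (1 + (norm (Xc s \<omega>))\<^sup>2)"
  shows "(\<integral>\<^sup>+ \<omega>. ennreal (v \<omega>) \<partial>M) \<le> ennreal growth_const"
proof -
  have [measurable]: "Xc s \<in> borel_measurable M" by (rule section_measurable[OF Xc_joint])
  have "(\<integral>\<^sup>+ \<omega>. ennreal (v \<omega>) \<partial>M) \<le> (\<integral>\<^sup>+ \<omega>. ennreal (6 * lip_const\<^sup>2) * (1 + ennreal ((norm (Xc s \<omega>))\<^sup>2)) \<partial>M)"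
  proof (rule nn_integral_mono_AE, use le in eventually_elim)
    case (elim \<omega>)
    have "ennreal (6 * lip_const\<^sup>2) * (1 + ennreal ((norm (Xc s \<omega>))\<^sup>2)) = ennreal (6 * lip_const\<^sup>2 * (1 + (norm (Xc s \<omega>))\<^sup>2))"
      by (rule ennreal_mult_add_one) auto
    then show ?case using elim by (simp only: ennreal_leI)
  qed
  also have "\<dots> = ennreal (6 * lip_const\<^sup>2) * (1 + (\<integral>\<^sup>+ \<omega>. ennreal ((norm (Xc s \<omega>))\<^sup>2) \<partial>M))"
    by (subst nn_integral_cmult) (simp_all add: nn_integral_add emeasure_space_1)
  also have "\<dots> \<le> ennreal (6 * lip_const\<^sup>2) * (1 + ennreal m)"
    using moment[OF s] s by (intro mult_left_mono add_left_mono) (auto simp: Xc_def clamp_time_eq)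
  also have "\<dots> = ennreal growth_const"
    using m by (subst ennreal_mult_add_one) (auto simp: growth_const_def)
  finally show ?thesis .
qed

text \<open>In \<open>gronwall_const\<close>, 2 T comes from the drift and 8 = 2 * 4 from each
  component of the Ito integral, the outer 2 being that of (x + y)^2 \<le> 2 x^2 + 2 y^2.
  \<open>state_const\<close> is the output of Gronwall's inequality, and
  \<open>integral_const\<close> is the accumulated local error once the state error is inserted. In
  the last two constants 4 T + 16 is twice the sum 2 T + 8 of the driver and stochastic
  contributions.\<close>

definition gronwall_const :: real where "gronwall_const = (2 * T + 8 * real CARD('d)) * growth_const"
definition state_const :: real where "state_const = 2 * exp (2 * gronwall_const * T) * (gronwall_const * (T + 1))"
definition integral_const :: real where "integral_const = growth_const * (T + 1 + T * state_const)"
definition cost_const :: real where "cost_const = 2 * K\<^sup>2 * state_const + (4 * T + 16) * integral_const"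
definition value_const :: real where "value_const = 2 * cost_const + (4 * T + 16) * integral_const"

lemma consts_pos: "0 < gronwall_const" "0 < state_const" "0 < integral_const" "0 < cost_const" "0 < value_const"
proof -
  show 1: "0 < gronwall_const" using horizon_pos growth_const_pos by (auto simp: gronwall_const_def intro!: mult_pos_pos add_pos_nonneg)
  then show 2: "0 < state_const" using horizon_pos by (auto simp: state_const_def)
  then show 3: "0 < integral_const" using horizon_pos growth_const_pos by (auto simp: integral_const_def intro!: mult_pos_pos add_pos_pos)
  show 4: "0 < cost_const" unfolding cost_const_def using 2 3 horizon_pos
    by (intro add_nonneg_pos mult_nonneg_nonneg mult_pos_pos) auto
  show "0 < value_const" unfolding value_const_def using 3 4 horizon_pos
    by (intro add_pos_pos mult_pos_pos) auto
qed

end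

section \<open>The Euler scheme for a fixed step size\<close>

lemma (in brownian_setup) dfilt_measurable:
  assumes h: "h \<in> step_sizes T" and j: "j \<le> nsteps T h" and f: "f \<in> borel_measurable (dfilt P h j)"
  shows "f \<in> borel_measurable (filt P (grid h j))"
proof (rule measurable_from_subalg[OF _ f])
  note g = grid_mem[OF h j]
  have sp: "space (filt P (grid h j)) = space M"
    using filt_subalgebra[OF g] by (simp add: subalgebra_def)
  \<comment> \<open>The increment with index i < j is known at \<open>grid h (Suc i)\<close>, which
    is at most \<open>grid h j\<close>. The discrete filtration is thus contained in the continuous
    one, which makes the Euler data adapted for elementary Ito integrals.\<close>
  have "dW P h i -` A \<inter> space M \<in> sets (filt P (grid h j))" if "i < j" "A \<in> sets borel" for i A
  proof -
    have le: "grid h i \<le> grid h (Suc i)" "grid h (Suc i) \<le> grid h j" "0 \<le> grid h i"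
      using that step_sizes_facts[OF h] grid_mono[of h i "Suc i"] grid_mono[of h "Suc i" j]
      by (auto simp: grid_def)
    have "dW P h i \<in> borel_measurable (filt P (grid h j))"
      unfolding dW_def[abs_def]
      by (rule measurable_filt_mono[OF increment_measurable_filt]) (use le g in auto)
    from measurable_sets[OF this that(2)] show ?thesis by (simp add: sp)
  qed
  then have "sigma_sets (space M) {dW P h i -` A \<inter> space M |i A. i < j \<and> A \<in> sets borel} \<subseteq> sets (filt P (grid h j))"
    unfolding sp[symmetric] by (intro sets.sigma_sets_subset) auto
  moreover have "sets (dfilt P h j) = sigma_sets (space M) {dW P h i -` A \<inter> space M |i A. i < j \<and> A \<in> sets borel}"
    unfolding dfilt_def by (rule sets_measure_of) auto
  moreover have "space (dfilt P h j) = space M"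
    unfolding dfilt_def by (rule space_measure_of) auto
  ultimately show "subalgebra (filt P (grid h j)) (dfilt P h j)"
    by (simp add: subalgebra_def sp)
qed

text \<open>\<open>\<delta>\<close> bounds the squared gap between the two feedbacks along the
  scheme and is later instantiated with the square of the maximum in the theorem. Being an extended
  nonnegative real, it may be infinite.\<close>

locale discretized_system = controlled_system P \<alpha> K m \<zeta> X Y Z
  for P :: "('w, 'd::finite, 'k::finite) control_problem" and \<alpha> K m \<zeta> X Y Z +
  fixes h :: real and \<eta> :: "nat \<Rightarrow> real^'d \<Rightarrow> real^'k" and \<delta> :: ennreal
  assumes h: "h \<in> step_sizes (horizon P)"
    and \<eta>: "\<eta> \<in> admissible_h P h"
    and \<delta>: "\<And>j. j < nsteps (horizon P) h \<Longrightarrow>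
      (\<integral>\<^sup>+ \<omega>. ennreal ((norm (\<zeta> (grid h j) (Xh P h \<eta> j \<omega>) - \<eta> j (Xh P h \<eta> j \<omega>)))\<^sup>2) \<partial>pspace P) \<le> \<delta>"
begin

abbreviation "N \<equiv> nsteps T h"
abbreviation "Xd \<equiv> Xh P h \<eta>"
abbreviation "Zd \<equiv> Zh P h \<eta>"

lemmas h_facts = step_sizes_facts[OF h]

lemma Xd_filt: "j \<le> N \<Longrightarrow> Xd j \<in> borel_measurable (filt P (grid h j))"
  and Xd_square: "j \<le> N \<Longrightarrow> integrable M (\<lambda>\<omega>. (norm (Xd j \<omega>))\<^sup>2)"
  using \<eta> by (auto simp: admissible_h_def S2h_def intro!: dfilt_measurable[OF h])

lemma Zd_filt: "j < N \<Longrightarrow> Zd j \<in> borel_measurable (filt P (grid h j))"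
  and Zd_square: "j < N \<Longrightarrow> integrable M (\<lambda>\<omega>. (norm (Zd j \<omega>))\<^sup>2)"
  using \<eta> by (auto simp: admissible_h_def S2h_def intro!: dfilt_measurable[OF h])

lemma Xd_measurable: "j \<le> N \<Longrightarrow> Xd j \<in> borel_measurable M"
  using measurable_filt_pspace[OF Xd_filt grid_mem[OF h]] .

lemma Zd_measurable: "j < N \<Longrightarrow> Zd j \<in> borel_measurable M"
  using measurable_filt_pspace[OF Zd_filt grid_mem[OF h]] by simp

definition D :: ennreal where "D = ennreal (h powr \<alpha>) + \<delta>"

text \<open>The first inequality absorbs the unfinished cell, of order h, into the rate; it relies
  on h < 1 and \<alpha> \<le> 1. The second is the condition \<open>e \<le> 1\<close> of
  \<open>square_bound\<close>.\<close>

lemma h_powr: "h \<le> h powr \<alpha>" "h powr \<alpha> \<le> 1"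
proof -
  show "h powr \<alpha> \<le> 1" using h_facts \<alpha> by (simp add: powr_le1)
  have "h powr 1 \<le> h powr \<alpha>" using h_facts \<alpha> by (intro powr_mono') auto
  then show "h \<le> h powr \<alpha>" using h_facts by simp
qed

lemma h_le_D: "ennreal h \<le> D"
  unfolding D_def using h_powr(1) by (intro add_increasing2 ennreal_leI) auto

definition \<phi> :: "real \<Rightarrow> ennreal" where
  "\<phi> s = (\<integral>\<^sup>+ \<omega>. ennreal ((norm (Xc s \<omega> - interp_state T h Xd s \<omega>))\<^sup>2) \<partial>M)"

text \<open>The cell index is measurable in time with countably many values, so joint measurability
  reduces to measurability of each \<open>Xd j\<close>.\<close>

lemma interp_state_joint: "(\<lambda>(s, \<omega>). interp_state T h Xd s \<omega>) \<in> borel_measurable (lborel \<Otimes>\<^sub>M M)"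
proof -
  have 1: "(\<lambda>p. Xd (min N i) (snd p)) \<in> borel_measurable (lborel \<Otimes>\<^sub>M M)" for i
    by (rule measurable_compose[OF measurable_snd Xd_measurable]) simp
  have 2: "(\<lambda>p. nat \<lfloor>fst p / h\<rfloor>) \<in> measurable (lborel \<Otimes>\<^sub>M M) (count_space UNIV)"
    by measurable
  show ?thesis
    unfolding interp_state_def interp_def case_prod_beta'
    by (rule measurable_compose_countable[OF 1 2])
qed

lemma \<phi>_measurable [measurable]: "\<phi> \<in> borel_measurable lborel"
proof -
  note [measurable] = interp_state_joint
  show ?thesis unfolding \<phi>_def[abs_def] by measurable
qed

lemma interp_state_inside:
  assumes "j < N" "grid h j < s" "s < grid h (Suc j)"
  shows "interp_state T h R s = R j"
  using floor_index_eq[OF h_facts(1), of j s] assms by (simp add: interp_state_def interp_def)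

lemma inside_mem:
  assumes "j < N" "grid h j < s" "s < grid h (Suc j)"
  shows "s \<in> {0..T}" "grid h j \<in> {0..T}" "\<bar>s - grid h j\<bar> powr \<alpha> \<le> h powr \<alpha>"
proof -
  show 1: "grid h j \<in> {0..T}" by (rule grid_mem[OF h]) (use assms in simp)
  have "grid h (Suc j) \<in> {0..T}" by (rule grid_mem[OF h]) (use assms in simp)
  then show "s \<in> {0..T}" using 1 assms by simp
  have "\<bar>s - grid h j\<bar> \<le> h" using assms by (simp add: grid_def algebra_simps)
  then show "\<bar>s - grid h j\<bar> powr \<alpha> \<le> h powr \<alpha>" using \<alpha> by (intro powr_mono2) auto
qed

definition \<Psi> :: "real \<Rightarrow> ennreal" where "\<Psi> s = ennreal growth_const * (D + \<phi> s)"

lemma \<Psi>_measurable: "\<Psi> \<in> borel_measurable lborel"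
  unfolding \<Psi>_def[abs_def] by measurable

text \<open>Inside a cell the interpolated state is \<open>Xd j\<close>, so the three squares have
  means bounded by m, \<open>\<phi> s\<close> and \<open>\<delta>\<close>. Enlarging the last two by
  the factor 1 + m \<ge> 1 lets \<open>D + \<phi> s\<close> be factored out.\<close>

lemma local_error_expectation:
  assumes j: "j < N" "grid h j < s" "s < grid h (Suc j)"
    and le: "AE \<omega> in M. v \<omega> \<le> 6 * lip_const\<^sup>2 * (h powr \<alpha> * (1 + (norm (Xc s \<omega>))\<^sup>2) + (norm (Xc s \<omega> - Xd j \<omega>))\<^sup>2
       + (norm (\<zeta> (grid h j) (Xd j \<omega>) - Zd j \<omega>))\<^sup>2)"
  shows "(\<integral>\<^sup>+ \<omega>. ennreal (v \<omega>) \<partial>M) \<le> \<Psi> s"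
proof -
  note mem = inside_mem[OF j]
  have [measurable]: "Xc s \<in> borel_measurable M" by (rule section_measurable[OF Xc_joint])
  have [measurable]: "Xd j \<in> borel_measurable M" "Zd j \<in> borel_measurable M"
    using Xd_measurable Zd_measurable j by simp_all
  have [measurable]: "\<zeta> (grid h j) \<in> borel_measurable borel" by (rule control_section_measurable[OF mem(2)])
  let ?x = "\<lambda>\<omega>. (norm (Xc s \<omega>))\<^sup>2" and ?y = "\<lambda>\<omega>. (norm (Xc s \<omega> - Xd j \<omega>))\<^sup>2"
    and ?w = "\<lambda>\<omega>. (norm (\<zeta> (grid h j) (Xd j \<omega>) - Zd j \<omega>))\<^sup>2"
  have "(\<integral>\<^sup>+ \<omega>. ennreal (v \<omega>) \<partial>M) \<le>
    (\<integral>\<^sup>+ \<omega>. ennreal (6 * lip_const\<^sup>2) * (ennreal (h powr \<alpha>) * (1 + ennreal (?x \<omega>)) + ennreal (?y \<omega>) + ennreal (?w \<omega>)) \<partial>M)"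
  proof (rule nn_integral_mono_AE, use le in eventually_elim)
    case (elim \<omega>)
    have "ennreal (6 * lip_const\<^sup>2) * (ennreal (h powr \<alpha>) * (1 + ennreal (?x \<omega>)) + ennreal (?y \<omega>) + ennreal (?w \<omega>))
      = ennreal (6 * lip_const\<^sup>2 * (h powr \<alpha> * (1 + ?x \<omega>) + ?y \<omega> + ?w \<omega>))"
      by (subst ennreal_mult_add_one, simp, simp, subst ennreal_plus[symmetric], simp, simp,
          subst ennreal_plus[symmetric], simp, simp, subst ennreal_mult[symmetric]) auto
    then show ?case using elim by (simp only: ennreal_leI)
  qed
  also have "\<dots> = ennreal (6 * lip_const\<^sup>2) * (ennreal (h powr \<alpha>) * (1 + (\<integral>\<^sup>+ \<omega>. ennreal (?x \<omega>) \<partial>M))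
      + (\<integral>\<^sup>+ \<omega>. ennreal (?y \<omega>) \<partial>M) + (\<integral>\<^sup>+ \<omega>. ennreal (?w \<omega>) \<partial>M))"
    by (subst nn_integral_cmult, measurable) (simp add: nn_integral_add nn_integral_cmult emeasure_space_1)
  also have "\<dots> \<le> ennreal (6 * lip_const\<^sup>2) * (ennreal (h powr \<alpha>) * (1 + ennreal m) + \<phi> s + \<delta>)"
    using moment[OF mem(1)] mem(1) \<delta>[OF j(1)] interp_state_inside[OF j, of Xd]
    by (intro mult_left_mono add_mono order.refl) (auto simp: Xc_def clamp_time_eq \<phi>_def Zh_def)
  also have "\<dots> \<le> ennreal (6 * lip_const\<^sup>2) * ((1 + ennreal m) * (D + \<phi> s))"
  proof (rule mult_left_mono)
    have "ennreal (h powr \<alpha>) * (1 + ennreal m) + \<phi> s + \<delta>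
       \<le> ennreal (h powr \<alpha>) * (1 + ennreal m) + \<phi> s * (1 + ennreal m) + \<delta> * (1 + ennreal m)"
      by (intro add_mono order.refl) (simp_all add: distrib_left add_increasing2)
    also have "\<dots> = (1 + ennreal m) * (D + \<phi> s)"
      by (simp add: D_def distrib_left distrib_right mult.commute add_ac)
    finally show "ennreal (h powr \<alpha>) * (1 + ennreal m) + \<phi> s + \<delta> \<le> (1 + ennreal m) * (D + \<phi> s)" .
  qed simp
  also have "\<dots> = \<Psi> s"
  proof -
    have "ennreal (6 * lip_const\<^sup>2) * (1 + ennreal m) = ennreal growth_const"
      using m by (subst ennreal_mult_add_one) (auto simp: growth_const_def)
    then show ?thesis by (simp add: \<Psi>_def flip: mult.assoc)
  qed
  finally show ?thesis .
qed

text \<open>In T + 1, the T comes from integrating \<open>D\<close> over \<open>{0..t}\<close> and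
  the 1 from the unfinished cell, whose length h is at most \<open>D\<close>.\<close>

definition G :: "real \<Rightarrow> ennreal" where
  "G t = ennreal growth_const * (ennreal (T + 1) * D + (\<integral>\<^sup>+ s. \<phi> s * indicator {0..t} s \<partial>lborel))"

lemma accumulated_error:
  assumes t: "t \<in> {0..T}"
  shows "(\<integral>\<^sup>+ s. \<Psi> s * indicator {0..t} s \<partial>lborel) + ennreal growth_const * ennreal h \<le> G t"
proof -
  have "(\<integral>\<^sup>+ s. \<Psi> s * indicator {0..t} s \<partial>lborel)
    = (\<integral>\<^sup>+ s. ennreal growth_const * (D * indicator {0..t} s + \<phi> s * indicator {0..t} s) \<partial>lborel)"
    by (intro nn_integral_cong) (simp add: \<Psi>_def distrib_left distrib_right mult.assoc)
  also have "\<dots> = ennreal growth_const * (D * ennreal t + (\<integral>\<^sup>+ s. \<phi> s * indicator {0..t} s \<partial>lborel))"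
    using t by (simp add: nn_integral_cmult nn_integral_add)
  finally have "(\<integral>\<^sup>+ s. \<Psi> s * indicator {0..t} s \<partial>lborel) + ennreal growth_const * ennreal h
    = ennreal growth_const * (D * ennreal t + (\<integral>\<^sup>+ s. \<phi> s * indicator {0..t} s \<partial>lborel) + ennreal h)"
    by (simp add: distrib_left)
  also have "\<dots> \<le> ennreal growth_const * (D * ennreal T + (\<integral>\<^sup>+ s. \<phi> s * indicator {0..t} s \<partial>lborel) + D)"
    using t h_le_D by (intro mult_left_mono add_mono order.refl ennreal_leI) auto
  also have "\<dots> = G t"
  proof -
    have "ennreal (T + 1) = ennreal T + 1" using horizon_pos by (simp add: ennreal_plus)
    then have "ennreal (T + 1) * D = D * ennreal T + D"
      by (simp only: distrib_right mult_1_left mult.commute[of D])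
    then show ?thesis by (simp add: G_def add_ac)
  qed
  finally show ?thesis .
qed

section \<open>Mean-square local errors on a grid cell\<close>

lemma drift_local:
  assumes j: "j < N" "grid h j < s" "s < grid h (Suc j)"
  shows "(\<integral>\<^sup>+ \<omega>. ennreal ((norm (drift_c s \<omega> - drift P (grid h j) (Xd j \<omega>) (Zd j \<omega>)))\<^sup>2) \<partial>M) \<le> \<Psi> s"
proof (rule local_error_expectation[OF j], use Z_eq[OF inside_mem(1)[OF j]] in eventually_elim)
  case (elim \<omega>)
  note mem = inside_mem[OF j]
  then show ?case
    unfolding drift_c_def elim clamp_time_eq[OF mem(1)]
    by (intro controlled_difference_square[where u = "drift P"] drift_lipschitz h_powr) auto
qed

lemma driver_local:
  assumes j: "j < N" "grid h j < s" "s < grid h (Suc j)"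
  shows "(\<integral>\<^sup>+ \<omega>. ennreal ((norm (driver_c s \<omega> - driver P (grid h j) (Xd j \<omega>) (Zd j \<omega>)))\<^sup>2) \<partial>M) \<le> \<Psi> s"
proof (rule local_error_expectation[OF j], use Z_eq[OF inside_mem(1)[OF j]] in eventually_elim)
  case (elim \<omega>)
  note mem = inside_mem[OF j]
  then show ?case
    unfolding driver_c_def elim clamp_time_eq[OF mem(1)]
    by (intro controlled_difference_square[where u = "driver P"] driver_lipschitz h_powr) auto
qed

lemma control_local:
  assumes j: "j < N" "grid h j < s" "s < grid h (Suc j)"
  shows "(\<integral>\<^sup>+ \<omega>. ennreal ((norm (Zc s \<omega> - Zd j \<omega>))\<^sup>2) \<partial>M) \<le> \<Psi> s"
proof (rule local_error_expectation[OF j], use Z_eq[OF inside_mem(1)[OF j]] in eventually_elim)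
  case (elim \<omega>)
  note mem = inside_mem[OF j]
  then show ?case
    unfolding elim by (intro control_difference_square h_powr) auto
qed

lemma diffusion_local:
  assumes j: "j < N" "grid h j < s" "s < grid h (Suc j)"
  shows "(\<integral>\<^sup>+ \<omega>. ennreal ((norm (diffusion_c s \<omega> $ i - diffusion P (grid h j) (Xd j \<omega>) $ i))\<^sup>2) \<partial>M) \<le> \<Psi> s"
proof (rule local_error_expectation[OF j], rule AE_I2)
  fix \<omega>
  note mem = inside_mem[OF j]
  have "(norm (diffusion_c s \<omega> $ i - diffusion P (grid h j) (Xd j \<omega>) $ i))\<^sup>2
    \<le> (norm (diffusion_c s \<omega> - diffusion P (grid h j) (Xd j \<omega>)))\<^sup>2"
    by (intro power_mono) (simp_all flip: vector_minus_component add: Finite_Cartesian_Product.norm_nth_le)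
  also have "\<dots> \<le> 6 * lip_const\<^sup>2 * (h powr \<alpha> * (1 + (norm (Xc s \<omega>))\<^sup>2) + (norm (Xc s \<omega> - Xd j \<omega>))\<^sup>2
       + (norm (\<zeta> (grid h j) (Xd j \<omega>) - Zd j \<omega>))\<^sup>2)"
    unfolding diffusion_c_def clamp_time_eq[OF mem(1)]
    by (rule diffusion_difference_square[OF mem h_powr(2)])
  finally show "(norm (diffusion_c s \<omega> $ i - diffusion P (grid h j) (Xd j \<omega>) $ i))\<^sup>2 \<le> \<dots>" .
qed

lemma growth_bounds:
  assumes s: "s \<in> {0..T}"
  shows "(\<integral>\<^sup>+ \<omega>. ennreal ((norm (drift_c s \<omega>))\<^sup>2) \<partial>M) \<le> ennreal growth_const"
    and "(\<integral>\<^sup>+ \<omega>. ennreal ((norm (driver_c s \<omega>))\<^sup>2) \<partial>M) \<le> ennreal growth_const"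
    and "(\<integral>\<^sup>+ \<omega>. ennreal ((norm (Zc s \<omega>))\<^sup>2) \<partial>M) \<le> ennreal growth_const"
    and "(\<integral>\<^sup>+ \<omega>. ennreal ((norm (diffusion_c s \<omega> $ i))\<^sup>2) \<partial>M) \<le> ennreal growth_const"
proof -
  show "(\<integral>\<^sup>+ \<omega>. ennreal ((norm (drift_c s \<omega>))\<^sup>2) \<partial>M) \<le> ennreal growth_const"
  proof (rule growth_expectation[OF s], use Z_eq[OF s] in eventually_elim)
    case (elim \<omega>)
    show ?case unfolding drift_c_def elim clamp_time_eq[OF s]
      by (rule controlled_growth_square[where u = "drift P", OF drift_growth[OF s] s])
  qed
  show "(\<integral>\<^sup>+ \<omega>. ennreal ((norm (driver_c s \<omega>))\<^sup>2) \<partial>M) \<le> ennreal growth_const"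
  proof (rule growth_expectation[OF s], use Z_eq[OF s] in eventually_elim)
    case (elim \<omega>)
    show ?case unfolding driver_c_def elim clamp_time_eq[OF s]
      by (rule controlled_growth_square[where u = "driver P", OF driver_growth[OF s] s])
  qed
  show "(\<integral>\<^sup>+ \<omega>. ennreal ((norm (Zc s \<omega>))\<^sup>2) \<partial>M) \<le> ennreal growth_const"
  proof (rule growth_expectation[OF s], use Z_eq[OF s] in eventually_elim)
    case (elim \<omega>)
    show ?case unfolding elim by (rule control_growth_square[OF s])
  qed
  show "(\<integral>\<^sup>+ \<omega>. ennreal ((norm (diffusion_c s \<omega> $ i))\<^sup>2) \<partial>M) \<le> ennreal growth_const"
  proof (rule growth_expectation[OF s], rule AE_I2)
    fix \<omega>
    have "(norm (diffusion_c s \<omega> $ i))\<^sup>2 \<le> (norm (diffusion_c s \<omega>))\<^sup>2"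
      by (intro power_mono Finite_Cartesian_Product.norm_nth_le) simp
    also have "\<dots> \<le> 6 * lip_const\<^sup>2 * (1 + (norm (Xc s \<omega>))\<^sup>2)"
      unfolding diffusion_c_def clamp_time_eq[OF s] by (rule diffusion_growth_square[OF s])
    finally show "(norm (diffusion_c s \<omega> $ i))\<^sup>2 \<le> \<dots>" .
  qed
qed

lemma drift_d_measurable: "j < N \<Longrightarrow> (\<lambda>\<omega>. drift P (grid h j) (Xd j \<omega>) (Zd j \<omega>)) \<in> borel_measurable M"
  by (rule coefficient_section_measurable[OF drift_continuous grid_mem[OF h]])
     (auto intro: Xd_measurable Zd_measurable)

lemma driver_d_measurable: "j < N \<Longrightarrow> (\<lambda>\<omega>. driver P (grid h j) (Xd j \<omega>) (Zd j \<omega>)) \<in> borel_measurable M"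
  by (rule coefficient_section_measurable[OF driver_continuous grid_mem[OF h]])
     (auto intro: Xd_measurable Zd_measurable)

lemma diffusion_d_filt:
  "j < N \<Longrightarrow> (\<lambda>\<omega>. diffusion P (grid h j) (Xd j \<omega>) $ i) \<in> borel_measurable (filt P (grid h j))"
  by (intro borel_measurable_vec_component diffusion_section_measurable grid_mem[OF h] Xd_filt) auto

lemma diffusion_d_square:
  assumes j: "j < N"
  shows "integrable M (\<lambda>\<omega>. (norm (diffusion P (grid h j) (Xd j \<omega>) $ i))\<^sup>2)"
proof (rule Bochner_Integration.integrable_bound)
  show "integrable M (\<lambda>\<omega>. 6 * lip_const\<^sup>2 * (1 + (norm (Xd j \<omega>))\<^sup>2))" using Xd_square[of j] j by simp
  have g: "grid h j \<in> {0..T}" by (rule grid_mem[OF h]) (use j in simp)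
  have [measurable]: "(\<lambda>\<omega>. diffusion P (grid h j) (Xd j \<omega>) $ i) \<in> borel_measurable M"
    by (rule measurable_filt_pspace[OF diffusion_d_filt[OF j] g])
  show "(\<lambda>\<omega>. (norm (diffusion P (grid h j) (Xd j \<omega>) $ i))\<^sup>2) \<in> borel_measurable M" by measurable
  show "AE \<omega> in M. norm ((norm (diffusion P (grid h j) (Xd j \<omega>) $ i))\<^sup>2) \<le> norm (6 * lip_const\<^sup>2 * (1 + (norm (Xd j \<omega>))\<^sup>2))"
  proof (rule AE_I2)
    fix \<omega>
    have "(norm (diffusion P (grid h j) (Xd j \<omega>) $ i))\<^sup>2 \<le> (norm (diffusion P (grid h j) (Xd j \<omega>)))\<^sup>2"
      by (intro power_mono Finite_Cartesian_Product.norm_nth_le) simp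
    also have "\<dots> \<le> 6 * lip_const\<^sup>2 * (1 + (norm (Xd j \<omega>))\<^sup>2)" by (rule diffusion_growth_square[OF g])
    finally show "norm ((norm (diffusion P (grid h j) (Xd j \<omega>) $ i))\<^sup>2) \<le> norm (6 * lip_const\<^sup>2 * (1 + (norm (Xd j \<omega>))\<^sup>2))"
      by simp
  qed
qed

text \<open>\<open>ito_integral\<close> is an arbitrary choice, known only through
  \<open>has_ito_integral\<close>; the error estimates hold for every representative.\<close>

lemma ito_integral_spec:
  assumes "ito_integrable P z" "t \<in> {0..T}"
  shows "has_ito_integral P z t (ito_integral P z t)"
  using assms unfolding ito_integrable_def ito_integral_def by (metis someI_ex)

section \<open>Errors of the drift, driver, diffusion and control integrals up to a fixed
  time\<close>

context
  fixes t :: real and n :: nat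
  assumes t: "t \<in> {0..T}" and n: "n = nat \<lfloor>t / h\<rfloor>"
begin

lemma drift_integral_error:
  "(\<integral>\<^sup>+ \<omega>. ennreal ((norm ((LINT s:{0..t}|lborel. drift_c s \<omega>)
      - (\<Sum>j<n. h *\<^sub>R drift P (grid h j) (Xd j \<omega>) (Zd j \<omega>))))\<^sup>2) \<partial>M) \<le> ennreal T * G t"
proof -
  have int: "AE \<omega> in M. set_integrable lborel {0..T} (\<lambda>s. drift_c s \<omega>)"
  proof -
    have "AE \<omega> in M. set_integrable lborel {0..T} (\<lambda>s. drift P s (X s \<omega>) (Z s \<omega>))"
      using sol by (simp add: solves_def)
    then show ?thesis
    proof eventually_elim
      case (elim \<omega>)
      then show ?case
        by (rule set_integrable_cong[THEN iffD1, rotated -1])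
           (auto simp: drift_c_def Xc_def Zc_def clamp_time_eq)
    qed
  qed
  show ?thesis
    by (rule order.trans[OF time_integral_error[OF h drift_c_joint drift_d_measurable \<Psi>_measurable drift_local growth_bounds(1) t n int]
          mult_left_mono[OF accumulated_error[OF t] zero_le]]) auto
qed

lemma driver_integral_error:
  "(\<integral>\<^sup>+ \<omega>. ennreal ((norm ((LINT s:{0..t}|lborel. driver_c s \<omega>)
      - (\<Sum>j<n. h *\<^sub>R driver P (grid h j) (Xd j \<omega>) (Zd j \<omega>))))\<^sup>2) \<partial>M) \<le> ennreal T * G t"
proof -
  have int: "AE \<omega> in M. set_integrable lborel {0..T} (\<lambda>s. driver_c s \<omega>)"
  proof -
    have "AE \<omega> in M. set_integrable lborel {0..T} (\<lambda>s. driver P s (X s \<omega>) (Z s \<omega>))"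
      using sol by (simp add: solves_def)
    then show ?thesis
    proof eventually_elim
      case (elim \<omega>)
      then show ?case
        by (rule set_integrable_cong[THEN iffD1, rotated -1])
           (auto simp: driver_c_def Xc_def Zc_def clamp_time_eq)
    qed
  qed
  show ?thesis
    by (rule order.trans[OF time_integral_error[OF h driver_c_joint driver_d_measurable \<Psi>_measurable driver_local growth_bounds(2) t n int]
          mult_left_mono[OF accumulated_error[OF t] zero_le]]) auto
qed

lemma diffusion_has_ito:
  "has_ito_integral P (\<lambda>s \<omega>. diffusion P s (X s \<omega>) $ i) t (ito_integral P (\<lambda>s \<omega>. diffusion P s (X s \<omega>) $ i) t)"
  using sol t by (intro ito_integral_spec) (auto simp: solves_def)

lemma control_has_ito: "has_ito_integral P Z t (ito_integral P Z t)"
  using sol t by (intro ito_integral_spec) (auto simp: solves_def)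

lemma diffusion_integral_error:
  "(\<integral>\<^sup>+ \<omega>. ennreal ((ito_integral P (\<lambda>s \<omega>. diffusion P s (X s \<omega>) $ i) t \<omega>
      - (\<Sum>j<n. (diffusion P (grid h j) (Xd j \<omega>) $ i) \<bullet> dW P h j \<omega>))\<^sup>2) \<partial>M) \<le> 4 * G t"
proof -
  have F: "(\<lambda>(s, \<omega>). diffusion_c s \<omega> $ i) \<in> borel_measurable (lborel \<Otimes>\<^sub>M M)"
    using borel_measurable_vec_component[OF diffusion_c_joint, of i] by (simp add: case_prod_beta')
  show ?thesis
    by (rule order.trans[OF ito_integral_error[OF h F diffusion_d_filt diffusion_d_square \<Psi>_measurable
          diffusion_local growth_bounds(4) t n _ diffusion_has_ito]
          mult_left_mono[OF accumulated_error[OF t] zero_le]])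
       (auto simp: diffusion_c_def Xc_def clamp_time_eq)
qed

lemma control_integral_error:
  "(\<integral>\<^sup>+ \<omega>. ennreal ((ito_integral P Z t \<omega> - (\<Sum>j<n. Zd j \<omega> \<bullet> dW P h j \<omega>))\<^sup>2) \<partial>M) \<le> 4 * G t"
  by (rule order.trans[OF ito_integral_error[OF h Zc_joint Zd_filt Zd_square \<Psi>_measurable
          control_local growth_bounds(3) t n _ control_has_ito]
          mult_left_mono[OF accumulated_error[OF t] zero_le]])
     (auto simp: Zc_def clamp_time_eq)

end

end

lemma nn_integral_norm_diff_square_le:
  fixes f g :: "'a \<Rightarrow> 'b::euclidean_space"
  assumes "f \<in> borel_measurable N" "g \<in> borel_measurable N"
  shows "(\<integral>\<^sup>+ x. ennreal ((norm (f x - g x))\<^sup>2) \<partial>N)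
    \<le> 2 * (\<integral>\<^sup>+ x. ennreal ((norm (f x))\<^sup>2) \<partial>N) + 2 * (\<integral>\<^sup>+ x. ennreal ((norm (g x))\<^sup>2) \<partial>N)"
  using nn_integral_norm_add_square_le[of f N "\<lambda>x. - g x"] assms by simp

text \<open>Jensen's inequality for the square, obtained from Cauchy-Schwarz against the constant
  1.\<close>

lemma (in prob_space) expectation_square_le:
  fixes u :: "'a \<Rightarrow> real"
  assumes u: "integrable M u"
  shows "ennreal ((expectation u)\<^sup>2) \<le> (\<integral>\<^sup>+ \<omega>. ennreal ((u \<omega>)\<^sup>2) \<partial>M)"
proof -
  have [measurable]: "u \<in> borel_measurable M" using u by simp
  have "(ennreal \<bar>expectation u\<bar>)\<^sup>2 \<le> (\<integral>\<^sup>+ \<omega>. ennreal \<bar>u \<omega>\<bar> * 1 \<partial>M)\<^sup>2"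
    using integral_norm_bound_ennreal[OF u] by (intro power_mono) auto
  also have "\<dots> \<le> (\<integral>\<^sup>+ \<omega>. (ennreal \<bar>u \<omega>\<bar>)\<^sup>2 \<partial>M) * (\<integral>\<^sup>+ \<omega>. 1\<^sup>2 \<partial>M)"
    by (rule Cauchy_Schwarz_nn_integral) measurable
  finally show ?thesis by (simp add: ennreal_power emeasure_space_1)
qed

section \<open>Global errors of state, control, cost and value\<close>

context discretized_system
begin

lemma drift_integral_measurable: "(\<lambda>\<omega>. LINT s:{0..t}|lborel. drift_c s \<omega>) \<in> borel_measurable M"
  by (rule time_integral_measurable[OF drift_c_joint])

lemma driver_integral_measurable: "(\<lambda>\<omega>. LINT s:{0..t}|lborel. driver_c s \<omega>) \<in> borel_measurable M"
  by (rule time_integral_measurable[OF driver_c_joint])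

lemma dW_measurable: "j < N \<Longrightarrow> dW P h j \<in> borel_measurable M"
  unfolding dW_def[abs_def]
  using grid_mem[OF h, of j] grid_mem[OF h, of "Suc j"] by (intro borel_measurable_diff bm_measurable) auto

lemma set_integral_clamped:
  assumes t: "t \<in> {0..T}"
  shows "(LINT s:{0..t}|lborel. drift P s (X s \<omega>) (Z s \<omega>)) = (LINT s:{0..t}|lborel. drift_c s \<omega>)"
    and "(LINT s:{0..t}|lborel. driver P s (X s \<omega>) (Z s \<omega>)) = (LINT s:{0..t}|lborel. driver_c s \<omega>)"
  using t by (auto intro!: set_lebesgue_integral_cong simp: drift_c_def driver_c_def Xc_def Zc_def clamp_time_eq)

lemma interp_state_eq: "t \<in> {0..T} \<Longrightarrow> interp_state T h R t = R (nat \<lfloor>t / h\<rfloor>)"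
  using floor_index_facts(1)[OF h, of t] by (simp add: interp_state_def interp_def)

lemma norm_square_components: "(norm (x :: real^'n::finite))\<^sup>2 = (\<Sum>i\<in>UNIV. (x $ i)\<^sup>2)"
  unfolding power2_norm_eq_inner inner_vec_def by (simp add: power2_eq_square)

text \<open>Subtracting the Euler recursion from the equation cancels the initial value and leaves a
  drift error \<open>A\<close> and a stochastic error \<open>B\<close>. The latter is treated
  component by component, because the Ito estimate is scalar. Since \<open>G\<close> contains the
  integral of \<open>\<phi>\<close>, this is the Gronwall inequality in disguise.\<close>

lemma state_step:
  assumes t: "t \<in> {0..T}"
  shows "\<phi> t \<le> ennreal (2 * T + 8 * real CARD('d)) * G t"
proof -
  define n where "n = nat \<lfloor>t / h\<rfloor>"
  have nN: "n \<le> N" using floor_index_facts(1)[OF h t] by (simp add: n_def)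
  define A where "A \<omega> = (LINT s:{0..t}|lborel. drift_c s \<omega>) - (\<Sum>j<n. h *\<^sub>R drift P (grid h j) (Xd j \<omega>) (Zd j \<omega>))" for \<omega>
  define B where "B \<omega> = (\<chi> i. ito_integral P (\<lambda>s \<omega>. diffusion P s (X s \<omega>) $ i) t \<omega>
      - (\<Sum>j<n. (diffusion P (grid h j) (Xd j \<omega>) $ i) \<bullet> dW P h j \<omega>))" for \<omega>
  have Am: "A \<in> borel_measurable M"
    unfolding A_def[abs_def] using nN
    by (intro borel_measurable_diff drift_integral_measurable borel_measurable_sum borel_measurable_scaleR
          drift_d_measurable borel_measurable_const) auto
  have Bi: "(\<lambda>\<omega>. B \<omega> $ i) \<in> borel_measurable M" for i
  proof -
    have "ito_integral P (\<lambda>s \<omega>. diffusion P s (X s \<omega>) $ i) t \<in> borel_measurable M"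
      using diffusion_has_ito[OF t n_def] by (simp add: has_ito_integral_def)
    moreover have "(\<lambda>\<omega>. (diffusion P (grid h j) (Xd j \<omega>) $ i) \<bullet> dW P h j \<omega>) \<in> borel_measurable M" if "j < n" for j
      using that nN grid_mem[OF h, of j]
      by (intro borel_measurable_inner dW_measurable measurable_filt_pspace[OF diffusion_d_filt]) auto
    ultimately show ?thesis unfolding B_def vec_lambda_beta
      by (intro borel_measurable_diff borel_measurable_sum) auto
  qed
  have Bm: "B \<in> borel_measurable M"
    by (rule borel_measurable_euclidean_space[THEN iffD2])
       (auto simp: Basis_vec_def inner_axis intro: Bi)
  have "\<phi> t = (\<integral>\<^sup>+ \<omega>. ennreal ((norm (A \<omega> + B \<omega>))\<^sup>2) \<partial>M)"
    unfolding \<phi>_def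
  proof (rule nn_integral_cong_AE)
    have "AE \<omega> in M. X t \<omega> = init P + (LINT s:{0..t}|lborel. drift P s (X s \<omega>) (Z s \<omega>))
                + ito_integral_vec P (\<lambda>s \<omega>. diffusion P s (X s \<omega>)) t \<omega>"
      using sol t by (simp add: solves_def)
    then show "AE \<omega> in M. ennreal ((norm (Xc t \<omega> - interp_state T h Xd t \<omega>))\<^sup>2) = ennreal ((norm (A \<omega> + B \<omega>))\<^sup>2)"
    proof eventually_elim
      case (elim \<omega>)
      have "Xd n \<omega> = init P + (\<Sum>j<n. h *\<^sub>R drift P (grid h j) (Xd j \<omega>) (Zd j \<omega>))
         + (\<Sum>j<n. diffusion P (grid h j) (Xd j \<omega>) *v dW P h j \<omega>)"
        by (subst Xh.simps) (simp add: Zh_def)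
      moreover have "ito_integral_vec P (\<lambda>s \<omega>. diffusion P s (X s \<omega>)) t \<omega>
         - (\<Sum>j<n. diffusion P (grid h j) (Xd j \<omega>) *v dW P h j \<omega>) = B \<omega>"
        by (simp add: vec_eq_iff B_def ito_integral_vec_def matrix_vector_mul_component)
      ultimately have "Xc t \<omega> - interp_state T h Xd t \<omega> = A \<omega> + B \<omega>"
        using elim t by (simp add: Xc_def clamp_time_eq interp_state_eq A_def set_integral_clamped flip: n_def)
      then show ?case by simp
    qed
  qed
  also have "\<dots> \<le> 2 * (\<integral>\<^sup>+ \<omega>. ennreal ((norm (A \<omega>))\<^sup>2) \<partial>M) + 2 * (\<integral>\<^sup>+ \<omega>. ennreal ((norm (B \<omega>))\<^sup>2) \<partial>M)"
    by (rule nn_integral_norm_add_square_le[OF Am Bm])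
  also have "(\<integral>\<^sup>+ \<omega>. ennreal ((norm (B \<omega>))\<^sup>2) \<partial>M) = (\<Sum>i\<in>UNIV. \<integral>\<^sup>+ \<omega>. ennreal ((B \<omega> $ i)\<^sup>2) \<partial>M)"
    using Bi by (simp add: norm_square_components nn_integral_sum flip: sum_ennreal)
  also have "\<dots> \<le> (\<Sum>i\<in>(UNIV :: 'd set). 4 * G t)"
    unfolding B_def vec_lambda_beta by (intro sum_mono diffusion_integral_error[OF t n_def])
  also have "(\<integral>\<^sup>+ \<omega>. ennreal ((norm (A \<omega>))\<^sup>2) \<partial>M) \<le> ennreal T * G t"
    unfolding A_def by (rule drift_integral_error[OF t n_def])
  also have "2 * (ennreal T * G t) + 2 * (\<Sum>i\<in>(UNIV :: 'd set). 4 * G t) = ennreal (2 * T + 8 * real CARD('d)) * G t"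
  proof -
    have "ennreal (2 * T + 8 * real CARD('d)) = 2 * ennreal T + 8 * of_nat CARD('d)"
      using horizon_pos by (simp add: ennreal_plus ennreal_mult ennreal_of_nat_eq_real_of_nat)
    then show ?thesis by (simp add: distrib_left mult_ac)
  qed
  finally show ?thesis by (simp add: add_mono mult_left_mono)
qed

text \<open>This bound may depend on h, as the sum over all grid indices shows. It serves solely as
  the boundedness premise of \<open>gronwall_ennreal\<close>.\<close>

lemma state_bounded: "\<exists>R. \<forall>t\<in>{0..T}. \<phi> t \<le> ennreal R"
proof (intro exI ballI)
  fix t assume t: "t \<in> {0..T}"
  define n where "n = nat \<lfloor>t / h\<rfloor>"
  have nN: "n \<le> N" using floor_index_facts(1)[OF h t] by (simp add: n_def)
  have "\<phi> t = (\<integral>\<^sup>+ \<omega>. ennreal ((norm (X t \<omega> - Xd n \<omega>))\<^sup>2) \<partial>M)"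
    using t by (simp add: \<phi>_def Xc_def clamp_time_eq interp_state_eq n_def)
  also have "\<dots> \<le> 2 * (\<integral>\<^sup>+ \<omega>. ennreal ((norm (X t \<omega>))\<^sup>2) \<partial>M) + 2 * (\<integral>\<^sup>+ \<omega>. ennreal ((norm (Xd n \<omega>))\<^sup>2) \<partial>M)"
    by (rule nn_integral_norm_diff_square_le[OF X_measurable[OF t] Xd_measurable[OF nN]])
  also have "(\<integral>\<^sup>+ \<omega>. ennreal ((norm (Xd n \<omega>))\<^sup>2) \<partial>M) = ennreal (expectation (\<lambda>\<omega>. (norm (Xd n \<omega>))\<^sup>2))"
    by (rule nn_integral_eq_integral[OF Xd_square[OF nN]]) simp
  also have "\<dots> \<le> ennreal (\<Sum>n\<le>N. expectation (\<lambda>\<omega>. (norm (Xd n \<omega>))\<^sup>2))"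
    using nN by (intro ennreal_leI member_le_sum) auto
  also have "(\<integral>\<^sup>+ \<omega>. ennreal ((norm (X t \<omega>))\<^sup>2) \<partial>M) \<le> ennreal m" by (rule moment[OF t])
  also have "2 * ennreal m + 2 * ennreal (\<Sum>n\<le>N. expectation (\<lambda>\<omega>. (norm (Xd n \<omega>))\<^sup>2))
     = ennreal (2 * m + 2 * (\<Sum>n\<le>N. expectation (\<lambda>\<omega>. (norm (Xd n \<omega>))\<^sup>2)))"
    using m by (simp add: ennreal_plus ennreal_mult sum_nonneg)
  finally show "\<phi> t \<le> ennreal (2 * m + 2 * (\<Sum>n\<le>N. expectation (\<lambda>\<omega>. (norm (Xd n \<omega>))\<^sup>2)))"
    by (simp add: add_mono mult_left_mono)
qed

lemma state_error:
  assumes t: "t \<in> {0..T}"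
  shows "\<phi> t \<le> ennreal state_const * D"
proof -
  obtain R where R: "\<And>t. t \<in> {0..T} \<Longrightarrow> \<phi> t \<le> ennreal R" using state_bounded by blast
  have step: "\<phi> t \<le> ennreal (gronwall_const * (T + 1)) * D + ennreal gronwall_const * (\<integral>\<^sup>+ s. \<phi> s * indicator {0..t} s \<partial>lborel)"
    if t: "t \<in> {0..T}" for t
  proof -
    have "ennreal (2 * T + 8 * real CARD('d)) * ennreal growth_const = ennreal gronwall_const"
      using horizon_pos growth_const_pos by (subst ennreal_mult[symmetric]) (auto simp: gronwall_const_def)
    then have "ennreal (2 * T + 8 * real CARD('d)) * G t
      = ennreal gronwall_const * (ennreal (T + 1) * D + (\<integral>\<^sup>+ s. \<phi> s * indicator {0..t} s \<partial>lborel))"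
      by (simp add: G_def flip: mult.assoc)
    also have "\<dots> = ennreal (gronwall_const * (T + 1)) * D + ennreal gronwall_const * (\<integral>\<^sup>+ s. \<phi> s * indicator {0..t} s \<partial>lborel)"
    proof -
      have "ennreal (gronwall_const * (T + 1)) = ennreal gronwall_const * ennreal (T + 1)"
        by (rule ennreal_mult) (use consts_pos horizon_pos in auto)
      then show ?thesis by (simp only: distrib_left mult.assoc)
    qed
    finally show ?thesis using state_step[OF t] by simp
  qed
  have "\<phi> t \<le> ennreal (2 * exp (2 * gronwall_const * T)) * (ennreal (gronwall_const * (T + 1)) * D)"
    by (rule gronwall_ennreal[OF step R consts_pos(1) t])
  also have "\<dots> = ennreal state_const * D"
    using consts_pos horizon_pos unfolding state_const_def by (subst mult.assoc[symmetric], subst ennreal_mult[symmetric]) auto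
  finally show ?thesis .
qed

lemma G_bound:
  assumes t: "t \<in> {0..T}"
  shows "G t \<le> ennreal integral_const * D"
proof -
  have "(\<integral>\<^sup>+ s. \<phi> s * indicator {0..t} s \<partial>lborel) \<le> (\<integral>\<^sup>+ s. (ennreal state_const * D) * indicator {0..T} s \<partial>lborel)"
    using state_error t by (intro nn_integral_mono) (auto simp: indicator_def)
  also have "\<dots> = ennreal state_const * D * ennreal T" using horizon_pos by (simp add: nn_integral_cmult)
  finally have "G t \<le> ennreal growth_const * (ennreal (T + 1) * D + ennreal state_const * D * ennreal T)"
    unfolding G_def by (intro mult_left_mono add_left_mono) auto
  also have "\<dots> = ennreal growth_const * (ennreal (T + 1) + ennreal T * ennreal state_const) * D"
    by (simp add: distrib_left distrib_right mult_ac)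
  also have "ennreal growth_const * (ennreal (T + 1) + ennreal T * ennreal state_const) = ennreal integral_const"
    using consts_pos growth_const_pos horizon_pos unfolding integral_const_def
    by (subst ennreal_mult[symmetric], simp, simp, subst ennreal_plus[symmetric], simp, simp, subst ennreal_mult[symmetric]) auto
  finally show ?thesis .
qed

lemma state_norm_error:
  assumes t: "t \<in> {0..T}"
  shows "(\<integral>\<^sup>+ \<omega>. ennreal ((norm (X t \<omega> - interp_state T h Xd t \<omega>))\<^sup>2) \<partial>M) \<le> ennreal state_const * D"
  using state_error[OF t] t by (simp add: \<phi>_def Xc_def clamp_time_eq)

text \<open>Off the grid points the interpolated control is the step process over all N cells, so
  the case t = T of \<open>step_process_error\<close> applies; the state error enters through
  \<open>\<Psi>\<close>.\<close>

lemma control_norm_error: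
  "(\<integral>\<^sup>+ \<omega>. (\<integral>\<^sup>+ s. ennreal ((norm (Z s \<omega> - interp_control T h Zd s \<omega>))\<^sup>2) * indicator {0..T} s \<partial>lborel) \<partial>M)
    \<le> ennreal integral_const * D"
proof -
  have T: "T \<in> {0..T}" using horizon_pos by simp
  have NT: "N = nat \<lfloor>T / h\<rfloor>" by (simp add: nsteps_def)
  have "(\<integral>\<^sup>+ \<omega>. (\<integral>\<^sup>+ s. ennreal ((norm (Z s \<omega> - interp_control T h Zd s \<omega>))\<^sup>2) * indicator {0..T} s \<partial>lborel) \<partial>M)
    = (\<integral>\<^sup>+ \<omega>. (\<integral>\<^sup>+ s. ennreal ((norm (Zc s \<omega> - step_process N h Zd s \<omega>))\<^sup>2) * indicator {0..T} s \<partial>lborel) \<partial>M)"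
  proof (rule nn_integral_cong, rule nn_integral_cong_AE)
    fix \<omega>
    have "AE s in lborel. s \<notin> grid h ` {..N}"
      by (intro AE_not_in finite_imp_null_set_lborel) simp
    then show "AE s in lborel. ennreal ((norm (Z s \<omega> - interp_control T h Zd s \<omega>))\<^sup>2) * indicator {0..T} s
      = ennreal ((norm (Zc s \<omega> - step_process N h Zd s \<omega>))\<^sup>2) * indicator {0..T} s"
    proof eventually_elim
      case (elim s)
      show ?case
      proof (cases "s \<in> {0..T}")
        case True
        define j where "j = nat \<lfloor>s / h\<rfloor>"
        note f = floor_index_facts[OF h True, folded j_def]
        have js: "grid h j < s" using elim f by (cases "grid h j = s") auto
        have "grid h N = T" using h_facts by (simp add: grid_def)
        \<comment> \<open>Index N would place s strictly beyond T, so the truncation at N - 1 in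
          \<open>interp_control\<close> is inactive.\<close>
        then have jN: "j < N" using js True f(1) by (cases "j = N") auto
        have "interp_control T h Zd s = Zd j"
          using jN by (simp add: interp_control_def interp_def flip: j_def)
        then show ?thesis
          using True by (simp add: step_process_inside[OF h_facts(1) jN js f(3)] Zc_def clamp_time_eq)
      qed simp
    qed
  qed
  also have "\<dots> \<le> (\<integral>\<^sup>+ s. \<Psi> s * indicator {0..T} s \<partial>lborel) + ennreal growth_const * ennreal h"
    by (rule step_process_error[OF h Zc_joint Zd_measurable \<Psi>_measurable control_local growth_bounds(3) T NT])
  also have "\<dots> \<le> G T" by (rule accumulated_error[OF T])
  also have "\<dots> \<le> ennreal integral_const * D" by (rule G_bound[OF T])
  finally show ?thesis .
qed

definition driver_gap :: "real \<Rightarrow> nat \<Rightarrow> 'w \<Rightarrow> real" where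
  "driver_gap t n \<omega> = (LINT s:{0..t}|lborel. driver_c s \<omega>)
     - (\<Sum>j<n. h *\<^sub>R driver P (grid h j) (Xd j \<omega>) (Zd j \<omega>))"

definition ito_gap :: "real \<Rightarrow> nat \<Rightarrow> 'w \<Rightarrow> real" where
  "ito_gap t n \<omega> = ito_integral P Z t \<omega> - (\<Sum>j<n. Zd j \<omega> \<bullet> dW P h j \<omega>)"

lemma gap_measurable:
  assumes t: "t \<in> {0..T}" and n: "n = nat \<lfloor>t / h\<rfloor>"
  shows "driver_gap t n \<in> borel_measurable M" "ito_gap t n \<in> borel_measurable M"
proof -
  have nN: "n \<le> N" using floor_index_facts(1)[OF h t] n by simp
  show "driver_gap t n \<in> borel_measurable M"
    unfolding driver_gap_def[abs_def] using nN
    by (intro borel_measurable_diff driver_integral_measurable borel_measurable_sum borel_measurable_scaleR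
          driver_d_measurable borel_measurable_const) auto
  have "ito_integral P Z t \<in> borel_measurable M"
    using control_has_ito[OF t n] by (simp add: has_ito_integral_def)
  then show "ito_gap t n \<in> borel_measurable M"
    unfolding ito_gap_def[abs_def] using nN
    by (intro borel_measurable_diff borel_measurable_sum borel_measurable_inner Zd_measurable dW_measurable) auto
qed

lemma gap_difference_bound:
  assumes t: "t \<in> {0..T}" and n: "n = nat \<lfloor>t / h\<rfloor>"
  shows "(\<integral>\<^sup>+ \<omega>. ennreal ((norm (driver_gap t n \<omega> - ito_gap t n \<omega>))\<^sup>2) \<partial>M) \<le> ennreal ((2 * T + 8) * integral_const) * D"
proof -
  have "(\<integral>\<^sup>+ \<omega>. ennreal ((norm (driver_gap t n \<omega> - ito_gap t n \<omega>))\<^sup>2) \<partial>M)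
    \<le> 2 * (\<integral>\<^sup>+ \<omega>. ennreal ((norm (driver_gap t n \<omega>))\<^sup>2) \<partial>M) + 2 * (\<integral>\<^sup>+ \<omega>. ennreal ((norm (ito_gap t n \<omega>))\<^sup>2) \<partial>M)"
    by (rule nn_integral_norm_diff_square_le[OF gap_measurable[OF t n]])
  also have "\<dots> \<le> 2 * (ennreal T * G t) + 2 * (4 * G t)"
    using driver_integral_error[OF t n] control_integral_error[OF t n]
    unfolding driver_gap_def ito_gap_def by (intro add_mono mult_left_mono) auto
  also have "\<dots> = ennreal (2 * T + 8) * G t"
  proof -
    have "ennreal (2 * T + 8) = 2 * ennreal T + 8"
      using horizon_pos by (simp add: ennreal_plus ennreal_mult)
    then show ?thesis by (simp add: distrib_right mult.assoc[symmetric])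
  qed
  also have "\<dots> \<le> ennreal (2 * T + 8) * (ennreal integral_const * D)"
    by (intro mult_left_mono G_bound t) auto
  also have "\<dots> = ennreal ((2 * T + 8) * integral_const) * D"
    using consts_pos horizon_pos by (subst mult.assoc[symmetric], subst ennreal_mult[symmetric]) auto
  finally show ?thesis .
qed

text \<open>The expected costs are the initial values of the two value processes; a mean-square
  bound on the costs will control the difference of these constants. The terminal part is the state
  error at T, multiplied by the squared Lipschitz constant, and the other parts are the gaps at
  T.\<close>

lemma cost_error:
  "(\<integral>\<^sup>+ \<omega>. ennreal ((cost P X Z \<omega> - cost_h P h \<eta> \<omega>)\<^sup>2) \<partial>M) \<le> ennreal cost_const * D"
proof -
  have T: "T \<in> {0..T}" using horizon_pos by simp
  have NT: "N = nat \<lfloor>T / h\<rfloor>" by (simp add: nsteps_def)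
  define E where "E \<omega> = terminal P (X T \<omega>) - terminal P (Xd N \<omega>)" for \<omega>
  have Em: "E \<in> borel_measurable M"
    unfolding E_def[abs_def]
    by (intro borel_measurable_diff measurable_compose[OF _ terminal_measurable] X_measurable[OF T] Xd_measurable) simp
  have eq: "cost P X Z \<omega> - cost_h P h \<eta> \<omega> = E \<omega> + (driver_gap T N \<omega> - ito_gap T N \<omega>)" for \<omega>
    unfolding cost_def cost_h_def E_def driver_gap_def ito_gap_def set_integral_clamped[OF T]
    by (simp add: mult.commute)
  have "(\<integral>\<^sup>+ \<omega>. ennreal ((norm (E \<omega>))\<^sup>2) \<partial>M) \<le> (\<integral>\<^sup>+ \<omega>. ennreal (K\<^sup>2) * ennreal ((norm (X T \<omega> - interp_state T h Xd T \<omega>))\<^sup>2) \<partial>M)"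
  proof (rule nn_integral_mono)
    fix \<omega>
    have "(norm (E \<omega>))\<^sup>2 \<le> (K * norm (X T \<omega> - Xd N \<omega>))\<^sup>2"
      unfolding E_def by (intro power_mono terminal_lipschitz) simp
    then show "ennreal ((norm (E \<omega>))\<^sup>2) \<le> ennreal (K\<^sup>2) * ennreal ((norm (X T \<omega> - interp_state T h Xd T \<omega>))\<^sup>2)"
      unfolding interp_state_eq[OF T] NT[symmetric]
      by (subst ennreal_mult[symmetric]) (auto simp: power_mult_distrib intro: ennreal_leI)
  qed
  also have "\<dots> = ennreal (K\<^sup>2) * (\<integral>\<^sup>+ \<omega>. ennreal ((norm (X T \<omega> - interp_state T h Xd T \<omega>))\<^sup>2) \<partial>M)"
    unfolding interp_state_eq[OF T] NT[symmetric]
    using X_measurable[OF T] Xd_measurable[of N] by (intro nn_integral_cmult) simp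
  also have "\<dots> \<le> ennreal (K\<^sup>2) * (ennreal state_const * D)"
    by (intro mult_left_mono state_norm_error[OF T]) simp
  finally have E: "(\<integral>\<^sup>+ \<omega>. ennreal ((norm (E \<omega>))\<^sup>2) \<partial>M) \<le> ennreal (K\<^sup>2 * state_const) * D"
    using consts_pos by (simp add: ennreal_mult mult.assoc)
  have "(\<integral>\<^sup>+ \<omega>. ennreal ((cost P X Z \<omega> - cost_h P h \<eta> \<omega>)\<^sup>2) \<partial>M)
    = (\<integral>\<^sup>+ \<omega>. ennreal ((norm (E \<omega> + (driver_gap T N \<omega> - ito_gap T N \<omega>)))\<^sup>2) \<partial>M)"
    unfolding eq by simp
  also have "\<dots> \<le> 2 * (\<integral>\<^sup>+ \<omega>. ennreal ((norm (E \<omega>))\<^sup>2) \<partial>M)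
      + 2 * (\<integral>\<^sup>+ \<omega>. ennreal ((norm (driver_gap T N \<omega> - ito_gap T N \<omega>))\<^sup>2) \<partial>M)"
    by (rule nn_integral_norm_add_square_le[OF Em borel_measurable_diff[OF gap_measurable[OF T NT]]])
  also have "\<dots> \<le> 2 * (ennreal (K\<^sup>2 * state_const) * D) + 2 * (ennreal ((2 * T + 8) * integral_const) * D)"
    by (intro add_mono mult_left_mono E gap_difference_bound[OF T NT]) auto
  also have "\<dots> = (2 * ennreal (K\<^sup>2 * state_const) + 2 * ennreal ((2 * T + 8) * integral_const)) * D"
    by (simp add: distrib_right mult.assoc)
  also have "2 * ennreal (K\<^sup>2 * state_const) + 2 * ennreal ((2 * T + 8) * integral_const) = ennreal (2 * (K\<^sup>2 * state_const) + 2 * ((2 * T + 8) * integral_const))"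
    using consts_pos horizon_pos by (subst ennreal_plus) (simp_all add: ennreal_mult)
  also have "2 * (K\<^sup>2 * state_const) + 2 * ((2 * T + 8) * integral_const) = cost_const"
    by (simp add: cost_const_def algebra_simps)
  finally show ?thesis .
qed

text \<open>The values differ by the constant a, the difference of the expected costs, minus the
  driver gap plus the stochastic gap at t. The constant is bounded by \<open>cost_error\<close> and
  Jensen's inequality.\<close>

lemma value_norm_error:
  assumes t: "t \<in> {0..T}"
  shows "(\<integral>\<^sup>+ \<omega>. ennreal ((norm (Y t \<omega> - interp_state T h (Yh P h \<eta>) t \<omega>))\<^sup>2) \<partial>M) \<le> ennreal value_const * D"
proof -
  define n where "n = nat \<lfloor>t / h\<rfloor>"
  define a where "a = expectation (\<lambda>\<omega>. cost P X Z \<omega> - cost_h P h \<eta> \<omega>)"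
  have int: "integrable M (cost P X Z)" "integrable M (cost_h P h \<eta>)"
    using sol \<eta> by (simp_all add: solves_def admissible_h_def)
  have a: "ennreal (a\<^sup>2) \<le> ennreal cost_const * D"
    unfolding a_def by (rule order.trans[OF expectation_square_le cost_error]) (use int in simp)
  have "(\<integral>\<^sup>+ \<omega>. ennreal ((norm (Y t \<omega> - interp_state T h (Yh P h \<eta>) t \<omega>))\<^sup>2) \<partial>M)
    = (\<integral>\<^sup>+ \<omega>. ennreal ((norm (a - (driver_gap t n \<omega> - ito_gap t n \<omega>)))\<^sup>2) \<partial>M)"
  proof (rule nn_integral_cong_AE)
    have "AE \<omega> in M. Y t \<omega> = expectation (cost P X Z)
                - (LINT s:{0..t}|lborel. driver P s (X s \<omega>) (Z s \<omega>)) + ito_integral P Z t \<omega>"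
      using sol t by (simp add: solves_def)
    then show "AE \<omega> in M. ennreal ((norm (Y t \<omega> - interp_state T h (Yh P h \<eta>) t \<omega>))\<^sup>2)
       = ennreal ((norm (a - (driver_gap t n \<omega> - ito_gap t n \<omega>)))\<^sup>2)"
    proof eventually_elim
      case (elim \<omega>)
      have "a = expectation (cost P X Z) - expectation (cost_h P h \<eta>)"
        unfolding a_def by (rule Bochner_Integration.integral_diff[OF int])
      then have "Y t \<omega> - interp_state T h (Yh P h \<eta>) t \<omega> = a - (driver_gap t n \<omega> - ito_gap t n \<omega>)"
        unfolding elim interp_state_eq[OF t] n_def[symmetric] Yh_def driver_gap_def ito_gap_def set_integral_clamped[OF t]
        by (simp add: mult.commute)
      then show ?case by simp
    qed
  qed
  also have "\<dots> \<le> 2 * (\<integral>\<^sup>+ \<omega>. ennreal ((norm a)\<^sup>2) \<partial>M)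
      + 2 * (\<integral>\<^sup>+ \<omega>. ennreal ((norm (driver_gap t n \<omega> - ito_gap t n \<omega>))\<^sup>2) \<partial>M)"
    by (rule nn_integral_norm_diff_square_le[OF borel_measurable_const borel_measurable_diff[OF gap_measurable[OF t n_def]]])
  also have "\<dots> \<le> 2 * (ennreal cost_const * D) + 2 * (ennreal ((2 * T + 8) * integral_const) * D)"
    using a by (intro add_mono mult_left_mono gap_difference_bound[OF t n_def]) (auto simp: emeasure_space_1)
  also have "\<dots> = (2 * ennreal cost_const + 2 * ennreal ((2 * T + 8) * integral_const)) * D"
    by (simp add: distrib_right mult.assoc)
  also have "2 * ennreal cost_const + 2 * ennreal ((2 * T + 8) * integral_const) = ennreal (2 * cost_const + 2 * ((2 * T + 8) * integral_const))"
    using consts_pos horizon_pos by (subst ennreal_plus) (simp_all add: ennreal_mult)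
  also have "2 * cost_const + 2 * ((2 * T + 8) * integral_const) = value_const"
    by (simp add: value_const_def algebra_simps)
  finally show ?thesis .
qed

text \<open>Writing \<open>D\<close> as a sum of squares of h^(\<alpha>/2) and \<mu>, it is at most
  the square of their sum; this turns the mean-square rate into the stated one.\<close>

lemma sqrt_bound:
  assumes x: "x \<le> ennreal C * D" and C: "0 \<le> C" and \<delta>: "\<delta> = \<mu> * \<mu>"
  shows "ennsqrt x \<le> ennreal (sqrt C) * (ennreal (h powr (\<alpha> / 2)) + \<mu>)"
proof (rule ennsqrt_le)
  define e where "e = ennreal (h powr (\<alpha> / 2))"
  have "ennreal (h powr \<alpha>) = e * e"
    unfolding e_def by (simp flip: ennreal_mult powr_add)
  then have "D = e * e + \<mu> * \<mu>" unfolding D_def using \<delta> by simp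
  also have "\<dots> \<le> (e + \<mu>) * (e + \<mu>)"
    by (simp add: distrib_left distrib_right add_ac add_mono add_increasing add_increasing2)
  finally have "x \<le> ennreal C * ((e + \<mu>) * (e + \<mu>))"
    using x by (meson mult_left_mono order.trans zero_le)
  also have "ennreal C = ennreal (sqrt C) * ennreal (sqrt C)"
    using C by (simp flip: ennreal_mult)
  finally show "x \<le> (ennreal (sqrt C) * (ennreal (h powr (\<alpha> / 2)) + \<mu>)) * (ennreal (sqrt C) * (ennreal (h powr (\<alpha> / 2)) + \<mu>))"
    by (simp add: e_def mult_ac)
qed

lemma total_error:
  assumes \<delta>: "\<delta> = \<mu> * \<mu>"
  shows "S2_norm P (\<lambda>t \<omega>. X t \<omega> - interp_state T h Xd t \<omega>)
      + S2_norm P (\<lambda>t \<omega>. Y t \<omega> - interp_state T h (Yh P h \<eta>) t \<omega>)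
      + H2_norm P (\<lambda>t \<omega>. Z t \<omega> - interp_control T h Zd t \<omega>)
    \<le> ennreal (sqrt state_const + sqrt value_const + sqrt integral_const) * (ennreal (h powr (\<alpha> / 2)) + \<mu>)"
proof -
  have "S2_norm P (\<lambda>t \<omega>. X t \<omega> - interp_state T h Xd t \<omega>) \<le> ennreal (sqrt state_const) * (ennreal (h powr (\<alpha> / 2)) + \<mu>)"
    unfolding S2_norm_def using consts_pos by (intro SUP_least sqrt_bound[OF _ _ \<delta>] state_norm_error) auto
  moreover have "S2_norm P (\<lambda>t \<omega>. Y t \<omega> - interp_state T h (Yh P h \<eta>) t \<omega>) \<le> ennreal (sqrt value_const) * (ennreal (h powr (\<alpha> / 2)) + \<mu>)"
    unfolding S2_norm_def using consts_pos by (intro SUP_least sqrt_bound[OF _ _ \<delta>] value_norm_error) auto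
  moreover have "H2_norm P (\<lambda>t \<omega>. Z t \<omega> - interp_control T h Zd t \<omega>) \<le> ennreal (sqrt integral_const) * (ennreal (h powr (\<alpha> / 2)) + \<mu>)"
    unfolding H2_norm_def using consts_pos by (intro sqrt_bound[OF _ _ \<delta>] control_norm_error) auto
  moreover have "ennreal (sqrt state_const + sqrt value_const + sqrt integral_const) = ennreal (sqrt state_const) + ennreal (sqrt value_const) + ennreal (sqrt integral_const)"
    using consts_pos by (simp add: ennreal_plus)
  ultimately show ?thesis
    by (simp only: distrib_right) (intro add_mono; assumption)
qed

end

section \<open>From the function-space hypotheses to the uniform error bound\<close>

theorem proposition4p4:
  fixes P :: "('w, 'd::finite, 'k::finite) control_problem"
    and \<alpha> lam :: real and \<beta> :: nat
    and \<zeta>s :: "real \<Rightarrow> real^'d \<Rightarrow> real^'k"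
    and \<zeta>h :: "real \<Rightarrow> real \<Rightarrow> nat \<Rightarrow> real^'d \<Rightarrow> real^'k"
  assumes "0 < horizon P"
    and "filtered_prob_space P"
    and "brownian_motion P"
    and "(0 \<le> \<alpha> \<and> \<alpha> \<le> 1/2 \<and> \<beta> = 1) \<or> (\<alpha> = 1 \<and> \<beta> = 2)"
    and "drift P \<in> CHb2 (horizon P) \<alpha> \<beta> \<beta>"
    and "diffusion P \<in> CHb1 (horizon P) \<alpha> \<beta>"
    and "driver P \<in> CHb2 (horizon P) \<alpha> \<beta> \<beta>"
    and "terminal P \<in> Cb 1"
    and "\<alpha> = 1 \<Longrightarrow> \<forall>t\<in>{0..horizon P}. \<forall>x v. frechet_derivative (diffusion P t) (at x) v = 0"
    and "is_unique_minimizer P 1 \<zeta>s"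
    and "\<zeta>s \<in> admissible_smooth P \<alpha> \<beta>"
    and "prob_space.variance (pspace P) (cost_of P \<zeta>s) = 0"
    and "\<And>\<mu> h. 0 \<le> \<mu> \<Longrightarrow> h \<in> step_sizes (horizon P) \<Longrightarrow>
           is_arg_min (Phi_h P \<mu> h) (\<lambda>\<zeta>. \<zeta> \<in> admissible_h P h) (\<zeta>h \<mu> h)"
    and "\<And>\<mu> h. 0 \<le> \<mu> \<Longrightarrow> h \<in> step_sizes (horizon P) \<Longrightarrow>
           \<zeta>h \<mu> h \<in> admissible_h_smooth P h \<beta>"
    and "\<And>\<mu>. 0 \<le> \<mu> \<Longrightarrow>
           (SUP h\<in>step_sizes (horizon P).
              triple_norm1 (horizon P) 0 \<beta> (interp_control (horizon P) h (\<zeta>h \<mu> h))) < \<infinity>"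
    and "0 < \<alpha>"
    and "0 < lam"
  shows "\<exists>C::real. 0 \<le> C \<and> (\<forall>h\<in>step_sizes (horizon P).
      S2_norm P (\<lambda>t \<omega>. X_of P \<zeta>s t \<omega>
        - interp_state (horizon P) h (Xh P h (\<zeta>h lam h)) t \<omega>)
      + S2_norm P (\<lambda>t \<omega>. Y_of P \<zeta>s t \<omega>
        - interp_state (horizon P) h (Yh P h (\<zeta>h lam h)) t \<omega>)
      + H2_norm P (\<lambda>t \<omega>. Z_of P \<zeta>s t \<omega>
        - interp_control (horizon P) h (Zh P h (\<zeta>h lam h)) t \<omega>)
      \<le> ennreal C * (ennreal (h powr (\<alpha> / 2))
          + (MAX n\<in>{0..nsteps (horizon P) h}. ennsqrt (\<integral>\<^sup>+ \<omega>.
               ennreal ((norm (\<zeta>s (grid h n) (Xh P h (\<zeta>h lam h) n \<omega>)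
                 - interp_control (horizon P) h (\<zeta>h lam h) (grid h n)
                     (Xh P h (\<zeta>h lam h) n \<omega>)))\<^sup>2) \<partial>pspace P))))"
proof -
  interpret brownian_setup P
    using assms(1-3) by unfold_locales
  have \<alpha>: "0 < \<alpha>" "\<alpha> \<le> 1" and \<beta>: "1 \<le> \<beta>" using assms(4,16) by auto
  have \<zeta>s: "\<zeta>s \<in> admissible P" "\<zeta>s \<in> CHb1 T \<alpha> \<beta>"
    using assms(11) by (auto simp: admissible_smooth_def)
  define X Y Z where "X = X_of P \<zeta>s" and "Y = Y_of P \<zeta>s" and "Z = Z_of P \<zeta>s"
  have sol: "solves P \<zeta>s X Y Z"
  proof -
    obtain X' Y' Z' where "solves P \<zeta>s X' Y' Z'"
      using \<zeta>s(1) by (auto simp: admissible_def)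
    \<comment> \<open>Admissibility provides some solution, so the choice made in
      \<open>solution\<close> is a solution as well.\<close>
    then have "case solution P \<zeta>s of (X, Y, Z) \<Rightarrow> solves P \<zeta>s X Y Z"
      unfolding solution_def by (intro someI[of "\<lambda>(X, Y, Z). solves P \<zeta>s X Y Z" "(X', Y', Z')"]) simp
    then show ?thesis
      by (simp add: X_def Y_def Z_def X_of_def Y_of_def Z_of_def case_prod_beta')
  qed
  obtain K1 where K1: "0 \<le> K1"
    "\<And>t s x y z w. t \<in> {0..T} \<Longrightarrow> s \<in> {0..T} \<Longrightarrow> norm (drift P t x z - drift P s y w)
         \<le> K1 * (norm (x - y) + norm (z - w) + (1 + norm x + norm z) * \<bar>t - s\<bar> powr \<alpha>)"
    "\<And>t x z. t \<in> {0..T} \<Longrightarrow> norm (drift P t x z) \<le> K1 * (1 + norm x + norm z)"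
    using CHb2_estimate[OF assms(5) \<beta> \<beta> \<alpha>(1)] by blast
  obtain K2 where K2: "0 \<le> K2"
    "\<And>t s x y z w. t \<in> {0..T} \<Longrightarrow> s \<in> {0..T} \<Longrightarrow> norm (driver P t x z - driver P s y w)
         \<le> K2 * (norm (x - y) + norm (z - w) + (1 + norm x + norm z) * \<bar>t - s\<bar> powr \<alpha>)"
    "\<And>t x z. t \<in> {0..T} \<Longrightarrow> norm (driver P t x z) \<le> K2 * (1 + norm x + norm z)"
    using CHb2_estimate[OF assms(7) \<beta> \<beta> \<alpha>(1)] by blast
  obtain K3 where K3: "0 \<le> K3"
    "\<And>t s x y. t \<in> {0..T} \<Longrightarrow> s \<in> {0..T} \<Longrightarrow>
       norm (diffusion P t x - diffusion P s y) \<le> K3 * (norm (x - y) + (1 + norm x) * \<bar>t - s\<bar> powr \<alpha>)"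
    "\<And>t x. t \<in> {0..T} \<Longrightarrow> norm (diffusion P t x) \<le> K3 * (1 + norm x)"
    using CHb1_estimate[OF assms(6) \<beta> \<alpha>(1)] by blast
  obtain K4 where K4: "0 \<le> K4"
    "\<And>t s x y. t \<in> {0..T} \<Longrightarrow> s \<in> {0..T} \<Longrightarrow>
       norm (\<zeta>s t x - \<zeta>s s y) \<le> K4 * (norm (x - y) + (1 + norm x) * \<bar>t - s\<bar> powr \<alpha>)"
    "\<And>t x. t \<in> {0..T} \<Longrightarrow> norm (\<zeta>s t x) \<le> K4 * (1 + norm x)"
    using CHb1_estimate[OF \<zeta>s(2) \<beta> \<alpha>(1)] by blast
  obtain K5 where K5: "0 \<le> K5" "\<And>x y. norm (terminal P x - terminal P y) \<le> K5 * norm (x - y)"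
    using Cb_lipschitz[OF assms(8)] by blast
  \<comment> \<open>The sum of nonnegative constants dominates each of them, so a single K serves
    all coefficients.\<close>
  define K where "K = K1 + K2 + K3 + K4 + K5"
  have Kge: "0 \<le> K" "K1 \<le> K" "K2 \<le> K" "K3 \<le> K" "K4 \<le> K" "K5 \<le> K"
    using K1(1) K2(1) K3(1) K4(1) K5(1) by (auto simp: K_def)
  define m where "m = enn2real (S2_norm P X * S2_norm P X)"
  have "S2_norm P X < \<infinity>" using sol by (simp add: solves_def S2_def)
  then have m_eq: "S2_norm P X * S2_norm P X = ennreal m"
    by (simp add: m_def ennreal_mult_less_top)
  have moment: "(\<integral>\<^sup>+ \<omega>. ennreal ((norm (X s \<omega>))\<^sup>2) \<partial>M) \<le> ennreal m" if s: "s \<in> {0..T}" for s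
  proof -
    have "ennsqrt (\<integral>\<^sup>+ \<omega>. ennreal ((norm (X s \<omega>))\<^sup>2) \<partial>M) \<le> S2_norm P X"
      unfolding S2_norm_def by (rule SUP_upper[OF s])
    then have "ennsqrt (\<integral>\<^sup>+ \<omega>. ennreal ((norm (X s \<omega>))\<^sup>2) \<partial>M) * ennsqrt (\<integral>\<^sup>+ \<omega>. ennreal ((norm (X s \<omega>))\<^sup>2) \<partial>M)
      \<le> S2_norm P X * S2_norm P X" by (intro mult_mono) auto
    then show ?thesis unfolding ennsqrt_mult_self m_eq .
  qed
  have cont: "continuous_on ({0..T} \<times> UNIV \<times> UNIV) (\<lambda>(t, x, z). drift P t x z)"
    "continuous_on ({0..T} \<times> UNIV \<times> UNIV) (\<lambda>(t, x, z). driver P t x z)"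
    "continuous_on ({0..T} \<times> UNIV) (\<lambda>(t, x). diffusion P t x)"
  proof -
    \<comment> \<open>The derivative of order 0, with an empty list of directions, is the function
      itself; the continuity clause for it is joint continuity of the coefficient.\<close>
    have "continuous_on ({0..T} \<times> UNIV \<times> UNIV) (\<lambda>(t, x, z). nderiv (\<lambda>x. drift P t x z) [] x)"
      using assms(5) by (simp only: CHb2_def mem_Collect_eq list.size le0)
    then show "continuous_on ({0..T} \<times> UNIV \<times> UNIV) (\<lambda>(t, x, z). drift P t x z)" by simp
    have "continuous_on ({0..T} \<times> UNIV \<times> UNIV) (\<lambda>(t, x, z). nderiv (\<lambda>x. driver P t x z) [] x)"
      using assms(7) by (simp only: CHb2_def mem_Collect_eq list.size le0)
    then show "continuous_on ({0..T} \<times> UNIV \<times> UNIV) (\<lambda>(t, x, z). driver P t x z)" by simp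
    have "continuous_on ({0..T} \<times> UNIV) (\<lambda>(t, x). nderiv (diffusion P t) [] x)"
      using assms(6) by (simp only: CHb1_def mem_Collect_eq list.size le0)
    then show "continuous_on ({0..T} \<times> UNIV) (\<lambda>(t, x). diffusion P t x)" by simp
  qed
  interpret controlled_system P \<alpha> K m \<zeta>s X Y Z
  proof unfold_locales
    show "solves P \<zeta>s X Y Z" by (rule sol)
    show "0 < \<alpha>" "\<alpha> \<le> 1" by (rule \<alpha>)+
    show "0 \<le> K" by (rule Kge)
    show "0 \<le> m" by (simp add: m_def)
    fix t s :: real and x y :: "real^'d" and z w :: "real^'k"
    assume t: "t \<in> {0..T}"
    show "norm (drift P t x z) \<le> K * (1 + norm x + norm z)"
      by (rule order.trans[OF K1(3)[OF t]]) (intro mult_right_mono Kge, simp)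
    show "norm (driver P t x z) \<le> K * (1 + norm x + norm z)"
      by (rule order.trans[OF K2(3)[OF t]]) (intro mult_right_mono Kge, simp)
    show "norm (diffusion P t x) \<le> K * (1 + norm x)"
      by (rule order.trans[OF K3(3)[OF t]]) (intro mult_right_mono Kge, simp)
    show "norm (\<zeta>s t x) \<le> K * (1 + norm x)"
      by (rule order.trans[OF K4(3)[OF t]]) (intro mult_right_mono Kge, simp)
    show "(\<integral>\<^sup>+ \<omega>. ennreal ((norm (X t \<omega>))\<^sup>2) \<partial>M) \<le> ennreal m" by (rule moment[OF t])
    assume s: "s \<in> {0..T}"
    show "norm (drift P t x z - drift P s y w)
         \<le> K * (norm (x - y) + norm (z - w) + (1 + norm x + norm z) * \<bar>t - s\<bar> powr \<alpha>)"
      by (rule order.trans[OF K1(2)[OF t s]]) (intro mult_right_mono Kge, simp)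
    show "norm (driver P t x z - driver P s y w)
         \<le> K * (norm (x - y) + norm (z - w) + (1 + norm x + norm z) * \<bar>t - s\<bar> powr \<alpha>)"
      by (rule order.trans[OF K2(2)[OF t s]]) (intro mult_right_mono Kge, simp)
    show "norm (diffusion P t x - diffusion P s y) \<le> K * (norm (x - y) + (1 + norm x) * \<bar>t - s\<bar> powr \<alpha>)"
      by (rule order.trans[OF K3(2)[OF t s]]) (intro mult_right_mono Kge, simp)
    show "norm (\<zeta>s t x - \<zeta>s s y) \<le> K * (norm (x - y) + (1 + norm x) * \<bar>t - s\<bar> powr \<alpha>)"
      by (rule order.trans[OF K4(2)[OF t s]]) (intro mult_right_mono Kge, simp)
  next
    fix x y :: "real^'d"
    show "norm (terminal P x - terminal P y) \<le> K * norm (x - y)"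
      by (rule order.trans[OF K5(2)]) (intro mult_right_mono Kge, simp)
  qed (rule cont)+
  show ?thesis
  proof (intro exI conjI ballI)
    \<comment> \<open>The witness is assembled from constants of \<open>controlled_system\<close>,
      before h is introduced.\<close>
    show "0 \<le> sqrt state_const + sqrt value_const + sqrt integral_const" using consts_pos by simp
    fix h assume h: "h \<in> step_sizes T"
    let ?N = "nsteps T h"
    let ?Xd = "Xh P h (\<zeta>h lam h)"
    let ?e = "\<lambda>n. \<integral>\<^sup>+ \<omega>. ennreal ((norm (\<zeta>s (grid h n) (?Xd n \<omega>)
        - interp_control T h (\<zeta>h lam h) (grid h n) (?Xd n \<omega>)))\<^sup>2) \<partial>M"
    define \<mu> where "\<mu> = (MAX n\<in>{0..?N}. ennsqrt (?e n))"
    have adm: "\<zeta>h lam h \<in> admissible_h P h"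
      using assms(14)[OF _ h, of lam] assms(17) by (simp add: admissible_h_smooth_def)
    have \<delta>: "(\<integral>\<^sup>+ \<omega>. ennreal ((norm (\<zeta>s (grid h j) (?Xd j \<omega>) - \<zeta>h lam h j (?Xd j \<omega>)))\<^sup>2) \<partial>M) \<le> \<mu> * \<mu>"
      if j: "j < ?N" for j
    proof -
      \<comment> \<open>A grid point belongs to the cell it starts, and for j < N the truncation at
        the last control index is inactive.\<close>
      have "interp_control T h (\<zeta>h lam h) (grid h j) = \<zeta>h lam h j"
        using j step_sizes_facts[OF h] floor_index_eq[of h j "grid h j"]
        by (simp add: interp_control_def interp_def grid_def)
      then have "(\<integral>\<^sup>+ \<omega>. ennreal ((norm (\<zeta>s (grid h j) (?Xd j \<omega>) - \<zeta>h lam h j (?Xd j \<omega>)))\<^sup>2) \<partial>M)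
        = ennsqrt (?e j) * ennsqrt (?e j)"
        by (simp add: ennsqrt_mult_self)
      also have "\<dots> \<le> \<mu> * \<mu>"
      proof -
        have "ennsqrt (?e j) \<le> \<mu>" unfolding \<mu>_def using j by (intro Max_ge) auto
        then show ?thesis by (intro mult_mono) auto
      qed
      finally show ?thesis .
    qed
    \<comment> \<open>The gap bound is taken to be a square, the form that \<open>sqrt_bound\<close>
      asks for.\<close>
    interpret discretized_system P \<alpha> K m \<zeta>s X Y Z h "\<zeta>h lam h" "\<mu> * \<mu>"
      by unfold_locales (rule h adm \<delta>, assumption?)+
    show "S2_norm P (\<lambda>t \<omega>. X_of P \<zeta>s t \<omega> - interp_state T h (Xh P h (\<zeta>h lam h)) t \<omega>)
      + S2_norm P (\<lambda>t \<omega>. Y_of P \<zeta>s t \<omega> - interp_state T h (Yh P h (\<zeta>h lam h)) t \<omega>)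
      + H2_norm P (\<lambda>t \<omega>. Z_of P \<zeta>s t \<omega> - interp_control T h (Zh P h (\<zeta>h lam h)) t \<omega>)
      \<le> ennreal (sqrt state_const + sqrt value_const + sqrt integral_const) * (ennreal (h powr (\<alpha> / 2))
          + (MAX n\<in>{0..?N}. ennsqrt (?e n)))"
      using total_error[OF refl] unfolding X_def Y_def Z_def \<mu>_def .
  qed
qed

end
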